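(* If $\mathsf{WS}_\alpha$ is a PTAS for the weighted sum scalarization of a MOMILP, then the inner approximation algorithm described in the context can be used to construct a multi-objective convex polynomial-time approximation scheme (cPTAS). If $\mathsf{WS}_\alpha$ is an FPTAS for the weighted sum scalarization, then the inner approximation algorithm can be used to construct a multi-objective convex fully polynomial-time approximation scheme (cFPTAS).
   Context: MOMILP. For $d,m,n\in\mathbb{N}_{>0}$, $Q\in\mathbb{Q}^{d\times n}$, $A\in\mathbb{Q}^{m\times n}$, $b\in\mathbb{Q}^m$ and $n_{\mathbb{R}},n_{\mathbb{Z}}\in\mathbb{N}_{\ge 0}$ with $n_{\mathbb{R}}+n_{\mathbb{Z}}=n$, a multi-objective mixed-integer linear program (MOMILP) is the problem $\min f(x)=Qx$ subject to $Ax\ge b$, $x\in\mathbb{R}^{n_{\mathbb{R}}}\times\mathbb{Z}^{n_{\mathbb{Z}}}$. $X$ denotes its set of feasible solutions and $Y=\{f(x):x\in X\}\subseteq\mathbb{R}^d$ its set of images. An instance $I$ need not be explicitly encoded in this form. Standing assumptions: $X\ne\emptyset$, $Y\subseteq\mathbb{R}^d_{\ge 0}$, and the number $d$ of objectives is a constant. $\langle\cdot\rangle$ denotes binary encoding length; inequalities between vectors are componentwise; sums of sets are Minkowski sums; $\mathsf{conv}$ is the convex hull. Convex approximation. A set $R\subseteq X$ is a $(1+\varepsilon)$-convex approximation set if for each $x\in X$ there is $v\in\mathsf{conv}\{f(x^* ):x^*\in R\}$ with $v\le(1+\varepsilon)f(x)$. A multi-objective convex approximation scheme is an algorithm that takes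 a MOMILP instance $I$ and $\varepsilon\in\mathbb{Q}_{>0}$ and outputs a $(1+\varepsilon)$-convex approximation set. It is a cPTAS if for every fixed $\varepsilon$ its running time is in $\mathcal{O}(\mathsf{poly}(\langle I\rangle))$, and a cFPTAS if its running time for every $\varepsilon$ is in $\mathcal{O}(\mathsf{poly}(\langle I\rangle,\varepsilon^{-1}))$. PTAS and FPTAS denote the usual single-objective approximation schemes. Approximate weighted sum oracle. For $w\in\mathbb{R}^d_{\ge0}$, the weighted sum scalarization is the single-objective problem $\min\{w^{\mathsf T}f(x):x\in X\}$. For $\alpha>1$, an $\alpha$-approximation algorithm $\mathsf{WS}_\alpha$ for it returns, on input $w$, a solution $x^*\in X$ with $w^{\mathsf T}f(x^* )\le\alpha\,w^{\mathsf T}f(x)$ for all $x\in X$; the returned solutions are assumed to have encoding length in $\mathcal{O}(\mathsf{poly}(\langle I\rangle))$. The oracle $\mathsf{hpO}\text{-}\mathsf{WS}_\alpha$, given $H=\{z\in\mathbb{R}^d:w^{\mathsf T}z\ge c\}$, computes $x^*\gets\mathsf{WS}_\alpha(w)$ and returns $(\textit{inside},\emptyset)$ if $w^{\mathsf T}f(x^* )\ge c$ and $(\textit{not inside},x^* )$ otherwise. Facet-supporting halfspaces. For a polyhedron $\mathcal{P}$, $\mathcal{H}(\mathcal{P})$ is the set of halfspaces that contain $\mathcal{P}$ and whose boundary contains a facet of $\mathcal{P}$. Inner approximation algorithm (with oracle $\mathsf{hpO}$, factor $1+\varepsilon$ and initial solution $x^{\mathrm{init}}\in X$ with encoding length in $\mathcal{O}(\mathsf{poly}(\langle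 I\rangle))$). Initialize $R=\{x^{\mathrm{init}}\}$, $k=1$, $F=\emptyset$, $\mathcal{A}^{(1)}=\{f(x^{\mathrm{init}})\}+\mathbb{R}^d_{\ge0}$. While $\mathcal{H}(\mathcal{A}^{(k)})\setminus F\ne\emptyset$: pick an arbitrary halfspace $H=\{z\in\mathbb{R}^d:w^{\mathsf T}z\ge c\}\in\mathcal{H}(\mathcal{A}^{(k)})\setminus F$; set $H_{1+\varepsilon}=\{z\in\mathbb{R}^d:(1+\varepsilon)w^{\mathsf T}z\ge c\}$; call $\mathsf{hpO}(H_{1+\varepsilon})$. If it returns $(\textit{not inside},x^* )$, set $R\gets R\cup\{x^*\}$, $k\gets k+1$, $\mathcal{A}^{(k)}\gets\mathsf{conv}\{f(x):x\in R\}+\mathbb{R}^d_{\ge0}$; otherwise set $F\gets F\cup\{H\}$. The output is $R$ at termination.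
   Formalization: Running times of an FPTAS and a cFPTAS may also be polynomial in the encoding length of ε, since merely reading ε is not bounded in ⟨I⟩ and 1/ε; for instances not explicitly encoded, f(x) is assumed computable in polynomial time from I and x, as the oracle and algorithm need it. *)

theory Defs
  imports
    "HOL-Analysis.Analysis"
    "HOL-Computational_Algebra.Polynomial"
    "HOL-Library.Log_Nat"
    "Jordan_Normal_Form.Matrix"
begin

no_notation Matrix.vec_index (infixl \<open>$\<close> 100)
no_notation Matrix.scalar_prod (infix \<open>\<bullet>\<close> 70)
unbundle inner_syntax

section \<open>Algorithms and running time\<close>

text \<open>
  Algorithms are programs of a small deeply embedded WHILE language. Data are binary trees with
  rational leaves; a rational is measured by the binary length of its reduced numerator and
  denominator. Every basic operation is charged the encoding lengths of its argument and of its
  result, so that every intermediate value of a run is no longer than the running time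
  (\<open>len_le_time\<close> below), and the operations are computable in polynomial time on a Turing
  machine. Conversely the language simulates Turing machines with polynomial overhead (tape
  halves are lists). Hence running times agree with Turing machine time up to a polynomial.
\<close>

datatype val = VNum rat | VPair val val

definition rat_len :: "rat \<Rightarrow> nat" where
  "rat_len q = (case quotient_of q of (a, b) \<Rightarrow> 1 + floorlog 2 (nat \<bar>a\<bar>) + floorlog 2 (nat b))"

fun len :: "val \<Rightarrow> nat" where
  "len (VNum q) = rat_len q"
| "len (VPair x y) = 1 + len x + len y"

datatype basic = Const val | Ident | Fst | Snd | IsPair | Add | Mul | Divide | Less | Floor

text \<open>Operations applied to arguments of the wrong shape return \<open>0\<close>, which also serves as the
  truth value false; every other value counts as true.\<close>

definition truth :: "bool \<Rightarrow> val" where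
  "truth b = VNum (if b then 1 else 0)"

fun apply_basic :: "basic \<Rightarrow> val \<Rightarrow> val" where
  "apply_basic (Const v) x = v"
| "apply_basic Ident x = x"
| "apply_basic Fst (VPair x y) = x"
| "apply_basic Snd (VPair x y) = y"
| "apply_basic IsPair (VPair x y) = truth True"
| "apply_basic Add (VPair (VNum a) (VNum b)) = VNum (a + b)"
| "apply_basic Mul (VPair (VNum a) (VNum b)) = VNum (a * b)"
| "apply_basic Divide (VPair (VNum a) (VNum b)) = VNum (a / b)"
| "apply_basic Less (VPair (VNum a) (VNum b)) = truth (a < b)"
| "apply_basic Floor (VNum a) = VNum (of_int \<lfloor>a\<rfloor>)"
| "apply_basic _ _ = VNum 0"

text \<open>A program maps a value to a value: \<open>Then p q\<close> feeds the result of \<open>p\<close> to \<open>q\<close>,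
  \<open>Fork p q\<close> pairs the results of both, \<open>While p q\<close> iterates \<open>q\<close> while \<open>p\<close> yields true.\<close>

datatype prog =
    Basic basic
  | Then prog prog
  | Fork prog prog
  | Cond prog prog prog
  | While prog prog

text \<open>\<open>run p x t y\<close>: on input \<open>x\<close> the program \<open>p\<close> halts after time \<open>t\<close> with output \<open>y\<close>.\<close>

inductive run :: "prog \<Rightarrow> val \<Rightarrow> nat \<Rightarrow> val \<Rightarrow> bool" where
  run_Basic: "run (Basic b) x (len x + len (apply_basic b x)) (apply_basic b x)"
| run_Then: "run p x s y \<Longrightarrow> run q y t z \<Longrightarrow> run (Then p q) x (s + t + 1) z"
| run_Fork: "run p x s y \<Longrightarrow> run q x t z \<Longrightarrow> run (Fork p q) x (s + t + 1) (VPair y z)"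
| run_CondT: "run c x s b \<Longrightarrow> b \<noteq> VNum 0 \<Longrightarrow> run p x t y \<Longrightarrow> run (Cond c p q) x (s + t + 1) y"
| run_CondF: "run c x s (VNum 0) \<Longrightarrow> run q x t y \<Longrightarrow> run (Cond c p q) x (s + t + 1) y"
| run_WhileF: "run c x s (VNum 0) \<Longrightarrow> run (While c p) x (s + 1) x"
| run_WhileT: "run c x s b \<Longrightarrow> b \<noteq> VNum 0 \<Longrightarrow> run p x t y \<Longrightarrow> run (While c p) y u z
    \<Longrightarrow> run (While c p) x (s + t + u + 1) z"

lemma run_deterministic:
  "run p x t y \<Longrightarrow> run p x t' y' \<Longrightarrow> t = t' \<and> y = y'"
proof (induction arbitrary: t' y' rule: run.induct)
  case (run_Basic b x)
  then show ?case by (auto elim: run.cases)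
next
  case (run_Then p x s y q t z)
  from run_Then.prems show ?case by cases (use run_Then.IH in blast)
next
  case (run_Fork p x s y q t z)
  from run_Fork.prems show ?case by cases (use run_Fork.IH in blast)
next
  case (run_CondT c x s b p t y q)
  from run_CondT.prems show ?case by cases (use run_CondT.IH run_CondT.hyps in blast)+
next
  case (run_CondF c x s q t y p)
  from run_CondF.prems show ?case by cases (use run_CondF.IH in blast)+
next
  case (run_WhileF c x s p)
  from run_WhileF.prems show ?case by cases (use run_WhileF.IH in blast)+
next
  case (run_WhileT c x s b p t y u z)
  from run_WhileT.prems show ?case by cases (use run_WhileT.IH run_WhileT.hyps in blast)+
qed

lemma len_le_time: "run p x t y \<Longrightarrow> len x \<le> t \<and> len y \<le> t"
  by (induction rule: run.induct) auto


section \<open>Encodings\<close>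

fun enc_list :: "val list \<Rightarrow> val" where
  "enc_list [] = VNum 0"
| "enc_list (x # xs) = VPair x (enc_list xs)"

definition enc_sol :: "rat Matrix.vec \<Rightarrow> val" where
  "enc_sol x = enc_list (map VNum (list_of_vec x))"

text \<open>The index type of the objectives is enumerable only in order to fix the order in which the
  components of a vector are listed.\<close>

definition enc_vec :: "rat ^ 'd::enum \<Rightarrow> val" where
  "enc_vec w = enc_list (map (\<lambda>j. VNum (w $ j)) enum_class.enum)"

definition real_vec :: "rat ^ 'd \<Rightarrow> real ^ 'd" where
  "real_vec w = (\<chi> j. of_rat (w $ j))"

definition real_sol :: "rat Matrix.vec \<Rightarrow> real Matrix.vec" where
  "real_sol x = map_vec of_rat x"


section \<open>Multi-objective mixed-integer linear programs\<close>

text \<open>The number \<open>d\<close> of objectives is the cardinality of the type \<open>'d\<close>, hence constant; \<open>objrow\<close>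
  lists the rows of the objective matrix. The numbers of variables and constraints vary.\<close>

record 'd momilp =
  nreal :: nat
  nint :: nat
  nconstr :: nat
  objrow :: "'d \<Rightarrow> rat Matrix.vec"
  cmat :: "rat mat"
  crhs :: "rat Matrix.vec"

definition nvars :: "'d momilp \<Rightarrow> nat" where
  "nvars M = nreal M + nint M"

definition wf_momilp :: "'d momilp \<Rightarrow> bool" where
  "wf_momilp M \<longleftrightarrow> nvars M > 0 \<and> nconstr M > 0 \<and> (\<forall>j. objrow M j \<in> carrier_vec (nvars M))
     \<and> cmat M \<in> carrier_mat (nconstr M) (nvars M) \<and> crhs M \<in> carrier_vec (nconstr M)"

definition objective :: "'d::finite momilp \<Rightarrow> real Matrix.vec \<Rightarrow> real ^ 'd" where
  "objective M x = (\<chi> j. Matrix.scalar_prod (map_vec of_rat (objrow M j)) x)"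

definition feasible :: "'d momilp \<Rightarrow> real Matrix.vec set" where
  "feasible M = {x \<in> carrier_vec (nvars M).
     map_mat of_rat (cmat M) *\<^sub>v x \<ge> map_vec of_rat (crhs M)
     \<and> (\<forall>i. nreal M \<le> i \<and> i < nvars M \<longrightarrow> Matrix.vec_index x i \<in> \<int>)}"

definition images :: "'d::finite momilp \<Rightarrow> (real ^ 'd) set" where
  "images M = objective M ` feasible M"

text \<open>A class of MOMILP instances: \<open>prob I\<close> is the program underlying the instance \<open>I\<close> and
  \<open>code I\<close> the representation of \<open>I\<close> that algorithms work on. The code need not list the data of
  \<open>prob I\<close>; as usual for optimization problems, it only has to allow evaluation of the objective
  functions in polynomial time.\<close>

definition ilen :: "('i \<Rightarrow> val) \<Rightarrow> 'i \<Rightarrow> real" where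
  "ilen code I = real (len (code I))"

definition objective_polytime :: "('i \<Rightarrow> val) \<Rightarrow> ('i \<Rightarrow> 'd::enum momilp) \<Rightarrow> bool" where
  "objective_polytime code prob \<longleftrightarrow> (\<exists>E p. \<forall>I x. real_sol x \<in> feasible (prob I) \<longrightarrow>
     (\<exists>t y. run E (VPair (code I) (enc_sol x)) t (enc_vec y)
        \<and> real_vec y = objective (prob I) (real_sol x)
        \<and> real t \<le> poly p (ilen code I + real (len (enc_sol x)))))"

definition momilp_class :: "('i \<Rightarrow> val) \<Rightarrow> ('i \<Rightarrow> 'd::enum momilp) \<Rightarrow> bool" where
  "momilp_class code prob \<longleftrightarrow>
     (\<forall>I. wf_momilp (prob I) \<and> feasible (prob I) \<noteq> {} \<and> images (prob I) \<subseteq> {y. 0 \<le> y})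
     \<and> objective_polytime code prob"


section \<open>Convex approximation schemes\<close>

definition convex_approx_set :: "'d::finite momilp \<Rightarrow> real \<Rightarrow> real Matrix.vec set \<Rightarrow> bool" where
  "convex_approx_set M \<alpha> R \<longleftrightarrow> R \<subseteq> feasible M
     \<and> (\<forall>x \<in> feasible M. \<exists>v \<in> convex hull (objective M ` R). v \<le> \<alpha> *\<^sub>R objective M x)"

definition scheme_input :: "('i \<Rightarrow> val) \<Rightarrow> 'i \<Rightarrow> rat \<Rightarrow> val" where
  "scheme_input code I \<epsilon> = VPair (code I) (VNum \<epsilon>)"

definition enc_sols :: "rat Matrix.vec list \<Rightarrow> val" where
  "enc_sols xs = enc_list (map enc_sol xs)"

definition convex_approx_scheme ::
    "('i \<Rightarrow> val) \<Rightarrow> ('i \<Rightarrow> 'd::enum momilp) \<Rightarrow> prog \<Rightarrow> bool" where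
  "convex_approx_scheme code prob S \<longleftrightarrow> (\<forall>I. \<forall>\<epsilon>>0. \<exists>t xs.
     run S (scheme_input code I \<epsilon>) t (enc_sols xs)
     \<and> convex_approx_set (prob I) (1 + of_rat \<epsilon>) (real_sol ` set xs))"

definition cPTAS :: "('i \<Rightarrow> val) \<Rightarrow> ('i \<Rightarrow> 'd::enum momilp) \<Rightarrow> prog \<Rightarrow> bool" where
  "cPTAS code prob S \<longleftrightarrow> convex_approx_scheme code prob S
     \<and> (\<forall>\<epsilon>>0. \<exists>p. \<forall>I t y. run S (scheme_input code I \<epsilon>) t y \<longrightarrow> real t \<le> poly p (ilen code I))"

text \<open>In the fully polynomial case the length of \<open>\<epsilon>\<close>, which is part of the input and cannot be
  bounded in terms of \<open>1 / \<epsilon>\<close>, enters the bound: merely reading \<open>\<epsilon>\<close> takes that long. A polynomial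
  bound in several nonnegative quantities amounts to a polynomial bound in their sum.\<close>

definition eps_len :: "rat \<Rightarrow> real" where
  "eps_len \<epsilon> = real (rat_len \<epsilon>) + 1 / of_rat \<epsilon>"

definition cFPTAS :: "('i \<Rightarrow> val) \<Rightarrow> ('i \<Rightarrow> 'd::enum momilp) \<Rightarrow> prog \<Rightarrow> bool" where
  "cFPTAS code prob S \<longleftrightarrow> convex_approx_scheme code prob S
     \<and> (\<exists>p. \<forall>I. \<forall>\<epsilon>>0. \<forall>t y. run S (scheme_input code I \<epsilon>) t y
          \<longrightarrow> real t \<le> poly p (ilen code I + eps_len \<epsilon>))"


section \<open>Approximation schemes for the weighted sum scalarization\<close>

text \<open>The accuracy \<open>\<epsilon>\<close> stands for the approximation factor \<open>\<alpha> = 1 + \<epsilon>\<close>. Weights handed to a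
  program are rational.\<close>

definition ws_input :: "('i \<Rightarrow> val) \<Rightarrow> 'i \<Rightarrow> rat \<Rightarrow> rat ^ 'd::enum \<Rightarrow> val" where
  "ws_input code I \<epsilon> w = VPair (code I) (VPair (VNum \<epsilon>) (enc_vec w))"

definition ws_approx :: "'d::finite momilp \<Rightarrow> real \<Rightarrow> real ^ 'd \<Rightarrow> real Matrix.vec \<Rightarrow> bool" where
  "ws_approx M \<alpha> w x \<longleftrightarrow> x \<in> feasible M
     \<and> (\<forall>x' \<in> feasible M. w \<bullet> objective M x \<le> \<alpha> * (w \<bullet> objective M x'))"

definition ws_approx_scheme ::
    "('i \<Rightarrow> val) \<Rightarrow> ('i \<Rightarrow> 'd::enum momilp) \<Rightarrow> prog \<Rightarrow> bool" where
  "ws_approx_scheme code prob WS \<longleftrightarrow> (\<forall>I. \<forall>\<epsilon>>0. \<forall>w::(rat, 'd) Finite_Cartesian_Product.vec. 0 \<le> w \<longrightarrow>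
     (\<exists>t x. run WS (ws_input code I \<epsilon> w) t (enc_sol x)
        \<and> ws_approx (prob I) (1 + of_rat \<epsilon>) (real_vec w) (real_sol x)))"

definition ws_PTAS :: "('i \<Rightarrow> val) \<Rightarrow> ('i \<Rightarrow> 'd::enum momilp) \<Rightarrow> prog \<Rightarrow> bool" where
  "ws_PTAS code prob WS \<longleftrightarrow> ws_approx_scheme code prob WS
     \<and> (\<forall>\<epsilon>>0. \<exists>p. \<forall>I. \<forall>w::(rat, 'd) Finite_Cartesian_Product.vec. 0 \<le> w \<longrightarrow> (\<forall>t y. run WS (ws_input code I \<epsilon> w) t y
          \<longrightarrow> real t \<le> poly p (ilen code I + real (len (enc_vec w)))))
     \<and> (\<forall>\<epsilon>>0. \<exists>p. \<forall>I. \<forall>w::(rat, 'd) Finite_Cartesian_Product.vec. 0 \<le> w \<longrightarrow> (\<forall>t y. run WS (ws_input code I \<epsilon> w) t y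
          \<longrightarrow> real (len y) \<le> poly p (ilen code I)))"

definition ws_FPTAS :: "('i \<Rightarrow> val) \<Rightarrow> ('i \<Rightarrow> 'd::enum momilp) \<Rightarrow> prog \<Rightarrow> bool" where
  "ws_FPTAS code prob WS \<longleftrightarrow> ws_approx_scheme code prob WS
     \<and> (\<exists>p. \<forall>I. \<forall>\<epsilon>>0. \<forall>w::(rat, 'd) Finite_Cartesian_Product.vec. 0 \<le> w \<longrightarrow> (\<forall>t y. run WS (ws_input code I \<epsilon> w) t y
          \<longrightarrow> real t \<le> poly p (ilen code I + real (len (enc_vec w)) + eps_len \<epsilon>)))
     \<and> (\<exists>p. \<forall>I. \<forall>\<epsilon>>0. \<forall>w::(rat, 'd) Finite_Cartesian_Product.vec. 0 \<le> w \<longrightarrow> (\<forall>t y. run WS (ws_input code I \<epsilon> w) t y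
          \<longrightarrow> real (len y) \<le> poly p (ilen code I)))"

definition ws_fun :: "('i \<Rightarrow> val) \<Rightarrow> prog \<Rightarrow> 'i \<Rightarrow> rat \<Rightarrow> rat ^ 'd::enum \<Rightarrow> rat Matrix.vec" where
  "ws_fun code WS I \<epsilon> w = (THE x. \<exists>t. run WS (ws_input code I \<epsilon> w) t (enc_sol x))"


section \<open>The inner approximation algorithm\<close>

definition halfspace :: "real ^ 'd \<Rightarrow> real \<Rightarrow> (real ^ 'd::finite) set" where
  "halfspace w c = {z. w \<bullet> z \<ge> c}"

definition facet_halfspaces :: "(real ^ 'd::finite) set \<Rightarrow> (real ^ 'd) set set" where
  "facet_halfspaces P = {H. (\<exists>w c. w \<noteq> 0 \<and> H = halfspace w c) \<and> P \<subseteq> H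
     \<and> (\<exists>G. G facet_of P \<and> G \<subseteq> frontier H)}"

datatype 's answer = Inside | NotInside 's

definition hpO_WS :: "('s \<Rightarrow> real ^ 'd::finite) \<Rightarrow> (rat ^ 'd \<Rightarrow> 's) \<Rightarrow> rat ^ 'd \<Rightarrow> real \<Rightarrow> 's answer"
  where "hpO_WS f ws w c =
    (let x = ws w in if real_vec w \<bullet> f x \<ge> c then Inside else NotInside x)"

definition inner_approx :: "('s \<Rightarrow> real ^ 'd::finite) \<Rightarrow> 's set \<Rightarrow> (real ^ 'd) set" where
  "inner_approx f R = convex hull (f ` R) + {z. 0 \<le> z}"

text \<open>One iteration on states \<open>(R, F)\<close>. The algorithm manipulates a halfspace through a rational
  normal vector \<open>w\<close>; the oracle is called on \<open>{z. (1 + \<epsilon>) w\<^sup>T z \<ge> c}\<close>.\<close>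

inductive inner_step :: "('s \<Rightarrow> real ^ 'd::finite) \<Rightarrow> (rat ^ 'd \<Rightarrow> 's) \<Rightarrow> rat \<Rightarrow>
    's set \<times> (real ^ 'd) set set \<Rightarrow> 's set \<times> (real ^ 'd) set set \<Rightarrow> bool"
  for f ws \<epsilon> where
  not_inside: "halfspace (real_vec w) c \<in> facet_halfspaces (inner_approx f R) - F
    \<Longrightarrow> hpO_WS f ws ((1 + \<epsilon>) *s w) c = NotInside x
    \<Longrightarrow> inner_step f ws \<epsilon> (R, F) (insert x R, F)"
| inside: "halfspace (real_vec w) c \<in> facet_halfspaces (inner_approx f R) - F
    \<Longrightarrow> hpO_WS f ws ((1 + \<epsilon>) *s w) c = Inside
    \<Longrightarrow> inner_step f ws \<epsilon> (R, F) (R, insert (halfspace (real_vec w) c) F)"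

definition inner_algorithm_output ::
    "('s \<Rightarrow> real ^ 'd::finite) \<Rightarrow> (rat ^ 'd \<Rightarrow> 's) \<Rightarrow> rat \<Rightarrow> 's \<Rightarrow> 's set \<Rightarrow> bool" where
  "inner_algorithm_output f ws \<epsilon> x_init R \<longleftrightarrow> (\<exists>F. (inner_step f ws \<epsilon>)\<^sup>*\<^sup>* ({x_init}, {}) (R, F)
     \<and> facet_halfspaces (inner_approx f R) - F = {})"

text \<open>The program \<open>S\<close> arises from the inner approximation algorithm with oracle \<open>WS\<close>: for accuracy
  \<open>\<epsilon>\<close>, it outputs the result of a terminated execution with factor \<open>1 + \<eta> \<epsilon>\<close> and oracle
  \<open>hpO-WS\<^sub>\<alpha>\<close> for \<open>\<alpha> = 1 + \<delta> \<epsilon>\<close>. The factor and \<open>\<alpha>\<close> cannot both be \<open>1 + \<epsilon>\<close>, since the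
  errors multiply.\<close>

definition built_by_inner_approximation ::
    "('i \<Rightarrow> val) \<Rightarrow> ('i \<Rightarrow> 'd::enum momilp) \<Rightarrow> prog \<Rightarrow> prog \<Rightarrow> bool" where
  "built_by_inner_approximation code prob WS S \<longleftrightarrow>
     (\<exists>(\<eta> :: rat \<Rightarrow> rat) (\<delta> :: rat \<Rightarrow> rat) (x_init :: 'i \<Rightarrow> rat Matrix.vec).
        (\<forall>\<epsilon>>0. \<eta> \<epsilon> > 0 \<and> \<delta> \<epsilon> > 0)
      \<and> (\<forall>I. real_sol (x_init I) \<in> feasible (prob I))
      \<and> (\<exists>p. \<forall>I. real (len (enc_sol (x_init I))) \<le> poly p (ilen code I))
      \<and> (\<forall>I. \<forall>\<epsilon>>0. \<forall>t xs. run S (scheme_input code I \<epsilon>) t (enc_sols xs) \<longrightarrow>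
            inner_algorithm_output (\<lambda>x. objective (prob I) (real_sol x))
              (ws_fun code WS I (\<delta> \<epsilon>)) (\<eta> \<epsilon>) (x_init I) (set xs)))"

end

theory Submission
  imports Defs
begin

text \<open>
  The scheme runs the inner approximation algorithm with factor \<open>1 + \<eta>\<close> and a weighted sum oracle of
  factor \<open>1 + \<delta>\<close>, where \<open>\<eta> = \<epsilon> / 2\<close> and \<open>\<delta> = \<epsilon> / (\<epsilon> + 2)\<close>, so that \<open>(1 + \<eta>) (1 + \<delta>) = 1 + \<epsilon>\<close>.
  Let \<open>A = conv f(R) + \<real>\<^sup>d\<^sub>\<ge>\<^sub>0\<close> be the inner approximation for the current set \<open>R\<close> of solutions.

  Correctness. On termination the oracle, called for a facet inequality \<open>w\<^sup>T z \<ge> c\<close> of \<open>A\<close>, has answered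
  with a solution \<open>x*\<close> such that \<open>c \<le> (1 + \<eta>) w\<^sup>T f(x*)\<close>, and the latter is at most
  \<open>(1 + \<epsilon>) w\<^sup>T f(x)\<close> for every solution \<open>x\<close>. As \<open>A\<close> is the intersection of its facet halfspaces, it
  contains \<open>(1 + \<epsilon>) f(x)\<close>, which thus lies above a point of \<open>conv f(R)\<close> (\<open>convex_approx_sols\<close>).

  Number of iterations. A solution \<open>x*\<close> is added because \<open>(1 + \<eta>) w\<^sup>T f(x*) < c \<le> w\<^sup>T f(x)\<close> for the
  nonnegative weights \<open>w\<close> of some facet and for all \<open>x\<close> in \<open>R\<close>. Hence \<open>f(x) \<le> (1 + \<eta>) f(x*)\<close> holds for
  no \<open>x\<close> in \<open>R\<close>. The components of the images are rationals of polynomial length \<open>l\<close>, so they are \<open>0\<close>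
  or between \<open>2\<^sup>-\<^sup>l\<close> and \<open>2\<^sup>l\<close>, and rounding their logarithms to base \<open>1 + \<eta>\<close> puts the images into
  different cells of a grid with \<open>(2 r l + 2)\<^sup>d\<close> cells, where \<open>r \<ge> 1 / \<eta>\<close>
  (\<open>card_pairwise_nonapproximating\<close>). This is polynomial since \<open>d\<close> is constant.

  Facets. In homogeneous coordinates \<open>A\<close> is generated by the vectors \<open>(1, f(x))\<close> and \<open>(0, e\<^sub>j)\<close>. An
  inequality valid on all generators, with \<open>w \<noteq> 0\<close>, defines a facet if and only if up to a factor
  \<open>(- c, w)\<close> is the only vector orthogonal to the generators on which it is tight
  (\<open>facet_normal_imp_facet_halfspace\<close>, \<open>facet_halfspace_imp_facet_normal\<close>). So each facet normal is
  determined by \<open>d\<close> independent generators. A program can find it by trying all sequences of \<open>d\<close>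
  generators and, for each of them, restricting the whole space to the orthogonal complements of
  more and more of the generators by Gaussian elimination (\<open>facet_halfspaces_candidates\<close>). For
  constant \<open>d\<close> there are polynomially many sequences, with a constant number of eliminations each.

  Running time. The program is composed of combinators, each with a rule that bounds its running
  time by a polynomial, uniformly over a family of inputs (\<open>poly_time\<close>). The rules for loops pass to
  the family of all iterations, so that a loop is polynomial as soon as the number of iterations and,
  uniformly, the time of each iteration are. The bounds required of the given weighted sum algorithm
  are stated for an arbitrary set of pairs of an instance and an accuracy (\<open>inner_program\<close>). All
  instances with one fixed accuracy give the first claim, all pairs the second.
\<close>

section \<open>Encoding lengths of rationals\<close>

lemma floorlog2_mult_le: "floorlog 2 (a * b) \<le> floorlog 2 a + floorlog 2 b"
proof (rule floorlog_leI)
  have "a < 2 ^ floorlog 2 a" "b < 2 ^ floorlog 2 b"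
    by (rule floorlog_leD; simp)+
  then show "a * b < 2 ^ (floorlog 2 a + floorlog 2 b)"
    by (simp add: power_add mult_strict_mono)
qed auto

lemma floorlog2_add_le: "floorlog 2 (a + b) \<le> 1 + floorlog 2 a + floorlog 2 b"
proof (rule floorlog_leI)
  let ?p = "2 ^ floorlog 2 a :: nat" and ?q = "2 ^ floorlog 2 b :: nat"
  have "a < ?p" "b < ?q"
    by (rule floorlog_leD; simp)+
  moreover have "?p \<le> ?p * ?q" "?q \<le> ?p * ?q"
    by simp_all
  ultimately have "a + b < 2 * (?p * ?q)"
    by linarith
  then show "a + b < 2 ^ (1 + floorlog 2 a + floorlog 2 b)"
    by (simp add: power_add)
qed auto

lemma floorlog2_pos: "0 < b \<Longrightarrow> 1 \<le> floorlog 2 b"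
  by (simp add: floorlog_def)

lemma rat_len_ge_2: "2 \<le> rat_len q"
proof (cases "quotient_of q")
  case (Pair a b)
  then have "1 \<le> floorlog 2 (nat b)"
    using quotient_of_denom_pos[OF Pair] by (intro floorlog2_pos) simp
  then show ?thesis
    by (simp add: rat_len_def Pair)
qed

text \<open>Reducing a fraction divides both the numerator and the denominator, so that any fraction
  representing a rational bounds its length.\<close>

lemma rat_len_fraction_le:
  assumes "m \<noteq> 0"
  shows "rat_len (of_int n / of_int m) \<le> 1 + floorlog 2 (nat \<bar>n\<bar>) + floorlog 2 (nat \<bar>m\<bar>)"
proof (cases "quotient_of (of_int n / of_int m)")
  case (Pair a b)
  have b: "b > 0" and cop: "coprime a b" and eq: "(of_int n / of_int m :: rat) = of_int a / of_int b"
    using quotient_of_denom_pos[OF Pair] quotient_of_coprime[OF Pair] quotient_of_div[OF Pair] by auto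
  have "(of_int (n * b) :: rat) = of_int (a * m)"
    using eq b assms by (simp add: field_simps)
  then have nb: "n * b = a * m"
    by (simp only: of_int_eq_iff)
  have "a dvd n"
    using coprime_dvd_mult_left_iff[OF cop, of n] nb by simp
  have "b dvd m"
    using coprime_dvd_mult_right_iff[of b a m] cop nb[symmetric] by (simp add: coprime_commute)
  then have "\<bar>b\<bar> \<le> \<bar>m\<bar>"
    using assms by (rule dvd_imp_le_int[rotated])
  moreover have "\<bar>a\<bar> \<le> \<bar>n\<bar>"
  proof (cases "n = 0")
    case True
    then show ?thesis
      using nb assms by simp
  next
    case False
    then show ?thesis
      using \<open>a dvd n\<close> by (rule dvd_imp_le_int)
  qed
  ultimately show ?thesis
    using b unfolding rat_len_def Pair by (auto intro!: add_mono floorlog_mono)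
qed

lemma rat_len_add: "rat_len (p + q) \<le> 2 * (rat_len p + rat_len q)"
proof (cases "quotient_of p"; cases "quotient_of q")
  fix a b c d assume p: "quotient_of p = (a, b)" and q: "quotient_of q = (c, d)"
  have pos: "b > 0" "d > 0" and eq: "p = of_int a / of_int b" "q = of_int c / of_int d"
    using quotient_of_denom_pos[OF p] quotient_of_div[OF p] quotient_of_denom_pos[OF q]
      quotient_of_div[OF q] by auto
  have sum: "p + q = of_int (a * d + c * b) / of_int (b * d)"
    using pos by (simp add: eq field_simps)
  have "rat_len (p + q) \<le> 1 + floorlog 2 (nat \<bar>a * d + c * b\<bar>) + floorlog 2 (nat \<bar>b * d\<bar>)"
    unfolding sum using pos by (intro rat_len_fraction_le) auto
  moreover have "floorlog 2 (nat \<bar>a * d + c * b\<bar>) \<le> floorlog 2 (nat \<bar>a\<bar> * nat d + nat \<bar>c\<bar> * nat b)"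
    using pos by (intro floorlog_mono)
      (simp add: nat_mult_distrib[symmetric] nat_add_distrib[symmetric] abs_mult, simp add: nat_le_iff abs_mult abs_triangle_ineq[THEN order_trans])
  moreover have "\<dots> \<le> 1 + (floorlog 2 (nat \<bar>a\<bar>) + floorlog 2 (nat d))
      + (floorlog 2 (nat \<bar>c\<bar>) + floorlog 2 (nat b))"
    using floorlog2_add_le[of "nat \<bar>a\<bar> * nat d" "nat \<bar>c\<bar> * nat b"]
      floorlog2_mult_le[of "nat \<bar>a\<bar>" "nat d"] floorlog2_mult_le[of "nat \<bar>c\<bar>" "nat b"] by linarith
  moreover have "floorlog 2 (nat \<bar>b * d\<bar>) \<le> floorlog 2 (nat b) + floorlog 2 (nat d)"
    using floorlog2_mult_le[of "nat b" "nat d"] pos by (simp add: nat_mult_distrib abs_mult)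
  ultimately show ?thesis
    by (simp add: rat_len_def p q)
qed

lemma rat_len_mult: "rat_len (p * q) \<le> rat_len p + rat_len q"
proof (cases "quotient_of p"; cases "quotient_of q")
  fix a b c d assume p: "quotient_of p = (a, b)" and q: "quotient_of q = (c, d)"
  have pos: "b > 0" "d > 0" and eq: "p = of_int a / of_int b" "q = of_int c / of_int d"
    using quotient_of_denom_pos[OF p] quotient_of_div[OF p] quotient_of_denom_pos[OF q]
      quotient_of_div[OF q] by auto
  have "rat_len (p * q) \<le> 1 + floorlog 2 (nat \<bar>a * c\<bar>) + floorlog 2 (nat \<bar>b * d\<bar>)"
    using pos rat_len_fraction_le[of "b * d" "a * c"] by (simp add: eq)
  then show ?thesis
    using floorlog2_mult_le[of "nat \<bar>a\<bar>" "nat \<bar>c\<bar>"] floorlog2_mult_le[of "nat b" "nat d"] pos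
    by (simp add: rat_len_def p q abs_mult nat_mult_distrib)
qed

lemma rat_len_divide: "rat_len (p / q) \<le> rat_len p + rat_len q"
proof (cases "q = 0")
  case True
  then show ?thesis
    using rat_len_ge_2[of p] by (simp add: rat_len_def floorlog_def)
next
  case False
  show ?thesis
  proof (cases "quotient_of p"; cases "quotient_of q")
    fix a b c d assume p: "quotient_of p = (a, b)" and q: "quotient_of q = (c, d)"
    have pos: "b > 0" "d > 0" and eq: "p = of_int a / of_int b" "q = of_int c / of_int d"
      using quotient_of_denom_pos[OF p] quotient_of_div[OF p] quotient_of_denom_pos[OF q]
        quotient_of_div[OF q] by auto
    have "c \<noteq> 0"
      using False eq by auto
    then have "rat_len (p / q) \<le> 1 + floorlog 2 (nat \<bar>a * d\<bar>) + floorlog 2 (nat \<bar>b * c\<bar>)"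
      using pos rat_len_fraction_le[of "b * c" "a * d"] by (simp add: eq)
    then show ?thesis
      using floorlog2_mult_le[of "nat \<bar>a\<bar>" "nat d"] floorlog2_mult_le[of "nat b" "nat \<bar>c\<bar>"] pos
      by (simp add: rat_len_def p q abs_mult nat_mult_distrib)
  qed
qed

text \<open>Objective values of bounded length are thereby zero or in a bounded range of orders of
  magnitude, which makes the images of solutions countable.\<close>

lemma rat_abs_bounds:
  assumes "q \<noteq> 0" and "rat_len q \<le> l"
  shows "\<bar>q\<bar> \<le> 2 ^ l" and "1 \<le> \<bar>q\<bar> * 2 ^ l"
proof -
  obtain a b where q: "quotient_of q = (a, b)"
    by (cases "quotient_of q")
  have b: "b > 0" and eq: "q = of_int a / of_int b"
    using quotient_of_denom_pos[OF q] quotient_of_div[OF q] by auto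
  have a: "\<bar>a\<bar> \<ge> 1"
    using assms(1) eq by (cases "a = 0") auto
  have "nat \<bar>a\<bar> < 2 ^ floorlog 2 (nat \<bar>a\<bar>)" "nat b < 2 ^ floorlog 2 (nat b)"
    by (rule floorlog_leD; simp)+
  moreover have "floorlog 2 (nat \<bar>a\<bar>) \<le> l" "floorlog 2 (nat b) \<le> l"
    using assms(2) by (auto simp: rat_len_def q)
  then have "(2::nat) ^ floorlog 2 (nat \<bar>a\<bar>) \<le> 2 ^ l" "(2::nat) ^ floorlog 2 (nat b) \<le> 2 ^ l"
    by (auto intro: power_increasing)
  ultimately have "nat \<bar>a\<bar> \<le> 2 ^ l" "nat b \<le> 2 ^ l"
    by linarith+
  then have ab: "\<bar>a\<bar> \<le> 2 ^ l" "b \<le> 2 ^ l"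
    by (auto simp: nat_le_iff)
  have abr: "(\<bar>of_int a\<bar> :: rat) \<le> 2 ^ l" "(of_int b :: rat) \<le> 2 ^ l"
    using ab[folded of_int_le_iff[where 'a = rat]] by simp_all
  have b1: "(1::rat) \<le> of_int b"
    using b by simp
  have "(2::rat) ^ l * 1 \<le> 2 ^ l * of_int b"
    using b1 by (intro mult_left_mono) auto
  then have "(\<bar>of_int a\<bar> :: rat) \<le> 2 ^ l * of_int b"
    using abr by linarith
  then show "\<bar>q\<bar> \<le> 2 ^ l"
    using b by (simp add: eq pos_divide_le_eq)
  have "(1::rat) \<le> \<bar>of_int a\<bar>"
    using a by linarith
  then have "(of_int b::rat) \<le> \<bar>of_int a\<bar> * 2 ^ l"
    using abr mult_mono[of 1 "\<bar>of_int a\<bar> :: rat" "of_int b" "2 ^ l"] b by simp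
  then show "1 \<le> \<bar>q\<bar> * 2 ^ l"
    using b by (simp add: eq field_simps)
qed

section \<open>Polynomially bounded families and programs\<close>

text \<open>On natural numbers \<open>s\<close>, the powers of \<open>s + 2\<close> dominate all polynomials. As the base is at
  least two, a sum of two powers is again below a power, so a single exponent can serve as the bound.\<close>

definition poly_bounded :: "('k \<Rightarrow> nat) \<Rightarrow> 'k set \<Rightarrow> ('k \<Rightarrow> nat) \<Rightarrow> bool" where
  "poly_bounded \<sigma> K g \<longleftrightarrow> (\<exists>n. \<forall>k\<in>K. g k \<le> (\<sigma> k + 2) ^ n)"

text \<open>Running times are bounded uniformly over a family of runs, indexed by \<open>K\<close>, in terms of a
  size \<open>\<sigma>\<close> of the index. The size need not be a function of the input: a time may be polynomial in
  \<open>1 / \<epsilon>\<close>, which can be exponential in the length of \<open>\<epsilon>\<close>. Moreover the bounds of consecutive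
  programs refer to the same size, so that sequences of programs only add them; a polynomial in the
  length of the respective input would have to be substituted into the next one.\<close>

definition poly_time :: "('k \<Rightarrow> nat) \<Rightarrow> 'k set \<Rightarrow> prog \<Rightarrow> ('k \<Rightarrow> val) \<Rightarrow> ('k \<Rightarrow> val) \<Rightarrow> bool" where
  "poly_time \<sigma> K P x y \<longleftrightarrow> (\<exists>n. \<forall>k\<in>K. \<exists>t. run P (x k) t (y k) \<and> t \<le> (\<sigma> k + 2) ^ n)"

lemma poly_bounded_mono:
  "poly_bounded \<sigma> K g \<Longrightarrow> (\<And>k. k \<in> K \<Longrightarrow> h k \<le> g k) \<Longrightarrow> poly_bounded \<sigma> K h"
  unfolding poly_bounded_def by (meson order_trans)

lemma poly_bounded_const: "poly_bounded \<sigma> K (\<lambda>k. c)"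
proof -
  have "c \<le> (\<sigma> k + 2) ^ c" for k
    by (rule order_trans[OF less_imp_le[OF less_exp]]) (simp add: power_mono)
  then show ?thesis
    unfolding poly_bounded_def by blast
qed

lemma poly_bounded_add:
  assumes "poly_bounded \<sigma> K g" "poly_bounded \<sigma> K h"
  shows "poly_bounded \<sigma> K (\<lambda>k. g k + h k)"
proof -
  obtain n m where nm: "\<And>k. k \<in> K \<Longrightarrow> g k \<le> (\<sigma> k + 2) ^ n" "\<And>k. k \<in> K \<Longrightarrow> h k \<le> (\<sigma> k + 2) ^ m"
    using assms unfolding poly_bounded_def by blast
  have "g k + h k \<le> (\<sigma> k + 2) ^ (Suc (n + m))" if "k \<in> K" for k
  proof -
    have "(\<sigma> k + 2) ^ n \<le> (\<sigma> k + 2) ^ (n + m)" "(\<sigma> k + 2) ^ m \<le> (\<sigma> k + 2) ^ (n + m)"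
      by (auto intro: power_increasing)
    then have "g k + h k \<le> 2 * (\<sigma> k + 2) ^ (n + m)"
      using nm[OF that] by linarith
    also have "\<dots> \<le> (\<sigma> k + 2) * (\<sigma> k + 2) ^ (n + m)"
      by (intro mult_right_mono) auto
    finally show ?thesis by simp
  qed
  then show ?thesis unfolding poly_bounded_def by blast
qed

lemma poly_bounded_mult:
  assumes "poly_bounded \<sigma> K g" "poly_bounded \<sigma> K h"
  shows "poly_bounded \<sigma> K (\<lambda>k. g k * h k)"
proof -
  obtain n m where nm: "\<And>k. k \<in> K \<Longrightarrow> g k \<le> (\<sigma> k + 2) ^ n" "\<And>k. k \<in> K \<Longrightarrow> h k \<le> (\<sigma> k + 2) ^ m"
    using assms unfolding poly_bounded_def by blast
  have "g k * h k \<le> (\<sigma> k + 2) ^ (n + m)" if "k \<in> K" for k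
    unfolding power_add using nm[OF that] by (intro mult_le_mono)
  then show ?thesis unfolding poly_bounded_def by blast
qed

lemma poly_bounded_Suc: "poly_bounded \<sigma> K g \<Longrightarrow> poly_bounded \<sigma> K (\<lambda>k. Suc (g k))"
  using poly_bounded_add[OF _ poly_bounded_const[of \<sigma> K 1]] by simp

lemma poly_bounded_power: "poly_bounded \<sigma> K g \<Longrightarrow> poly_bounded \<sigma> K (\<lambda>k. g k ^ n)"
  by (induction n) (auto intro: poly_bounded_const poly_bounded_mult)

lemma poly_bounded_self: "poly_bounded \<sigma> K \<sigma>"
  unfolding poly_bounded_def by (rule exI[of _ 1]) simp

lemma poly_bounded_compose:
  assumes "poly_bounded \<tau> K g" "poly_bounded \<sigma> K \<tau>"
  shows "poly_bounded \<sigma> K g"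
proof -
  obtain n where "\<And>k. k \<in> K \<Longrightarrow> g k \<le> (\<tau> k + 2) ^ n"
    using assms unfolding poly_bounded_def by blast
  moreover have "poly_bounded \<sigma> K (\<lambda>k. (\<tau> k + 2) ^ n)"
    by (intro poly_bounded_power poly_bounded_add poly_bounded_const assms(2))
  ultimately show ?thesis
    using poly_bounded_mono by blast
qed

lemma poly_bounded_reindex:
  "poly_bounded \<sigma> K g \<Longrightarrow> (\<And>k. k \<in> L \<Longrightarrow> h k \<in> K) \<Longrightarrow> poly_bounded (\<lambda>k. \<sigma> (h k)) L (\<lambda>k. g (h k))"
  unfolding poly_bounded_def by meson

lemmas poly_bounded_intros = poly_bounded_const poly_bounded_add poly_bounded_mult
  poly_bounded_Suc poly_bounded_power

text \<open>The polynomials of the complexity notions have real coefficients of any sign, but on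
  nonnegative arguments each is dominated by a power of the argument increased by two.\<close>

lemma poly_le_power:
  fixes p :: "real poly"
  shows "\<exists>n. \<forall>s r. 0 \<le> r \<longrightarrow> r \<le> real s \<longrightarrow> poly p r \<le> real ((s + 2) ^ n)"
proof (induction p)
  case 0
  then show ?case by (intro exI[of _ 0]) simp
next
  case (pCons a p)
  then obtain n where n: "\<And>s r. 0 \<le> r \<Longrightarrow> r \<le> real s \<Longrightarrow> poly p r \<le> real ((s + 2) ^ n)"
    by blast
  obtain c where c: "a \<le> real c"
    using real_arch_simple by blast
  obtain m where m: "\<And>s. c + s * (s + 2) ^ n \<le> (s + 2) ^ m"
    using poly_bounded_add[OF poly_bounded_const poly_bounded_mult[OF poly_bounded_self
      poly_bounded_power[OF poly_bounded_add[OF poly_bounded_self poly_bounded_const]]],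
      of "\<lambda>s. s" UNIV c 2 n]
    unfolding poly_bounded_def by auto
  have "poly (pCons a p) r \<le> real ((s + 2) ^ m)" if r: "0 \<le> r" "r \<le> real s" for s r
  proof -
    have "poly p r \<le> real ((s + 2) ^ n)"
      using n r by blast
    then have "r * poly p r \<le> real s * real ((s + 2) ^ n)"
      using r by (meson mult_left_mono mult_right_mono of_nat_0_le_iff order_trans)
    then have "poly (pCons a p) r \<le> real (c + s * (s + 2) ^ n)"
      using c by simp
    also have "\<dots> \<le> real ((s + 2) ^ m)"
      using m[of s] by linarith
    finally show ?thesis .
  qed
  then show ?case by blast
qed

lemma poly_time_input: "poly_time \<sigma> K P x y \<Longrightarrow> poly_bounded \<sigma> K (\<lambda>k. len (x k))"
  and poly_time_output: "poly_time \<sigma> K P x y \<Longrightarrow> poly_bounded \<sigma> K (\<lambda>k. len (y k))"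
  unfolding poly_time_def poly_bounded_def by (meson len_le_time order_trans)+

lemma poly_timeI:
  assumes "poly_bounded \<sigma> K T" "\<And>k. k \<in> K \<Longrightarrow> \<exists>t. run P (x k) t (y k) \<and> t \<le> T k"
  shows "poly_time \<sigma> K P x y"
  using assms unfolding poly_time_def poly_bounded_def by (meson order_trans)

lemma poly_timeE:
  assumes "poly_time \<sigma> K P x y"
  obtains T where "poly_bounded \<sigma> K T" "\<And>k. k \<in> K \<Longrightarrow> run P (x k) (T k) (y k)"
proof -
  obtain n where "\<forall>k\<in>K. \<exists>t. run P (x k) t (y k) \<and> t \<le> (\<sigma> k + 2) ^ n"
    using assms unfolding poly_time_def by blast
  then obtain T where "\<forall>k\<in>K. run P (x k) (T k) (y k) \<and> T k \<le> (\<sigma> k + 2) ^ n"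
    by metis
  then show thesis
    by (intro that[of T]) (auto simp: poly_bounded_def)
qed

lemma poly_time_cong:
  "poly_time \<sigma> K P x' y' \<Longrightarrow> (\<And>k. k \<in> K \<Longrightarrow> x k = x' k) \<Longrightarrow> (\<And>k. k \<in> K \<Longrightarrow> y k = y' k)
    \<Longrightarrow> poly_time \<sigma> K P x y"
  unfolding poly_time_def by simp

lemma poly_time_reindex:
  "poly_time \<sigma> K P x y \<Longrightarrow> (\<And>k. k \<in> L \<Longrightarrow> h k \<in> K)
    \<Longrightarrow> poly_time (\<lambda>k. \<sigma> (h k)) L P (\<lambda>k. x (h k)) (\<lambda>k. y (h k))"
  unfolding poly_time_def by meson

lemma poly_time_subset: "poly_time \<sigma> K P x y \<Longrightarrow> L \<subseteq> K \<Longrightarrow> poly_time \<sigma> L P x y"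
  unfolding poly_time_def by blast

lemma poly_bounded_subset: "poly_bounded \<sigma> K g \<Longrightarrow> L \<subseteq> K \<Longrightarrow> poly_bounded \<sigma> L g"
  unfolding poly_bounded_def by blast

lemma poly_time_Basic:
  assumes "poly_bounded \<sigma> K (\<lambda>k. len (x k))" "poly_bounded \<sigma> K (\<lambda>k. len (apply_basic b (x k)))"
  shows "poly_time \<sigma> K (Basic b) x (\<lambda>k. apply_basic b (x k))"
  by (rule poly_timeI[OF poly_bounded_add[OF assms]]) (use run_Basic in blast)

lemma poly_time_Then:
  assumes "poly_time \<sigma> K P x y" "poly_time \<sigma> K Q y z"
  shows "poly_time \<sigma> K (Then P Q) x z"
proof -
  obtain S T where "poly_bounded \<sigma> K S" "\<And>k. k \<in> K \<Longrightarrow> run P (x k) (S k) (y k)"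
      "poly_bounded \<sigma> K T" "\<And>k. k \<in> K \<Longrightarrow> run Q (y k) (T k) (z k)"
    using assms by (metis poly_timeE)
  note ST = this
  show ?thesis
  proof (rule poly_timeI)
    show "poly_bounded \<sigma> K (\<lambda>k. S k + T k + 1)"
      by (intro poly_bounded_intros ST)
    show "\<exists>t. run (Then P Q) (x k) t (z k) \<and> t \<le> S k + T k + 1" if "k \<in> K" for k
      using run_Then[OF ST(2)[OF that] ST(4)[OF that]] by blast
  qed
qed

lemma poly_time_Fork:
  assumes "poly_time \<sigma> K P x y" "poly_time \<sigma> K Q x z"
  shows "poly_time \<sigma> K (Fork P Q) x (\<lambda>k. VPair (y k) (z k))"
proof -
  obtain S T where "poly_bounded \<sigma> K S" "\<And>k. k \<in> K \<Longrightarrow> run P (x k) (S k) (y k)"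
      "poly_bounded \<sigma> K T" "\<And>k. k \<in> K \<Longrightarrow> run Q (x k) (T k) (z k)"
    using assms by (metis poly_timeE)
  note ST = this
  show ?thesis
  proof (rule poly_timeI)
    show "poly_bounded \<sigma> K (\<lambda>k. S k + T k + 1)"
      by (intro poly_bounded_intros ST)
    show "\<exists>t. run (Fork P Q) (x k) t (VPair (y k) (z k)) \<and> t \<le> S k + T k + 1" if "k \<in> K" for k
      using run_Fork[OF ST(2)[OF that] ST(4)[OF that]] by blast
  qed
qed

lemma poly_time_Cond:
  assumes "poly_time \<sigma> K C x b"
    and "poly_time \<sigma> {k \<in> K. b k \<noteq> VNum 0} P x y" and "poly_time \<sigma> {k \<in> K. b k = VNum 0} Q x y"
  shows "poly_time \<sigma> K (Cond C P Q) x y"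
proof -
  obtain n m l where
    n: "\<And>k. k \<in> K \<Longrightarrow> \<exists>t. run C (x k) t (b k) \<and> t \<le> (\<sigma> k + 2) ^ n" and
    m: "\<And>k. k \<in> K \<Longrightarrow> b k \<noteq> VNum 0 \<Longrightarrow> \<exists>t. run P (x k) t (y k) \<and> t \<le> (\<sigma> k + 2) ^ m" and
    l: "\<And>k. k \<in> K \<Longrightarrow> b k = VNum 0 \<Longrightarrow> \<exists>t. run Q (x k) t (y k) \<and> t \<le> (\<sigma> k + 2) ^ l"
    using assms unfolding poly_time_def by blast
  show ?thesis
  proof (rule poly_timeI)
    show "poly_bounded \<sigma> K (\<lambda>k. (\<sigma> k + 2) ^ n + ((\<sigma> k + 2) ^ m + (\<sigma> k + 2) ^ l) + 1)"
      by (intro poly_bounded_intros poly_bounded_self)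
    fix k assume k: "k \<in> K"
    obtain s where s: "run C (x k) s (b k)" "s \<le> (\<sigma> k + 2) ^ n"
      using n[OF k] by blast
    show "\<exists>t. run (Cond C P Q) (x k) t (y k)
        \<and> t \<le> (\<sigma> k + 2) ^ n + ((\<sigma> k + 2) ^ m + (\<sigma> k + 2) ^ l) + 1"
    proof (cases "b k = VNum 0")
      case True
      then obtain t where "run Q (x k) t (y k)" "t \<le> (\<sigma> k + 2) ^ l"
        using l[OF k] by blast
      then show ?thesis
        using s True by (intro exI[of _ "s + t + 1"] conjI run_CondF) auto
    next
      case False
      then obtain t where "run P (x k) t (y k)" "t \<le> (\<sigma> k + 2) ^ m"
        using m[OF k] by blast
      then show ?thesis
        using s False by (intro exI[of _ "s + t + 1"] conjI run_CondT) auto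
    qed
  qed
qed

text \<open>The states of a loop form a family indexed by the number of completed iterations. One
  polynomial must bound the time of all iterations.\<close>

lemma poly_time_While:
  fixes st :: "'k \<Rightarrow> nat \<Rightarrow> val"
  assumes C: "poly_time (\<lambda>z. \<sigma> (fst z)) {(k, i). k \<in> K \<and> i \<le> N k} C
      (\<lambda>z. st (fst z) (snd z)) (\<lambda>z. truth (snd z < N (fst z)))"
    and P: "poly_time (\<lambda>z. \<sigma> (fst z)) {(k, i). k \<in> K \<and> i < N k} P
      (\<lambda>z. st (fst z) (snd z)) (\<lambda>z. st (fst z) (Suc (snd z)))"
    and N: "poly_bounded \<sigma> K N"
  shows "poly_time \<sigma> K (While C P) (\<lambda>k. st k 0) (\<lambda>k. st k (N k))"
proof -
  obtain n where n: "\<And>k i. k \<in> K \<Longrightarrow> i \<le> N k \<Longrightarrow>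
      \<exists>t. run C (st k i) t (truth (i < N k)) \<and> t \<le> (\<sigma> k + 2) ^ n"
    using C unfolding poly_time_def by (metis (mono_tags) case_prodI fst_conv mem_Collect_eq snd_conv)
  obtain m where m: "\<And>k i. k \<in> K \<Longrightarrow> i < N k \<Longrightarrow>
      \<exists>t. run P (st k i) t (st k (Suc i)) \<and> t \<le> (\<sigma> k + 2) ^ m"
    using P unfolding poly_time_def by (metis (mono_tags) case_prodI fst_conv mem_Collect_eq snd_conv)
  define T where "T k = (\<sigma> k + 2) ^ n + (\<sigma> k + 2) ^ m + 1" for k
  have loop: "\<exists>t. run (While C P) (st k i) t (st k (N k)) \<and> t \<le> (N k - i + 1) * T k"
    if kK: "k \<in> K" and iN: "i \<le> N k" for k i
    using iN
  proof (induction i rule: inc_induct)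
    case base
    obtain s where "run C (st k (N k)) s (truth False)" "s \<le> (\<sigma> k + 2) ^ n"
      using n[OF kK order_refl] by auto
    then have "run (While C P) (st k (N k)) (s + 1) (st k (N k))" "s + 1 \<le> T k"
      by (auto simp: T_def truth_def simp del: add_Suc_right Suc_eq_plus1 One_nat_def intro: run_WhileF)
    then show ?case
      by (intro exI[of _ "s + 1"]) simp
  next
    case (step i)
    obtain s where s: "run C (st k i) s (truth (i < N k))" "s \<le> (\<sigma> k + 2) ^ n"
      using n[of k i] kK step.hyps by auto
    obtain t where t: "run P (st k i) t (st k (Suc i))" "t \<le> (\<sigma> k + 2) ^ m"
      using m[of k i] kK step.hyps by auto
    obtain u where u: "run (While C P) (st k (Suc i)) u (st k (N k))"
        "u \<le> (N k - Suc i + 1) * T k"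
      using step.IH by blast
    have "run (While C P) (st k i) (s + t + u + 1) (st k (N k))"
      using s t u step.hyps by (intro run_WhileT) (auto simp: truth_def)
    moreover have "s + t + u + 1 \<le> T k + (N k - Suc i + 1) * T k"
      using s t u by (simp add: T_def)
    moreover have "N k - i + 1 = Suc (N k - Suc i + 1)"
      using step.hyps by simp
    ultimately show ?case
      by (metis mult_Suc)
  qed
  show ?thesis
  proof (rule poly_timeI)
    show "poly_bounded \<sigma> K (\<lambda>k. (N k + 1) * T k)"
      unfolding T_def by (intro poly_bounded_intros N poly_bounded_self)
    show "\<exists>t. run (While C P) (st k 0) t (st k (N k)) \<and> t \<le> (N k + 1) * T k" if "k \<in> K" for k
      using loop[OF that, of 0] by simp
  qed
qed

section \<open>A library of polynomial-time programs\<close>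

abbreviation input :: prog where "input \<equiv> Basic Ident"

definition constP :: "val \<Rightarrow> prog" where "constP v = Basic (Const v)"
definition fstP :: "prog \<Rightarrow> prog" where "fstP P = Then P (Basic Fst)"
definition sndP :: "prog \<Rightarrow> prog" where "sndP P = Then P (Basic Snd)"
definition nonemptyP :: "prog \<Rightarrow> prog" where "nonemptyP P = Then P (Basic IsPair)"
definition addP :: "prog \<Rightarrow> prog \<Rightarrow> prog" where "addP P Q = Then (Fork P Q) (Basic Add)"
definition multP :: "prog \<Rightarrow> prog \<Rightarrow> prog" where "multP P Q = Then (Fork P Q) (Basic Mul)"
definition divideP :: "prog \<Rightarrow> prog \<Rightarrow> prog" where "divideP P Q = Then (Fork P Q) (Basic Divide)"
definition lessP :: "prog \<Rightarrow> prog \<Rightarrow> prog" where "lessP P Q = Then (Fork P Q) (Basic Less)"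

lemma len_truth: "len (truth b) \<le> 3"
  by (simp add: truth_def rat_len_def floorlog_def)

lemma poly_time_input_val: "poly_bounded \<sigma> K (\<lambda>k. len (x k)) \<Longrightarrow> poly_time \<sigma> K input x x"
  using poly_time_Basic[of \<sigma> K x Ident] by simp

lemma poly_time_const: "poly_bounded \<sigma> K (\<lambda>k. len (x k)) \<Longrightarrow> poly_time \<sigma> K (constP v) x (\<lambda>k. v)"
  using poly_time_Basic[of \<sigma> K x "Const v"] by (simp add: constP_def poly_bounded_const)

text \<open>An operation is charged for its argument, which is covered by the time that it took to compute
  it, and for its result. Only the length of the result calls for a new bound.\<close>

lemma poly_time_Basic_after:
  assumes "poly_time \<sigma> K P x y" "\<And>k. k \<in> K \<Longrightarrow> z k = apply_basic b (y k)"
    and "poly_bounded \<sigma> K g" "\<And>k. k \<in> K \<Longrightarrow> len (z k) \<le> g k"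
  shows "poly_time \<sigma> K (Then P (Basic b)) x z"
proof -
  have "poly_time \<sigma> K (Basic b) y (\<lambda>k. apply_basic b (y k))"
    using assms by (intro poly_time_Basic poly_time_output[OF assms(1)] poly_bounded_mono[OF assms(3)]) auto
  then show ?thesis
    using assms(1,2) by (intro poly_time_Then[of _ _ _ _ y] poly_time_cong[of _ _ "Basic b" y _ y z]) auto
qed

lemma poly_time_fst: "poly_time \<sigma> K P x (\<lambda>k. VPair (a k) (b k)) \<Longrightarrow> poly_time \<sigma> K (fstP P) x a"
  unfolding fstP_def by (rule poly_time_Basic_after[OF _ _ poly_time_output]) auto

lemma poly_time_snd: "poly_time \<sigma> K P x (\<lambda>k. VPair (a k) (b k)) \<Longrightarrow> poly_time \<sigma> K (sndP P) x b"
  unfolding sndP_def by (rule poly_time_Basic_after[OF _ _ poly_time_output]) auto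

lemma poly_time_nonempty:
  assumes "poly_time \<sigma> K P x (\<lambda>k. enc_list (xs k))"
  shows "poly_time \<sigma> K (nonemptyP P) x (\<lambda>k. truth (xs k \<noteq> []))"
  unfolding nonemptyP_def
proof (rule poly_time_Basic_after[OF assms _ poly_bounded_const])
  show "truth (xs k \<noteq> []) = apply_basic IsPair (enc_list (xs k))" for k
    by (cases "xs k") (simp_all add: truth_def)
qed (rule len_truth)

lemma poly_time_arith:
  assumes "poly_time \<sigma> K P x (\<lambda>k. VNum (a k))" "poly_time \<sigma> K Q x (\<lambda>k. VNum (b k))"
  shows poly_time_add: "poly_time \<sigma> K (addP P Q) x (\<lambda>k. VNum (a k + b k))"
    and poly_time_mult: "poly_time \<sigma> K (multP P Q) x (\<lambda>k. VNum (a k * b k))"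
    and poly_time_divide: "poly_time \<sigma> K (divideP P Q) x (\<lambda>k. VNum (a k / b k))"
    and poly_time_less: "poly_time \<sigma> K (lessP P Q) x (\<lambda>k. truth (a k < b k))"
proof -
  have "poly_bounded \<sigma> K (\<lambda>k. rat_len (a k))" "poly_bounded \<sigma> K (\<lambda>k. rat_len (b k))"
    using assms[THEN poly_time_output] by simp_all
  then have g: "poly_bounded \<sigma> K (\<lambda>k. 2 * (rat_len (a k) + rat_len (b k)))"
    by (intro poly_bounded_intros)
  note Fork = poly_time_Fork[OF assms]
  show "poly_time \<sigma> K (addP P Q) x (\<lambda>k. VNum (a k + b k))"
    unfolding addP_def by (rule poly_time_Basic_after[OF Fork _ g]) (auto intro: order_trans[OF rat_len_add])
  show "poly_time \<sigma> K (multP P Q) x (\<lambda>k. VNum (a k * b k))"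
    unfolding multP_def
    by (rule poly_time_Basic_after[OF Fork _ g]) (auto intro: order_trans[OF rat_len_mult])
  show "poly_time \<sigma> K (divideP P Q) x (\<lambda>k. VNum (a k / b k))"
    unfolding divideP_def
    by (rule poly_time_Basic_after[OF Fork _ g]) (auto intro: order_trans[OF rat_len_divide])
  show "poly_time \<sigma> K (lessP P Q) x (\<lambda>k. truth (a k < b k))"
    unfolding lessP_def
    by (rule poly_time_Basic_after[OF Fork _ poly_bounded_const]) (auto intro: len_truth)
qed

lemma poly_time_Cond_truth:
  assumes "poly_time \<sigma> K C x (\<lambda>k. truth (b k))"
    and "poly_time \<sigma> {k \<in> K. b k} P x y" and "poly_time \<sigma> {k \<in> K. \<not> b k} Q x z"
  shows "poly_time \<sigma> K (Cond C P Q) x (\<lambda>k. if b k then y k else z k)"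
proof (rule poly_time_Cond[OF assms(1)])
  have "{k \<in> K. truth (b k) \<noteq> VNum 0} = {k \<in> K. b k}" "{k \<in> K. truth (b k) = VNum 0} = {k \<in> K. \<not> b k}"
    by (auto simp: truth_def)
  then show "poly_time \<sigma> {k \<in> K. truth (b k) \<noteq> VNum 0} P x (\<lambda>k. if b k then y k else z k)"
    "poly_time \<sigma> {k \<in> K. truth (b k) = VNum 0} Q x (\<lambda>k. if b k then y k else z k)"
    by (auto intro: poly_time_cong[OF assms(2)] poly_time_cong[OF assms(3)])
qed

lemma poly_time_Cond_num:
  assumes "poly_time \<sigma> K C x (\<lambda>k. VNum (a k))"
    and "poly_time \<sigma> {k \<in> K. a k \<noteq> 0} P x y" and "poly_time \<sigma> {k \<in> K. a k = 0} Q x z"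
  shows "poly_time \<sigma> K (Cond C P Q) x (\<lambda>k. if a k \<noteq> 0 then y k else z k)"
  by (rule poly_time_Cond[OF assms(1)])
    (auto intro: poly_time_cong[OF assms(2)] poly_time_cong[OF assms(3)])

subsection \<open>Lists\<close>

lemma len_enc_list: "len (enc_list xs) = 2 + (\<Sum>x\<leftarrow>xs. Suc (len x))"
  by (induction xs) (auto simp: rat_len_def floorlog_def)

lemma len_enc_list_bounds:
  "length xs \<le> len (enc_list xs)" "x \<in> set xs \<Longrightarrow> len x \<le> len (enc_list xs)"
  by (induction xs) auto

lemma len_enc_list_le: "(\<And>x. x \<in> set xs \<Longrightarrow> len x \<le> b) \<Longrightarrow> len (enc_list xs) \<le> 2 + length xs * Suc b"
proof (induction xs)
  case (Cons x xs)
  then have "len x \<le> b" "len (enc_list xs) \<le> 2 + length xs * Suc b"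
    by auto
  then show ?case by simp
qed (simp add: rat_len_def floorlog_def)

lemma len_enc_list_drop_le: "len (enc_list (drop i xs)) \<le> len (enc_list xs)"
proof -
  have "(\<Sum>x\<leftarrow>xs. Suc (len x)) = (\<Sum>x\<leftarrow>take i xs @ drop i xs. Suc (len x))"
    by simp
  then show ?thesis
    by (simp only: len_enc_list map_append sum_list_append)
qed

lemma len_enc_list_rev_concat:
  "(\<And>x. x \<in> set xs \<Longrightarrow> len (enc_list (f x)) \<le> b)
    \<Longrightarrow> len (enc_list (rev (concat (map f xs)))) \<le> 2 + length xs * b"
proof (induction xs)
  case (Cons x xs)
  then have "len (enc_list (f x)) \<le> b" "len (enc_list (rev (concat (map f xs)))) \<le> 2 + length xs * b"
    by auto
  then show ?case by (simp add: len_enc_list rev_map[symmetric])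
qed (simp add: rat_len_def floorlog_def)

definition rev_appendP :: prog where
  "rev_appendP = sndP (While (nonemptyP (fstP input))
     (Fork (sndP (fstP input)) (Fork (fstP (fstP input)) (sndP input))))"

lemma enc_list_drop: "i < length xs \<Longrightarrow> enc_list (drop i xs) = VPair (xs ! i) (enc_list (drop (Suc i) xs))"
  by (simp flip: Cons_nth_drop_Suc)

text \<open>Every iteration moves one element from one list to the other, so all states are as long as the
  first one, up to a constant.\<close>

lemma poly_time_rev_append:
  assumes "poly_time \<sigma> K P x (\<lambda>k. VPair (enc_list (ys k)) (enc_list (zs k)))"
  shows "poly_time \<sigma> K (Then P rev_appendP) x (\<lambda>k. enc_list (rev (ys k) @ zs k))"
proof -
  let ?body = "Fork (sndP (fstP input)) (Fork (fstP (fstP input)) (sndP input))"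
  define rest where "rest z = enc_list (drop (snd z) (ys (fst z)))" for z :: "'a \<times> nat"
  define acc where "acc z = enc_list (rev (take (snd z) (ys (fst z))) @ zs (fst z))" for z :: "'a \<times> nat"
  define st where "st z = VPair (rest z) (acc z)" for z
  define J where "J = {(k, i). k \<in> K \<and> i \<le> length (ys k)}"
  define J' where "J' = {(k, i). k \<in> K \<and> i < length (ys k)}"
  have in0: "poly_bounded \<sigma> K (\<lambda>k. len (VPair (enc_list (ys k)) (enc_list (zs k))))"
    by (rule poly_time_output[OF assms])
  have len_st: "len (st (k, i)) \<le> len (VPair (enc_list (ys k)) (enc_list (zs k))) + 4" for k i
  proof -
    have "(\<Sum>x\<leftarrow>take i (ys k). Suc (len x)) + (\<Sum>x\<leftarrow>drop i (ys k). Suc (len x)) = (\<Sum>x\<leftarrow>ys k. Suc (len x))"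
      by (simp only: sum_list_append[symmetric] map_append[symmetric] append_take_drop_id)
    then show ?thesis
      unfolding st_def rest_def acc_def by (simp add: len_enc_list rev_map[symmetric])
  qed
  have st_in: "poly_bounded (\<lambda>z. \<sigma> (fst z)) J (\<lambda>z. len (st z))"
    by (rule poly_bounded_mono[OF poly_bounded_reindex[OF
          poly_bounded_add[OF in0 poly_bounded_const[of _ _ 4]], where h = fst]])
      (use len_st in \<open>auto simp: J_def simp del: len.simps\<close>)
  have id: "poly_time (\<lambda>z. \<sigma> (fst z)) J input st (\<lambda>z. VPair (rest z) (acc z))"
    using poly_time_input_val[OF st_in] by (simp add: st_def[abs_def])
  have "J' \<subseteq> J"
    by (auto simp: J_def J'_def)
  note id' = poly_time_subset[OF id this]
  have rest: "rest z = VPair (ys (fst z) ! snd z) (rest (fst z, Suc (snd z)))" if "z \<in> J'" for z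
    using that by (auto simp: rest_def J'_def enc_list_drop)
  have fst': "poly_time (\<lambda>z. \<sigma> (fst z)) J' (fstP input) st
      (\<lambda>z. VPair (ys (fst z) ! snd z) (rest (fst z, Suc (snd z))))"
    by (rule poly_time_cong[OF poly_time_fst[OF id']]) (auto simp: rest)
  have "poly_time \<sigma> K (While (nonemptyP (fstP input)) ?body) (\<lambda>k. st (k, 0)) (\<lambda>k. st (k, length (ys k)))"
  proof (rule poly_time_While[of \<sigma> K "\<lambda>k. length (ys k)" _ "\<lambda>k i. st (k, i)"])
    have "poly_time (\<lambda>z. \<sigma> (fst z)) J (nonemptyP (fstP input)) st
        (\<lambda>z. truth (drop (snd z) (ys (fst z)) \<noteq> []))"
      using poly_time_fst[OF id] unfolding rest_def[abs_def] by (rule poly_time_nonempty)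
    then show "poly_time (\<lambda>z. \<sigma> (fst z)) {(k, i). k \<in> K \<and> i \<le> length (ys k)} (nonemptyP (fstP input))
        (\<lambda>z. st (fst z, snd z)) (\<lambda>z. truth (snd z < length (ys (fst z))))"
      unfolding J_def by (simp add: not_le)
    have "poly_time (\<lambda>z. \<sigma> (fst z)) J' ?body
        st (\<lambda>z. VPair (rest (fst z, Suc (snd z))) (VPair (ys (fst z) ! snd z) (acc z)))"
      by (intro poly_time_Fork poly_time_fst[OF fst'] poly_time_snd[OF fst'] poly_time_snd[OF id'])
    then show "poly_time (\<lambda>z. \<sigma> (fst z)) {(k, i). k \<in> K \<and> i < length (ys k)}
        ?body
        (\<lambda>z. st (fst z, snd z)) (\<lambda>z. st (fst z, Suc (snd z)))"
      unfolding J'_def[symmetric]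
      by (rule poly_time_cong) (auto simp: st_def acc_def J'_def take_Suc_conv_app_nth)
    show "poly_bounded \<sigma> K (\<lambda>k. length (ys k))"
      by (rule poly_bounded_mono[OF in0]) (use len_enc_list_bounds(1) in \<open>auto intro: le_SucI trans_le_add1\<close>)
  qed
  then have "poly_time \<sigma> K rev_appendP (\<lambda>k. st (k, 0)) (\<lambda>k. acc (k, length (ys k)))"
    unfolding rev_appendP_def st_def by (rule poly_time_snd)
  then show ?thesis
    using assms by (intro poly_time_Then[OF assms]) (simp add: st_def rest_def acc_def)
qed

text \<open>A comprehension over a list. The reversal is immaterial for the algorithm, which uses only the
  set of results; it allows the program to prepend each result to those found before.\<close>

definition collect :: "('a \<Rightarrow> 'b list) \<Rightarrow> 'a list \<Rightarrow> 'b list" where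
  "collect f xs = rev (concat (map f xs))"

lemma set_collect [simp]: "set (collect f xs) = (\<Union>x\<in>set xs. set (f x))"
  by (simp add: collect_def)

lemma collect_eq_Nil_iff: "collect f xs = [] \<longleftrightarrow> (\<forall>x\<in>set xs. f x = [])"
  by (auto simp: collect_def)

definition collectP :: "prog \<Rightarrow> prog" where
  "collectP P = sndP (Then (Fork input (constP (VNum 0)))
     (While (nonemptyP (sndP (fstP input)))
       (Fork (Fork (fstP (fstP input)) (sndP (sndP (fstP input))))
         (Then (Fork (Then (Fork (fstP (fstP input)) (fstP (sndP (fstP input)))) P) (sndP input))
           rev_appendP))))"

text \<open>The body runs on the family of all pairs of an index and a list element; this is how nested
  comprehensions remain polynomial. Its inputs are parts of the input of the whole, so their
  lengths are bounded for free. The accumulated result is bounded because it consists of at most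
  one output of the body for each element of a list of bounded length.\<close>

lemma poly_time_collect:
  fixes enc :: "'a \<Rightarrow> val" and enc' :: "'b \<Rightarrow> val"
  assumes L: "poly_time \<sigma> K L x (\<lambda>k. VPair (env k) (enc_list (map enc (xs k))))"
    and P: "poly_bounded (\<lambda>z. \<sigma> (fst z)) {(k, a). k \<in> K \<and> a \<in> set (xs k)}
          (\<lambda>z. len (VPair (env (fst z)) (enc (snd z))))
      \<Longrightarrow> poly_time (\<lambda>z. \<sigma> (fst z)) {(k, a). k \<in> K \<and> a \<in> set (xs k)} P
          (\<lambda>z. VPair (env (fst z)) (enc (snd z))) (\<lambda>z. enc_list (map enc' (f (fst z) (snd z))))"
  shows "poly_time \<sigma> K (Then L (collectP P)) x (\<lambda>k. enc_list (map enc' (collect (f k) (xs k))))"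
proof -
  let ?body = "Fork (Fork (fstP (fstP input)) (sndP (sndP (fstP input))))
    (Then (Fork (Then (Fork (fstP (fstP input)) (fstP (sndP (fstP input)))) P) (sndP input)) rev_appendP)"
  define ys where "ys k = map enc (xs k)" for k
  define out where "out i k = collect (f k) (take i (xs k))" for i k
  define rest where "rest z = enc_list (drop (snd z) (ys (fst z)))" for z :: "'c \<times> nat"
  define acc where "acc z = enc_list (map enc' (out (snd z) (fst z)))" for z :: "'c \<times> nat"
  define st where "st z = VPair (VPair (env (fst z)) (rest z)) (acc z)" for z
  define J where "J = {(k, i). k \<in> K \<and> i \<le> length (xs k)}"
  define J' where "J' = {(k, i). k \<in> K \<and> i < length (xs k)}"
  define E where "E = {(k, a). k \<in> K \<and> a \<in> set (xs k)}"
  have in0: "poly_bounded \<sigma> K (\<lambda>k. len (VPair (env k) (enc_list (ys k))))"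
    using poly_time_output[OF L] by (simp add: ys_def)
  have in_len: "length (xs k) \<le> len (VPair (env k) (enc_list (ys k)))" for k
    using len_enc_list_bounds(1)[of "ys k"] by (simp add: ys_def)
  have "poly_bounded (\<lambda>z. \<sigma> (fst z)) E (\<lambda>z. len (VPair (env (fst z)) (enc (snd z))))"
  proof (rule poly_bounded_mono[OF poly_bounded_reindex[OF in0, where h = fst]])
    show "len (VPair (env (fst z)) (enc (snd z))) \<le> len (VPair (env (fst z)) (enc_list (ys (fst z))))"
      if "z \<in> E" for z
      using that len_enc_list_bounds(2)[of "enc (snd z)" "ys (fst z)"] by (auto simp: ys_def E_def)
  qed (auto simp: E_def)
  then have P': "poly_time (\<lambda>z. \<sigma> (fst z)) E P
      (\<lambda>z. VPair (env (fst z)) (enc (snd z))) (\<lambda>z. enc_list (map enc' (f (fst z) (snd z))))"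
    using P unfolding E_def by blast
  obtain m where m: "\<And>z. z \<in> E \<Longrightarrow> len (enc_list (map enc' (f (fst z) (snd z)))) \<le> (\<sigma> (fst z) + 2) ^ m"
    using poly_time_output[OF P'] unfolding poly_bounded_def by blast
  define B where "B k = len (VPair (env k) (enc_list (ys k)))
      + (2 + len (VPair (env k) (enc_list (ys k))) * (\<sigma> k + 2) ^ m) + 3" for k
  have B: "poly_bounded \<sigma> K B"
    unfolding B_def[abs_def] by (intro poly_bounded_intros in0 poly_bounded_self)
  have len_st: "len (st z) \<le> B (fst z)" if "z \<in> J" for z
  proof -
    obtain k i where z: "z = (k, i)" "k \<in> K"
      using \<open>z \<in> J\<close> unfolding J_def by blast
    have "len (enc_list (map enc' (out i k))) \<le> 2 + length (take i (xs k)) * (\<sigma> k + 2) ^ m"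
    proof -
      have "len (enc_list (map enc' (f k a))) \<le> (\<sigma> k + 2) ^ m" if "a \<in> set (take i (xs k))" for a
        using m[of "(k, a)"] z in_set_takeD[OF that] by (simp add: E_def)
      then show ?thesis
        unfolding out_def collect_def rev_map[symmetric] map_concat map_map
        by (intro len_enc_list_rev_concat) simp
    qed
    moreover have "length (take i (xs k)) * (\<sigma> k + 2) ^ m \<le> len (VPair (env k) (enc_list (ys k))) * (\<sigma> k + 2) ^ m"
      by (intro mult_right_mono order_trans[OF _ in_len]) auto
    moreover have "len (enc_list (drop i (ys k))) \<le> len (enc_list (ys k))"
      by (rule len_enc_list_drop_le)
    ultimately show ?thesis
      by (simp add: st_def rest_def acc_def z B_def)
  qed
  have "poly_bounded (\<lambda>z. \<sigma> (fst z)) J (\<lambda>z. len (st z))"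
    by (rule poly_bounded_mono[OF poly_bounded_reindex[OF B, where h = fst]])
      (auto simp: J_def intro!: len_st)
  then have id: "poly_time (\<lambda>z. \<sigma> (fst z)) J input st (\<lambda>z. VPair (VPair (env (fst z)) (rest z)) (acc z))"
    using poly_time_input_val[of "\<lambda>z. \<sigma> (fst z)" J st] by (simp add: st_def[abs_def])
  have "J' \<subseteq> J"
    by (auto simp: J_def J'_def)
  note id' = poly_time_subset[OF id this]
  have rest: "rest z = VPair (enc (xs (fst z) ! snd z)) (rest (fst z, Suc (snd z)))" if "z \<in> J'" for z
    using that by (auto simp: rest_def J'_def ys_def enc_list_drop)
  have lst: "poly_time (\<lambda>z. \<sigma> (fst z)) J' (sndP (fstP input)) st
      (\<lambda>z. VPair (enc (xs (fst z) ! snd z)) (rest (fst z, Suc (snd z))))"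
    by (rule poly_time_cong[OF poly_time_snd[OF poly_time_fst[OF id']]]) (auto simp: rest)
  have "poly_time \<sigma> K (While (nonemptyP (sndP (fstP input)))
       ?body) (\<lambda>k. st (k, 0)) (\<lambda>k. st (k, length (xs k)))"
  proof (rule poly_time_While[of \<sigma> K "\<lambda>k. length (xs k)" _ "\<lambda>k i. st (k, i)"])
    have "poly_time (\<lambda>z. \<sigma> (fst z)) J (nonemptyP (sndP (fstP input))) st
        (\<lambda>z. truth (drop (snd z) (ys (fst z)) \<noteq> []))"
      using poly_time_snd[OF poly_time_fst[OF id]] unfolding rest_def[abs_def] by (rule poly_time_nonempty)
    then show "poly_time (\<lambda>z. \<sigma> (fst z)) {(k, i). k \<in> K \<and> i \<le> length (xs k)} (nonemptyP (sndP (fstP input)))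
        (\<lambda>z. st (fst z, snd z)) (\<lambda>z. truth (snd z < length (xs (fst z))))"
      unfolding J_def by (simp add: not_le ys_def)
    have "poly_time (\<lambda>z. \<sigma> (fst z)) J' P
        (\<lambda>z. VPair (env (fst z)) (enc (xs (fst z) ! snd z)))
        (\<lambda>z. enc_list (map enc' (f (fst z) (xs (fst z) ! snd z))))"
      using poly_time_reindex[OF P', of J' "\<lambda>z. (fst z, xs (fst z) ! snd z)"]
      by (auto simp: J'_def E_def)
    then have "poly_time (\<lambda>z. \<sigma> (fst z)) J'
        ?body st
        (\<lambda>z. VPair (VPair (env (fst z)) (rest (fst z, Suc (snd z))))
          (enc_list (rev (map enc' (f (fst z) (xs (fst z) ! snd z))) @ map enc' (out (snd z) (fst z)))))"
      using poly_time_snd[OF id'] unfolding acc_def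
      by (intro poly_time_Fork poly_time_rev_append poly_time_fst[OF lst] poly_time_snd[OF lst]
          poly_time_fst[OF poly_time_fst[OF id']] poly_time_Then[of _ _ _ _ "\<lambda>z. VPair (env (fst z)) (enc (xs (fst z) ! snd z))"])
    then show "poly_time (\<lambda>z. \<sigma> (fst z)) {(k, i). k \<in> K \<and> i < length (xs k)}
        ?body
        (\<lambda>z. st (fst z, snd z)) (\<lambda>z. st (fst z, Suc (snd z)))"
      unfolding J'_def[symmetric]
      by (rule poly_time_cong)
        (auto simp: st_def acc_def J'_def take_Suc_conv_app_nth out_def collect_def rev_map)
    show "poly_bounded \<sigma> K (\<lambda>k. length (xs k))"
      by (rule poly_bounded_mono[OF in0]) (rule in_len)
  qed
  note loop = this
  have "poly_time \<sigma> K (Fork input (constP (VNum 0))) (\<lambda>k. VPair (env k) (enc_list (ys k)))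
      (\<lambda>k. VPair (VPair (env k) (enc_list (ys k))) (VNum 0))"
    by (intro poly_time_Fork poly_time_input_val poly_time_const in0)
  then have "poly_time \<sigma> K (Fork input (constP (VNum 0))) (\<lambda>k. VPair (env k) (enc_list (ys k))) (\<lambda>k. st (k, 0))"
    by (simp add: st_def rest_def acc_def out_def collect_def)
  from poly_time_Then[OF this loop]
  have "poly_time \<sigma> K (collectP P) (\<lambda>k. VPair (env k) (enc_list (ys k))) (\<lambda>k. acc (k, length (xs k)))"
    unfolding collectP_def st_def[of "(_, length _)"] by (rule poly_time_snd)
  then show ?thesis
    using L by (intro poly_time_Then[OF L]) (simp add: ys_def acc_def out_def)
qed

section \<open>Facets of a convex hull plus the nonnegative orthant\<close>

text \<open>Homogeneous coordinates: a point \<open>y\<close> becomes \<open>(1, y)\<close> and a direction \<open>r\<close> becomes \<open>(0, r)\<close>.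
  The inequality \<open>w\<^sup>T z \<ge> c\<close> becomes the vector \<open>(- c, w)\<close>; it is valid for the polyhedron if its
  inner product with every generator is nonnegative, and a generator is called tight if the inner
  product is zero.\<close>

definition generators :: "(real ^ 'd::finite) set \<Rightarrow> (real \<times> (real ^ 'd)) set" where
  "generators Y = Pair 1 ` Y \<union> range (\<lambda>j. (0, axis j 1))"

definition upper_hull :: "(real ^ 'd::finite) set \<Rightarrow> (real ^ 'd) set" where
  "upper_hull Y = convex hull Y + {z. 0 \<le> z}"

definition halfspace_of :: "real \<times> (real ^ 'd::finite) \<Rightarrow> (real ^ 'd) set" where
  "halfspace_of v = halfspace (snd v) (- fst v)"

text \<open>The last condition says that the tight generators determine the inequality up to a factor: it
  is an extreme ray of the cone of valid inequalities.\<close>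

definition facet_normal :: "(real \<times> (real ^ 'd::finite)) set \<Rightarrow> real \<times> (real ^ 'd) \<Rightarrow> bool" where
  "facet_normal \<Gamma> v \<longleftrightarrow> snd v \<noteq> 0 \<and> (\<forall>g\<in>\<Gamma>. 0 \<le> v \<bullet> g)
     \<and> (\<forall>u. (\<forall>g\<in>\<Gamma>. v \<bullet> g = 0 \<longrightarrow> u \<bullet> g = 0) \<longrightarrow> u \<in> span {v})"

lemma ball_generators:
  "(\<forall>g\<in>generators Y. Q g) \<longleftrightarrow> (\<forall>y\<in>Y. Q (1, y)) \<and> (\<forall>j. Q (0, axis j 1))"
  by (auto simp: generators_def)

lemma inner_generators [simp]:
  "(v::real \<times> (real ^ 'd::finite)) \<bullet> (1, y) = fst v + snd v \<bullet> y" "v \<bullet> (0, axis j 1) = snd v $ j"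
  by (auto simp: inner_prod_def inner_axis)

lemma in_halfspace_of: "z \<in> halfspace_of v \<longleftrightarrow> 0 \<le> v \<bullet> (1, z)"
  by (auto simp: halfspace_of_def halfspace_def)

lemma inner_nonneg: "0 \<le> (w::real ^ 'd::finite) \<Longrightarrow> 0 \<le> r \<Longrightarrow> 0 \<le> w \<bullet> r"
  by (auto simp: inner_vec_def Finite_Cartesian_Product.less_eq_vec_def intro!: sum_nonneg)

lemma upper_hull_eq: "upper_hull Y = {h + r | h r. h \<in> convex hull Y \<and> 0 \<le> r}"
  by (auto simp: upper_hull_def set_plus_def)

lemma upper_hull_ray: "y \<in> Y \<Longrightarrow> 0 \<le> t \<Longrightarrow> y + t *\<^sub>R axis j 1 \<in> upper_hull Y"
  unfolding upper_hull_eq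
  by (intro CollectI exI[of _ y] exI[of _ "t *\<^sub>R axis j 1"])
    (auto simp: hull_inc Finite_Cartesian_Product.less_eq_vec_def axis_def)

lemma upper_hull_inc: "y \<in> Y \<Longrightarrow> y \<in> upper_hull Y"
  using upper_hull_ray[of y Y 0] by simp

lemma upper_hull_subset_halfspace:
  assumes "\<forall>g\<in>generators Y. 0 \<le> v \<bullet> g"
  shows "upper_hull Y \<subseteq> halfspace_of v"
proof
  fix z assume "z \<in> upper_hull Y"
  then obtain h r where z: "z = h + r" "h \<in> convex hull Y" "0 \<le> r"
    by (auto simp: upper_hull_eq)
  have Y: "Y \<subseteq> {y. snd v \<bullet> y \<ge> - fst v}" and w: "0 \<le> snd v"
    using assms by (force simp: ball_generators Finite_Cartesian_Product.less_eq_vec_def)+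
  have "convex hull Y \<subseteq> {y. snd v \<bullet> y \<ge> - fst v}"
    using Y by (intro hull_minimal convex_halfspace_ge)
  then have "snd v \<bullet> h \<ge> - fst v"
    using z by auto
  then show "z \<in> halfspace_of v"
    using inner_nonneg[OF w z(3)] by (simp add: in_halfspace_of z inner_add_right)
qed

text \<open>A negative coefficient \<open>w\<^sub>j\<close> is impossible, since the ray from \<open>y0\<close> in direction \<open>e\<^sub>j\<close> would leave
  the halfspace.\<close>

lemma valid_on_generators:
  fixes Y :: "(real ^ 'd::finite) set"
  assumes y0: "y0 \<in> Y" and sub: "upper_hull Y \<subseteq> halfspace_of v"
  shows "\<forall>g\<in>generators Y. 0 \<le> v \<bullet> g"
proof -
  have "0 \<le> snd v $ j" for j
  proof (rule ccontr)
    assume neg: "\<not> 0 \<le> snd v $ j"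
    define t where "t = (v \<bullet> (1, y0) + 1) / - (snd v $ j)"
    have "0 \<le> v \<bullet> (1, y0)"
      using sub upper_hull_inc[OF y0] in_halfspace_of by blast
    then have "0 \<le> t"
      unfolding t_def using neg by (intro divide_nonneg_pos) auto
    then have "0 \<le> v \<bullet> (1, y0 + t *\<^sub>R axis j 1)"
      using sub upper_hull_ray[OF y0] in_halfspace_of by blast
    then have "0 \<le> v \<bullet> (1, y0) + t * snd v $ j"
      by (simp add: inner_add_right inner_axis)
    moreover have "t * snd v $ j = - (v \<bullet> (1, y0) + 1)"
      using neg by (simp add: t_def field_simps)
    ultimately show False
      by linarith
  qed
  moreover have "0 \<le> v \<bullet> (1, y)" if "y \<in> Y" for y
    using sub upper_hull_inc[OF that] in_halfspace_of by blast
  ultimately show ?thesis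
    by (simp add: ball_generators)
qed

lemma sum_axis: "(r::real ^ 'd::finite) = (\<Sum>j\<in>UNIV. r $ j *\<^sub>R axis j 1)"
  by (simp add: Finite_Cartesian_Product.vec_eq_iff axis_def if_distrib sum.delta cong: if_cong)

text \<open>A point of the polyhedron on the hyperplane of a valid inequality is a combination of those
  generators that lie on the hyperplane, since no other generator can have a positive coefficient.\<close>

lemma orthogonal_tight_point:
  fixes v :: "real \<times> (real ^ 'd::finite)"
  assumes fin: "finite Y" and valid: "\<forall>g\<in>generators Y. 0 \<le> v \<bullet> g"
    and u: "\<forall>g\<in>generators Y. v \<bullet> g = 0 \<longrightarrow> u \<bullet> g = 0"
    and z: "z \<in> upper_hull Y" "v \<bullet> (1, z) = 0"
  shows "u \<bullet> (1, z) = 0"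
proof -
  obtain h r where hr: "z = h + r" "h \<in> convex hull Y" "0 \<le> r"
    using z by (auto simp: upper_hull_eq)
  obtain l where l: "\<And>y. y \<in> Y \<Longrightarrow> 0 \<le> l y" "sum l Y = 1" "h = (\<Sum>y\<in>Y. l y *\<^sub>R y)"
    using hr(2) by (auto simp: convex_hull_finite[OF fin])
  have expand: "x \<bullet> (1, z) = (\<Sum>y\<in>Y. l y * (x \<bullet> (1, y))) + (\<Sum>j\<in>UNIV. r $ j * (x \<bullet> (0, axis j 1)))"
    for x :: "real \<times> (real ^ 'd)"
  proof -
    have "(\<Sum>y\<in>Y. l y * (x \<bullet> (1, y))) = fst x + snd x \<bullet> h"
      using l(2) by (simp add: l(3) distrib_left sum.distrib inner_sum_right flip: sum_distrib_right)
    moreover have "(\<Sum>j\<in>UNIV. r $ j * (x \<bullet> (0, axis j 1))) = snd x \<bullet> r"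
      by (simp add: inner_vec_def mult.commute)
    ultimately show ?thesis
      by (simp add: hr(1) inner_add_right)
  qed
  have vY: "\<And>y. y \<in> Y \<Longrightarrow> 0 \<le> v \<bullet> (1, y)" and vj: "\<And>j. 0 \<le> v \<bullet> (0, axis j 1)"
    using valid unfolding ball_generators by blast+
  have rj: "0 \<le> r $ j" for j
    using hr(3) by (simp add: Finite_Cartesian_Product.less_eq_vec_def)
  have nonneg: "0 \<le> (\<Sum>y\<in>Y. l y * (v \<bullet> (1, y)))" "0 \<le> (\<Sum>j\<in>UNIV. r $ j * (v \<bullet> (0, axis j 1)))"
    using l(1) vY vj rj by (auto intro!: sum_nonneg mult_nonneg_nonneg simp del: inner_generators)
  then have "(\<Sum>y\<in>Y. l y * (v \<bullet> (1, y))) = 0" "(\<Sum>j\<in>UNIV. r $ j * (v \<bullet> (0, axis j 1))) = 0"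
    using z(2) unfolding expand[of v] by linarith+
  then have zero: "\<And>y. y \<in> Y \<Longrightarrow> l y * (v \<bullet> (1, y)) = 0" "\<And>j. r $ j * (v \<bullet> (0, axis j 1)) = 0"
    using l(1) vY vj rj fin
    by (simp_all add: sum_nonneg_eq_0_iff del: inner_generators)
  have "l y * (u \<bullet> (1, y)) = 0" if "y \<in> Y" for y
    using zero(1)[OF that] u that unfolding ball_generators by auto
  moreover have "r $ j * (u \<bullet> (0, axis j 1)) = 0" for j
    using zero(2)[of j] u unfolding ball_generators by (auto simp del: inner_generators)
  ultimately have "(\<Sum>y\<in>Y. l y * (u \<bullet> (1, y))) = 0" "(\<Sum>j\<in>UNIV. r $ j * (u \<bullet> (0, axis j 1))) = 0"
    by (intro sum.neutral ballI; blast)+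
  then show ?thesis
    unfolding expand[of u] by linarith
qed

lemma aff_dim_upper_hull:
  fixes Y :: "(real ^ 'd::finite) set"
  assumes "y \<in> Y"
  shows "aff_dim (upper_hull Y) = int CARD('d)"
proof -
  have "y \<in> upper_hull Y"
    using assms by (rule upper_hull_inc)
  have "axis j 1 \<in> (\<lambda>x. - y + x) ` upper_hull Y" for j
  proof (rule image_eqI[of _ _ "y + axis j 1"])
    show "y + axis j 1 \<in> upper_hull Y"
      using upper_hull_ray[OF assms, of 1 j] by simp
  qed simp
  then have "span (range (\<lambda>j. axis j 1 :: real ^ 'd)) \<subseteq> span ((\<lambda>x. - y + x) ` upper_hull Y)"
    by (intro span_mono) auto
  moreover have "x \<in> span (range (\<lambda>j. axis j 1 :: real ^ 'd))" for x
    by (subst sum_axis) (intro span_sum span_mul span_base, simp)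
  ultimately have "span ((\<lambda>x. - y + x) ` upper_hull Y) = UNIV"
    by blast
  then have "dim ((\<lambda>x. - y + x) ` upper_hull Y) = CARD('d)"
    by (metis dim_UNIV dim_span DIM_cart DIM_real mult_1_right)
  then show ?thesis
    using aff_dim_eq_dim[of y "upper_hull Y"] \<open>y \<in> upper_hull Y\<close> by (simp add: hull_inc)
qed

lemma convex_upper_hull: "convex (upper_hull Y)"
proof -
  have "convex {z :: real ^ 'd::finite. 0 \<le> z}"
    by (auto simp: convex_def Finite_Cartesian_Product.less_eq_vec_def)
  then show ?thesis
    unfolding upper_hull_def by (intro convex_set_plus convex_convex_hull)
qed

lemma closed_upper_hull: "finite Y \<Longrightarrow> closed (upper_hull Y)"
proof -
  assume "finite Y"
  then have "compact (convex hull Y)"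
    by (intro compact_convex_hull finite_imp_compact)
  moreover have "closed {z :: real ^ 'd::finite. 0 \<le> z}"
  proof -
    have "{z :: real ^ 'd. 0 \<le> z} = (\<Inter>j. {z. 0 \<le> z $ j})"
      by (auto simp: Finite_Cartesian_Product.less_eq_vec_def)
    then show ?thesis
      by (auto intro!: closed_INT closed_Collect_le continuous_intros)
  qed
  ultimately have "closed (\<Union>x\<in>convex hull Y. \<Union>y\<in>{z. 0 \<le> z}. {x + y})"
    by (rule compact_closed_sums)
  moreover have "(\<Union>x\<in>convex hull Y. \<Union>y\<in>{z. 0 \<le> z}. {x + y}) = upper_hull Y"
    by (auto simp: upper_hull_eq)
  ultimately show ?thesis by simp
qed

text \<open>A facet spans its hyperplane. A vector orthogonal to all tight generators is orthogonal to all
  points of the facet, hence vanishes on the whole hyperplane, hence is a multiple of \<open>(- c, w)\<close>.\<close>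

lemma facet_halfspace_imp_facet_normal:
  fixes Y :: "(real ^ 'd::finite) set"
  assumes fin: "finite Y" and ne: "Y \<noteq> {}" and H: "H \<in> facet_halfspaces (upper_hull Y)"
  obtains v where "facet_normal (generators Y) v" "H = halfspace_of v"
proof -
  obtain w c G where w: "w \<noteq> 0" and Hw: "H = halfspace w c" and PH: "upper_hull Y \<subseteq> H"
    and G: "G facet_of upper_hull Y" "G \<subseteq> frontier H"
    using H unfolding facet_halfspaces_def by blast
  obtain y0 where y0: "y0 \<in> Y"
    using ne by blast
  define v where "v = (- c, w)"
  have Hv: "H = halfspace_of v"
    by (simp add: v_def Hw halfspace_of_def)
  have valid: "\<forall>g\<in>generators Y. 0 \<le> v \<bullet> g"
    using valid_on_generators[OF y0] PH unfolding Hv .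
  have "frontier H = {z. w \<bullet> z = c}"
    unfolding Hw halfspace_def using frontier_halfspace_ge[of w c] w by simp
  then have G_hyp: "G \<subseteq> {z. w \<bullet> z = c}"
    using G by simp
  have G_P: "G \<subseteq> upper_hull Y"
    using G(1) by (simp add: facet_of_imp_subset)
  have "aff_dim G = int CARD('d) - 1"
    using G(1) aff_dim_upper_hull[OF y0] by (simp add: facet_of_def)
  then have "aff_dim (affine hull G) = aff_dim {z. w \<bullet> z = c}"
    using w by (simp add: aff_dim_hyperplane)
  moreover have "affine hull G \<subseteq> {z. w \<bullet> z = c}"
    using G_hyp by (intro hull_minimal affine_hyperplane)
  moreover have "affine hull G \<noteq> {}"
    using G(1) by (auto simp: facet_of_def)
  ultimately have aff: "affine hull G = {z. w \<bullet> z = c}"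
    by (intro affine_dim_equal affine_affine_hull affine_hyperplane) auto
  have "u \<in> span {v}" if u: "\<forall>g\<in>generators Y. v \<bullet> g = 0 \<longrightarrow> u \<bullet> g = 0" for u
  proof -
    have "G \<subseteq> {z. snd u \<bullet> z = - fst u}"
    proof
      fix z assume "z \<in> G"
      then have "z \<in> upper_hull Y" "v \<bullet> (1, z) = 0"
        using G_P G_hyp by (auto simp: v_def)
      then have "u \<bullet> (1, z) = 0"
        by (rule orthogonal_tight_point[OF fin valid u])
      then show "z \<in> {z. snd u \<bullet> z = - fst u}"
        by simp
    qed
    then have "affine hull G \<subseteq> {z. snd u \<bullet> z = - fst u}"
      by (intro hull_minimal affine_hyperplane)
    then have hyp: "snd u \<bullet> z = - fst u" if "w \<bullet> z = c" for z
      using that aff by auto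
    define z0 where "z0 = (c / (w \<bullet> w)) *\<^sub>R w"
    define l where "l = (snd u \<bullet> w) / (w \<bullet> w)"
    define t where "t = snd u - l *\<^sub>R w"
    have z0: "w \<bullet> z0 = c" and wt: "w \<bullet> t = 0"
      using w by (simp_all add: z0_def t_def l_def inner_diff_right inner_commute)
    have "snd u \<bullet> (z0 + t) = snd u \<bullet> z0"
      using hyp[of "z0 + t"] hyp[of z0] z0 wt by (simp add: inner_add_right)
    then have "snd u \<bullet> t = 0"
      by (simp add: inner_add_right)
    then have "t \<bullet> t = 0"
      using wt by (subst (1) t_def) (simp add: inner_diff_left)
    then have su: "snd u = l *\<^sub>R w"
      by (simp add: t_def)
    then have "fst u = - l * c"
      using hyp[OF z0] z0 by simp
    then have "u = l *\<^sub>R v"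
      using su by (simp add: v_def prod_eq_iff)
    then show ?thesis
      by (simp add: span_mul span_base)
  qed
  moreover have "snd v \<noteq> 0"
    using w by (simp add: v_def)
  ultimately have "facet_normal (generators Y) v"
    using valid unfolding facet_normal_def by blast
  then show thesis
    using Hv by (rule that)
qed

text \<open>If only multiples of \<open>v\<close> are orthogonal to the tight generators, then the tight generators span
  all vectors orthogonal to \<open>v\<close>, in particular \<open>(1, z)\<close> for each point \<open>z\<close> of the hyperplane. Read in
  affine coordinates, \<open>z\<close> is an affine combination of points of the face, so the face has full
  dimension in the hyperplane.\<close>

lemma facet_normal_imp_facet_halfspace:
  fixes Y :: "(real ^ 'd::finite) set"
  assumes v: "facet_normal (generators Y) v"
  shows "halfspace_of v \<in> facet_halfspaces (upper_hull Y)"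
proof -
  define T where "T = {g \<in> generators Y. v \<bullet> g = 0}"
  define G where "G = upper_hull Y \<inter> {z. snd v \<bullet> z = - fst v}"
  have w: "snd v \<noteq> 0" and valid: "\<forall>g\<in>generators Y. 0 \<le> v \<bullet> g"
    and span: "\<And>u. (\<forall>g\<in>T. u \<bullet> g = 0) \<Longrightarrow> u \<in> span {v}"
    using v unfolding facet_normal_def T_def by blast+
  note PH = upper_hull_subset_halfspace[OF valid]
  have face: "G face_of upper_hull Y"
    unfolding G_def using PH
    by (intro face_of_Int_supporting_hyperplane_ge convex_upper_hull)
      (auto simp: in_halfspace_of)
  have y_in: "y \<in> G" if "(1, y) \<in> T" for y
  proof -
    have "y \<in> Y"
      using that by (auto simp: T_def generators_def)
    then show ?thesis
      using that upper_hull_inc[of y Y] by (simp add: G_def T_def)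
  qed
  obtain y0 where y0: "(1, y0) \<in> T"
  proof (rule ccontr)
    assume "\<not> thesis"
    then have "\<forall>y. (1, y) \<notin> T"
      using that by blast
    then have "\<forall>g\<in>T. (1, 0) \<bullet> g = 0"
      by (auto simp: T_def generators_def inner_prod_def)
    then have "(1, 0) \<in> span {v}"
      by (rule span)
    then show False
      using w by (auto simp: span_singleton prod_eq_iff)
  qed
  then have y0Y: "y0 \<in> Y"
    by (auto simp: T_def generators_def)
  have y0G: "y0 \<in> G"
    using y_in y0 .
  have ray: "y0 + axis j 1 \<in> G" if "(0, axis j 1) \<in> T" for j
  proof -
    have "snd v $ j = 0"
      using that by (simp add: T_def)
    moreover have "y0 + axis j 1 \<in> upper_hull Y"
      using upper_hull_ray[OF y0Y, of 1 j] by simp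
    ultimately show ?thesis
      using y0G by (simp add: G_def inner_add_right inner_axis)
  qed
  define D where "D = span ((\<lambda>x. x - y0) ` G)"
  have D_T: "snd g - fst g *\<^sub>R y0 \<in> D" if "g \<in> T" for g
  proof -
    consider y where "g = (1, y)" | j where "g = (0, axis j 1)"
      using \<open>g \<in> T\<close> unfolding T_def generators_def by blast
    then show ?thesis
    proof cases
      case (1 y)
      then show ?thesis
        using y_in that unfolding D_def by (auto intro!: span_base)
    next
      case (2 j)
      then have "(y0 + axis j 1) - y0 \<in> D"
        using ray that unfolding D_def by (intro span_base imageI) auto
      then show ?thesis
        using 2 by simp
    qed
  qed
  have D_span: "snd g - fst g *\<^sub>R y0 \<in> D" if "g \<in> span T" for g
    using that
  proof (induction rule: span_induct)
    case base
    have "subspace ((\<lambda>g. snd g - fst g *\<^sub>R y0) -` D)"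
      unfolding D_def
      by (intro linear_subspace_vimage subspace_span linearI)
        (auto simp: algebra_simps)
    then show ?case
      by (simp add: vimage_def)
  next
    case (step g)
    then show ?case
      by (rule D_T)
  qed
  have hyp: "z \<in> affine hull G" if "snd v \<bullet> z = - fst v" for z
  proof -
    obtain a b where ab: "a \<in> span T" "(1, z) = a + b" "\<And>g. g \<in> span T \<Longrightarrow> b \<bullet> g = 0"
      using orthogonal_subspace_decomp_exists[of T "(1, z)"]
      unfolding Linear_Algebra.orthogonal_def by metis
    have "b \<in> span {v}"
      using ab(3) by (intro span) (auto simp: span_base)
    then obtain l where l: "b = l *\<^sub>R v"
      by (auto simp: span_singleton)
    have "span T \<subseteq> {g. v \<bullet> g = 0}"
      by (intro span_minimal subspace_hyperplane) (auto simp: T_def)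
    then have "v \<bullet> a = 0"
      using ab(1) by blast
    then have "v \<bullet> (1, z) = l * (v \<bullet> v)"
      by (simp add: ab(2) l inner_add_right del: inner_generators)
    then have "l * (v \<bullet> v) = 0"
      using that by simp
    then have "l = 0"
      using w by auto
    then have "(1, z) \<in> span T"
      using ab l by simp
    then have "z - y0 \<in> D"
      using D_span by fastforce
    then have "y0 + (z - y0) \<in> affine hull G"
      unfolding D_def using y0G affine_hull_span2[of y0 G] diffs_affine_hull_span[of y0 G]
      by (metis (no_types, lifting) add.commute diff_add_cancel imageE)
    then show ?thesis
      by simp
  qed
  have "{z. snd v \<bullet> z = - fst v} \<subseteq> affine hull G"
    using hyp by blast
  then have "aff_dim {z. snd v \<bullet> z = - fst v} \<le> aff_dim G"
    by (metis aff_dim_subset aff_dim_affine_hull)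
  moreover have "aff_dim G \<le> aff_dim {z. snd v \<bullet> z = - fst v}"
    by (intro aff_dim_subset) (auto simp: G_def)
  ultimately have "aff_dim G = aff_dim (upper_hull Y) - 1"
    using w y0Y by (simp add: aff_dim_hyperplane aff_dim_upper_hull)
  then have "G facet_of upper_hull Y"
    using face y0G by (auto simp: facet_of_def)
  moreover have "G \<subseteq> frontier (halfspace_of v)"
    using frontier_halfspace_ge[of "snd v" "- fst v"] w
    by (auto simp: halfspace_of_def halfspace_def G_def)
  ultimately show ?thesis
    using PH w unfolding facet_halfspaces_def halfspace_of_def by blast
qed

lemma inner_generators_eq_0:
  fixes u :: "real \<times> (real ^ 'd::finite)"
  assumes "y \<in> Y" "\<forall>g\<in>generators Y. u \<bullet> g = 0"
  shows "u = 0"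
proof -
  have "snd u = 0"
    using assms(2) by (simp add: ball_generators Finite_Cartesian_Product.vec_eq_iff)
  moreover have "fst u + snd u \<bullet> y = 0"
    using assms by (simp add: ball_generators)
  ultimately show ?thesis
    by (simp add: prod_eq_iff)
qed

text \<open>The polyhedron is the intersection of its facet halfspaces. Start with any valid inequality
  that \<open>p\<close> violates. While its tight generators do not determine it, tilt it in a direction that
  changes neither their values nor the value at \<open>p\<close>, until another generator becomes tight. Each
  tilt enlarges the span of the tight generators, so this ends with a facet normal.\<close>

lemma facet_normal_separates:
  fixes Y :: "(real ^ 'd::finite) set"
  assumes fin: "finite Y" and ne: "Y \<noteq> {}" and p: "p \<notin> upper_hull Y"
  obtains v where "facet_normal (generators Y) v" "v \<bullet> (1, p) < 0"
proof -
  let ?\<Gamma> = "generators Y" and ?q = "(1, p) :: real \<times> (real ^ 'd)"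
  have fin\<Gamma>: "finite ?\<Gamma>"
    using fin by (simp add: generators_def)
  obtain y0 where y0: "y0 \<in> Y"
    using ne by blast
  have improve: "\<exists>v. facet_normal ?\<Gamma> v \<and> v \<bullet> ?q < 0"
    if "\<forall>g\<in>?\<Gamma>. 0 \<le> v \<bullet> g" "v \<bullet> ?q < 0" for v
    using that
  proof (induction "DIM(real \<times> (real ^ 'd)) - dim {g \<in> ?\<Gamma>. v \<bullet> g = 0}" arbitrary: v rule: less_induct)
    case less
    let ?T = "{g \<in> ?\<Gamma>. v \<bullet> g = 0}"
    show ?case
    proof (cases "\<forall>u. (\<forall>g\<in>?\<Gamma>. v \<bullet> g = 0 \<longrightarrow> u \<bullet> g = 0) \<longrightarrow> u \<in> span {v}")
      case True
      have "snd v \<noteq> 0"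
      proof
        assume "snd v = 0"
        then have "v \<bullet> (1, y0) = v \<bullet> ?q"
          by simp
        moreover have "0 \<le> v \<bullet> (1, y0)"
          using less.prems(1) y0 unfolding ball_generators by blast
        ultimately show False
          using less.prems(2) by linarith
      qed
      then show ?thesis
        using True less.prems unfolding facet_normal_def by blast
    next
      case False
      then obtain u where u: "\<forall>g\<in>?T. u \<bullet> g = 0" "u \<notin> span {v}"
        by blast
      \<comment> \<open>Correcting by a multiple of \<open>v\<close> makes the tilt neutral at \<open>p\<close>.\<close>
      define u1 where "u1 = u - ((u \<bullet> ?q) / (v \<bullet> ?q)) *\<^sub>R v"
      have u1q: "u1 \<bullet> ?q = 0"
        using less.prems(2) by (simp add: u1_def inner_diff_left del: inner_generators)
      have u1T: "\<forall>g\<in>?T. u1 \<bullet> g = 0"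
        using u(1) by (simp add: u1_def inner_diff_left)
      have "u1 \<noteq> 0"
        using u(2) by (auto simp: u1_def span_singleton)
      then obtain g1 where g1: "g1 \<in> ?\<Gamma>" "u1 \<bullet> g1 \<noteq> 0"
        using inner_generators_eq_0[OF y0] by blast
      \<comment> \<open>The sign is chosen such that some generator bounds the tilt.\<close>
      define u2 where "u2 = (if u1 \<bullet> g1 < 0 then u1 else - u1)"
      have u2: "u2 \<bullet> ?q = 0" "\<forall>g\<in>?T. u2 \<bullet> g = 0" "u2 \<bullet> g1 < 0"
        using u1q u1T g1(2) by (auto simp: u2_def simp del: inner_generators)
      define S where "S = {g \<in> ?\<Gamma>. u2 \<bullet> g < 0}"
      define r where "r g = (v \<bullet> g) / - (u2 \<bullet> g)" for g
      define t where "t = Min (r ` S)"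
      have S: "finite S" "S \<noteq> {}"
        using fin\<Gamma> g1(1) u2(3) unfolding S_def by (simp, blast)
      obtain g2 where g2: "g2 \<in> S" "t = r g2"
        using Min_in[of "r ` S"] S unfolding t_def by fastforce
      have tle: "t \<le> r g" if "g \<in> S" for g
        unfolding t_def using S(1) that by simp
      have t0: "0 \<le> t"
        unfolding g2(2) r_def using g2(1) less.prems(1) by (intro divide_nonneg_pos) (auto simp: S_def)
      define v' where "v' = v + t *\<^sub>R u2"
      have v'g: "v' \<bullet> g = v \<bullet> g + t * (u2 \<bullet> g)" for g
        by (simp add: v'_def inner_add_left)
      have valid': "\<forall>g\<in>?\<Gamma>. 0 \<le> v' \<bullet> g"
      proof
        fix g assume g: "g \<in> ?\<Gamma>"
        show "0 \<le> v' \<bullet> g"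
        proof (cases "g \<in> S")
          case True
          then have "u2 \<bullet> g < 0"
            by (simp add: S_def)
          then show ?thesis
            using tle[OF True] by (simp add: v'g r_def field_simps)
        next
          case False
          then show ?thesis
            using g t0 less.prems(1) by (simp add: v'g S_def)
        qed
      qed
      have q': "v' \<bullet> ?q < 0"
        using less.prems(2) u2(1) by (simp add: v'g del: inner_generators)
      have "v' \<bullet> g2 = 0"
        using g2 by (auto simp: v'g r_def S_def)
      then have T': "insert g2 ?T \<subseteq> {g \<in> ?\<Gamma>. v' \<bullet> g = 0}"
        using g2 u2(2) by (auto simp: S_def v'g)
      have "g2 \<notin> span ?T"
      proof
        assume "g2 \<in> span ?T"
        moreover have "subspace {g. u2 \<bullet> g = 0}"
          by (rule subspace_hyperplane)
        moreover have "?T \<subseteq> {g. u2 \<bullet> g = 0}"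
          using u2(2) by blast
        ultimately have "u2 \<bullet> g2 = 0"
          using span_minimal by blast
        then show False
          using g2 by (simp add: S_def)
      qed
      then have "dim ?T < dim (insert g2 ?T)"
        by (simp add: dim_insert)
      also have "\<dots> \<le> dim {g \<in> ?\<Gamma>. v' \<bullet> g = 0}"
        using T' by (rule dim_subset)
      finally have "dim ?T < dim {g \<in> ?\<Gamma>. v' \<bullet> g = 0}" .
      moreover have "dim {g \<in> ?\<Gamma>. v' \<bullet> g = 0} \<le> DIM(real \<times> (real ^ 'd))"
        by (rule dim_subset_UNIV)
      ultimately show ?thesis
        by (intro less.hyps[OF _ valid' q']) linarith
    qed
  qed
  obtain a b where ab: "a \<bullet> p < b" "\<And>x. x \<in> upper_hull Y \<Longrightarrow> b < a \<bullet> x"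
    using separating_hyperplane_closed_point[OF convex_upper_hull closed_upper_hull[OF fin] p] by blast
  then have "upper_hull Y \<subseteq> halfspace_of (- b, a)"
    by (auto simp: in_halfspace_of less_imp_le)
  then have "\<forall>g\<in>?\<Gamma>. 0 \<le> (- b, a) \<bullet> g"
    by (rule valid_on_generators[OF y0])
  then show thesis
    using improve[of "(- b, a)"] ab(1) that by auto
qed

section \<open>Gaussian elimination on spanning families\<close>

text \<open>The projection onto the hyperplane orthogonal to \<open>g\<close> along \<open>b\<close>.\<close>

definition eliminate :: "'a::real_inner \<Rightarrow> 'a \<Rightarrow> 'a \<Rightarrow> 'a" where
  "eliminate g b z = z - ((z \<bullet> g) / (b \<bullet> g)) *\<^sub>R b"

lemma linear_eliminate: "linear (eliminate g b)"
  by (rule linearI) (simp_all add: eliminate_def inner_add_left add_divide_distrib algebra_simps)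

lemma eliminate_orthogonal: "b \<bullet> g \<noteq> 0 \<Longrightarrow> eliminate g b z \<bullet> g = 0"
  by (simp add: eliminate_def inner_diff_left)

lemma span_eliminate:
  fixes B :: "'a::euclidean_space set"
  assumes b: "b \<in> B" and bg: "b \<bullet> g \<noteq> 0"
  shows "span (eliminate g b ` B) = {z \<in> span B. z \<bullet> g = 0}"
proof -
  have "span (eliminate g b ` B) = eliminate g b ` span B"
    by (rule linear_span_image[OF linear_eliminate])
  also have "\<dots> = {z \<in> span B. z \<bullet> g = 0}"
  proof safe
    fix z assume z: "z \<in> span B"
    then show "eliminate g b z \<in> span B"
      unfolding eliminate_def using b by (intro span_diff span_mul) (auto intro: span_base)
    show "eliminate g b z \<bullet> g = 0"
      by (rule eliminate_orthogonal[OF bg])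
  next
    fix z assume "z \<in> span B" "z \<bullet> g = 0"
    then show "z \<in> eliminate g b ` span B"
      by (intro image_eqI[of _ _ z]) (simp_all add: eliminate_def)
  qed
  finally show ?thesis .
qed

lemma dim_eliminate:
  fixes B :: "'a::euclidean_space set"
  assumes b: "b \<in> B" and bg: "b \<bullet> g \<noteq> 0"
  shows "dim (span B) = Suc (dim (span (eliminate g b ` B)))"
proof -
  let ?S = "span (eliminate g b ` B)"
  have "b \<notin> ?S"
    using bg by (simp add: span_eliminate[OF b bg])
  then have "dim (insert b ?S) = Suc (dim ?S)"
    using dim_insert[of b ?S] by (simp add: span_span)
  moreover have "span (insert b ?S) = span B"
  proof
    show "span (insert b ?S) \<subseteq> span B"
      using b by (intro span_minimal) (auto simp: span_eliminate[OF b bg] span_base)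
    have "z \<in> span (insert b ?S)" if "z \<in> B" for z
    proof -
      have "z = eliminate g b z + ((z \<bullet> g) / (b \<bullet> g)) *\<^sub>R b"
        by (simp add: eliminate_def)
      moreover have "eliminate g b z \<in> span (insert b ?S)"
        using that by (intro span_base insertI2 imageI)
      moreover have "b \<in> span (insert b ?S)"
        by (intro span_base) simp
      ultimately show ?thesis
        by (metis span_add span_mul)
    qed
    then show "span B \<subseteq> span (insert b ?S)"
      by (intro span_minimal) auto
  qed
  ultimately show ?thesis
    by (metis dim_span)
qed

section \<open>Counting points that do not approximate each other\<close>

text \<open>The rounded logarithms of the components to base \<open>1 + \<eta>\<close> place every point in a cell of a grid
  (with an extra value for zero components). Two points of a cell approximate each other up to the
  factor \<open>1 + \<eta>\<close>, so a cell contains at most one of the points. By Bernoulli's inequality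
  \<open>(1 + \<eta>)\<^sup>r \<ge> 2\<close>, hence the logarithms lie between \<open>- r l\<close> and \<open>r l\<close>.\<close>

lemma card_pairwise_nonapproximating:
  fixes y :: "nat \<Rightarrow> real ^ 'd::finite"
  assumes \<eta>: "0 < \<eta>" "1 \<le> \<eta> * real r"
    and bounds: "\<And>i c. i \<le> m \<Longrightarrow> y i $ c = 0 \<or> 0 < y i $ c \<and> 1 \<le> y i $ c * 2 ^ l \<and> y i $ c \<le> 2 ^ l"
    and far: "\<And>i j. i < j \<Longrightarrow> j \<le> m \<Longrightarrow> \<exists>c. (1 + \<eta>) * y j $ c < y i $ c"
  shows "m < (2 * r * l + 2) ^ CARD('d)"
proof -
  define lg where "lg = log (1 + \<eta>)"
  define N where "N = int (r * l)"
  define cell where "cell x = (if x = 0 then None else Some \<lfloor>lg x\<rfloor>)" for x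
  define cells where "cells = insert None (Some ` {- N..N})"
  define box where "box i c = cell (y i $ c)" for i c
  have "(2::real) \<le> 1 + real r * \<eta>"
    using \<eta> by (simp add: mult.commute)
  also have "\<dots> \<le> (1 + \<eta>) ^ r"
    using \<eta> by (intro Bernoulli_inequality) simp
  finally have "2 ^ l \<le> (1 + \<eta>) ^ (r * l)"
    by (simp add: power_mult power_mono)
  then have "lg (2 ^ l) \<le> lg ((1 + \<eta>) ^ (r * l))"
    unfolding lg_def using \<eta> by (subst log_le_cancel_iff) auto
  then have lgl: "lg (2 ^ l) \<le> real (r * l)"
    using \<eta> by (simp add: lg_def log_nat_power)
  have cell_in: "cell x \<in> cells" if x: "x = 0 \<or> 0 < x \<and> 1 \<le> x * 2 ^ l \<and> x \<le> 2 ^ l" for x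
  proof (cases "x = 0")
    case False
    then have x: "0 < x" "1 / 2 ^ l \<le> x" "x \<le> 2 ^ l"
      using x by (auto simp: field_simps)
    have "lg x \<le> lg (2 ^ l)" "lg (1 / 2 ^ l) \<le> lg x"
      unfolding lg_def using x \<eta> by (auto simp: log_le_cancel_iff)
    moreover have "lg (1 / 2 ^ l) = - lg (2 ^ l)"
      using \<eta> by (simp add: lg_def log_divide)
    ultimately have "- of_int N \<le> lg x" "lg x \<le> of_int N"
      using lgl by (auto simp: N_def)
    then show ?thesis
      using False by (auto simp: cell_def cells_def le_floor_iff floor_le_iff)
  qed (simp add: cell_def cells_def)
  have same_cell: "x \<le> (1 + \<eta>) * x'" if "cell x = cell x'" "0 \<le> x" "0 \<le> x'" for x x'
  proof (cases "x = 0 \<or> x' = 0")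
    case True
    then show ?thesis
      using that \<eta> by (auto simp: cell_def split: if_splits)
  next
    case False
    then have pos: "0 < x" "0 < x'" and eq: "\<lfloor>lg x\<rfloor> = \<lfloor>lg x'\<rfloor>"
      using that by (auto simp: cell_def)
    have "lg x < lg x' + 1"
      using eq by linarith
    also have "\<dots> = lg ((1 + \<eta>) * x')"
      using pos \<eta> by (simp add: lg_def log_mult)
    finally show ?thesis
      using pos \<eta> by (simp add: lg_def)
  qed
  have "inj_on box {..m}"
  proof (rule linorder_inj_onI)
    fix i j :: nat assume ij: "i < j" "i \<in> {..m}" "j \<in> {..m}"
    then obtain c where c: "(1 + \<eta>) * y j $ c < y i $ c"
      using far by auto
    have "0 \<le> y i $ c" "0 \<le> y j $ c"
      using bounds[of i c] bounds[of j c] ij by auto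
    then show "box i \<noteq> box j"
      using same_cell[of "y i $ c" "y j $ c"] c by (auto simp: box_def dest: fun_cong[of _ _ c])
  qed auto
  moreover have "box ` {..m} \<subseteq> Pi\<^sub>E UNIV (\<lambda>_. cells)"
    using bounds cell_in by (auto simp: box_def PiE_def)
  moreover have "finite (Pi\<^sub>E (UNIV :: 'd set) (\<lambda>_. cells))"
    by (intro finite_PiE) (auto simp: cells_def)
  ultimately have "card {..m} \<le> card (Pi\<^sub>E (UNIV :: 'd set) (\<lambda>_. cells))"
    by (metis card_image card_mono)
  also have "\<dots> = card cells ^ CARD('d)"
    by (simp add: card_PiE)
  also have "card cells = 2 * r * l + 2"
    by (simp add: cells_def card_insert_if card_image N_def nat_add_distrib nat_mult_distrib)
  finally show ?thesis
    by simp
qed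

section \<open>Enumerating facet normals by a program\<close>

text \<open>Vectors are lists of the constant length \<open>d + 1\<close>, so their operations are programs without
  loops, obtained by recursion on the length.\<close>

fun dot :: "rat list \<Rightarrow> rat list \<Rightarrow> rat" where
  "dot (a # u) (b # v) = a * b + dot u v"
| "dot _ _ = 0"

fun axpy :: "rat \<Rightarrow> rat list \<Rightarrow> rat list \<Rightarrow> rat list" where
  "axpy c (a # u) (b # v) = (c * a + b) # axpy c u v"
| "axpy _ _ _ = []"

lemma length_axpy [simp]: "length (axpy c u v) = min (length u) (length v)"
  by (induction c u v rule: axpy.induct) auto

definition enc_rats :: "rat list \<Rightarrow> val" where
  "enc_rats u = enc_list (map VNum u)"

lemma enc_rats_simps [simp]: "enc_rats [] = VNum 0" "enc_rats (a # u) = VPair (VNum a) (enc_rats u)"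
  by (simp_all add: enc_rats_def)

lemma enc_rats_Suc: "length u = Suc n \<Longrightarrow> enc_rats u = VPair (VNum (hd u)) (enc_rats (tl u))"
  by (cases u) auto

fun dotP :: "nat \<Rightarrow> prog" where
  "dotP 0 = constP (VNum 0)"
| "dotP (Suc n) = addP (multP (fstP (fstP input)) (fstP (sndP input)))
     (Then (Fork (sndP (fstP input)) (sndP (sndP input))) (dotP n))"

fun axpyP :: "nat \<Rightarrow> prog" where
  "axpyP 0 = constP (VNum 0)"
| "axpyP (Suc n) = Fork (addP (multP (fstP input) (fstP (fstP (sndP input)))) (fstP (sndP (sndP input))))
     (Then (Fork (fstP input) (Fork (sndP (fstP (sndP input))) (sndP (sndP (sndP input))))) (axpyP n))"

lemma poly_time_dot_rec:
  assumes "poly_bounded \<sigma> K (\<lambda>k. len (VPair (enc_rats (u k)) (enc_rats (v k))))"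
    and "\<And>k. k \<in> K \<Longrightarrow> length (u k) = n" "\<And>k. k \<in> K \<Longrightarrow> length (v k) = n"
  shows "poly_time \<sigma> K (dotP n) (\<lambda>k. VPair (enc_rats (u k)) (enc_rats (v k))) (\<lambda>k. VNum (dot (u k) (v k)))"
  using assms
proof (induction n arbitrary: u v)
  case 0
  show ?case
    unfolding dotP.simps by (rule poly_time_cong[OF poly_time_const[OF 0(1)]]) (use 0 in auto)
next
  case (Suc n)
  let ?x = "\<lambda>k. VPair (enc_rats (u k)) (enc_rats (v k))"
  note id = poly_time_input_val[OF Suc.prems(1)]
  have u: "poly_time \<sigma> K (fstP input) ?x (\<lambda>k. VPair (VNum (hd (u k))) (enc_rats (tl (u k))))"
    and v: "poly_time \<sigma> K (sndP input) ?x (\<lambda>k. VPair (VNum (hd (v k))) (enc_rats (tl (v k))))"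
    by (rule poly_time_cong[OF poly_time_fst[OF id] refl], metis Suc.prems(2) enc_rats_Suc)
      (rule poly_time_cong[OF poly_time_snd[OF id] refl], metis Suc.prems(3) enc_rats_Suc)
  note tails = poly_time_Fork[OF poly_time_snd[OF u] poly_time_snd[OF v]]
  have "poly_time \<sigma> K (dotP n) (\<lambda>k. VPair (enc_rats (tl (u k))) (enc_rats (tl (v k))))
      (\<lambda>k. VNum (dot (tl (u k)) (tl (v k))))"
    by (rule Suc.IH[OF poly_time_output[OF tails]]) (use Suc.prems in auto)
  from poly_time_add[OF poly_time_mult[OF poly_time_fst[OF u] poly_time_fst[OF v]] poly_time_Then[OF tails this]]
  show ?case
    unfolding dotP.simps
  proof (rule poly_time_cong)
    show "VNum (dot (u k) (v k)) = VNum (hd (u k) * hd (v k) + dot (tl (u k)) (tl (v k)))" if "k \<in> K" for k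
      using Suc.prems(2,3)[OF that] by (cases "u k"; cases "v k") auto
  qed simp
qed

lemma poly_time_axpy_rec:
  assumes "poly_bounded \<sigma> K (\<lambda>k. len (VPair (VNum (c k)) (VPair (enc_rats (u k)) (enc_rats (v k)))))"
    and "\<And>k. k \<in> K \<Longrightarrow> length (u k) = n" "\<And>k. k \<in> K \<Longrightarrow> length (v k) = n"
  shows "poly_time \<sigma> K (axpyP n) (\<lambda>k. VPair (VNum (c k)) (VPair (enc_rats (u k)) (enc_rats (v k))))
    (\<lambda>k. enc_rats (axpy (c k) (u k) (v k)))"
  using assms
proof (induction n arbitrary: u v)
  case 0
  show ?case
    unfolding axpyP.simps by (rule poly_time_cong[OF poly_time_const[OF 0(1)]]) (use 0 in auto)
next
  case (Suc n)
  let ?x = "\<lambda>k. VPair (VNum (c k)) (VPair (enc_rats (u k)) (enc_rats (v k)))"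
  note id = poly_time_input_val[OF Suc.prems(1)]
  have u: "poly_time \<sigma> K (fstP (sndP input)) ?x (\<lambda>k. VPair (VNum (hd (u k))) (enc_rats (tl (u k))))"
    and v: "poly_time \<sigma> K (sndP (sndP input)) ?x (\<lambda>k. VPair (VNum (hd (v k))) (enc_rats (tl (v k))))"
    by (rule poly_time_cong[OF poly_time_fst[OF poly_time_snd[OF id]] refl], metis Suc.prems(2) enc_rats_Suc)
      (rule poly_time_cong[OF poly_time_snd[OF poly_time_snd[OF id]] refl], metis Suc.prems(3) enc_rats_Suc)
  note tails = poly_time_Fork[OF poly_time_fst[OF id] poly_time_Fork[OF poly_time_snd[OF u] poly_time_snd[OF v]]]
  have "poly_time \<sigma> K (axpyP n) (\<lambda>k. VPair (VNum (c k)) (VPair (enc_rats (tl (u k))) (enc_rats (tl (v k)))))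
      (\<lambda>k. enc_rats (axpy (c k) (tl (u k)) (tl (v k))))"
    by (rule Suc.IH[OF poly_time_output[OF tails]]) (use Suc.prems in auto)
  from poly_time_Fork[OF poly_time_add[OF poly_time_mult[OF poly_time_fst[OF id] poly_time_fst[OF u]]
      poly_time_fst[OF v]] poly_time_Then[OF tails this]]
  show ?case
    unfolding axpyP.simps
  proof (rule poly_time_cong)
    show "enc_rats (axpy (c k) (u k) (v k)) = VPair (VNum (c k * hd (u k) + hd (v k)))
        (enc_rats (axpy (c k) (tl (u k)) (tl (v k))))" if "k \<in> K" for k
      using Suc.prems(2,3)[OF that] by (cases "u k"; cases "v k") auto
  qed simp
qed

definition dot_ofP :: "nat \<Rightarrow> prog \<Rightarrow> prog \<Rightarrow> prog" where
  "dot_ofP n P Q = Then (Fork P Q) (dotP n)"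

definition axpy_ofP :: "nat \<Rightarrow> prog \<Rightarrow> prog \<Rightarrow> prog \<Rightarrow> prog" where
  "axpy_ofP n C P Q = Then (Fork C (Fork P Q)) (axpyP n)"

definition singletonP :: "prog \<Rightarrow> prog" where
  "singletonP P = Fork P (constP (VNum 0))"

lemma poly_time_dot:
  assumes "poly_time \<sigma> K P x (\<lambda>k. enc_rats (u k))" "poly_time \<sigma> K Q x (\<lambda>k. enc_rats (v k))"
    and "\<And>k. k \<in> K \<Longrightarrow> length (u k) = n" "\<And>k. k \<in> K \<Longrightarrow> length (v k) = n"
  shows "poly_time \<sigma> K (dot_ofP n P Q) x (\<lambda>k. VNum (dot (u k) (v k)))"
  unfolding dot_ofP_def using poly_time_Fork[OF assms(1,2)]
  by (rule poly_time_Then) (intro poly_time_dot_rec poly_time_output[OF poly_time_Fork[OF assms(1,2)]] assms(3,4))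

lemma poly_time_axpy:
  assumes "poly_time \<sigma> K C x (\<lambda>k. VNum (c k))"
    and "poly_time \<sigma> K P x (\<lambda>k. enc_rats (u k))" "poly_time \<sigma> K Q x (\<lambda>k. enc_rats (v k))"
    and "\<And>k. k \<in> K \<Longrightarrow> length (u k) = n" "\<And>k. k \<in> K \<Longrightarrow> length (v k) = n"
  shows "poly_time \<sigma> K (axpy_ofP n C P Q) x (\<lambda>k. enc_rats (axpy (c k) (u k) (v k)))"
proof -
  note F = poly_time_Fork[OF assms(1) poly_time_Fork[OF assms(2,3)]]
  show ?thesis
    unfolding axpy_ofP_def using F
    by (rule poly_time_Then) (intro poly_time_axpy_rec poly_time_output[OF F] assms(4,5))
qed

lemma poly_time_singleton:
  "poly_time \<sigma> K P x (\<lambda>k. enc (a k)) \<Longrightarrow> poly_time \<sigma> K (singletonP P) x (\<lambda>k. enc_list (map enc [a k]))"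
  unfolding singletonP_def
  using poly_time_Fork[OF _ poly_time_const[OF poly_time_input]] by auto

lemma poly_time_nil:
  "poly_bounded \<sigma> K (\<lambda>k. len (x k)) \<Longrightarrow> poly_time \<sigma> K (constP (VNum 0)) x (\<lambda>k. enc_list (map enc []))"
  using poly_time_const[of \<sigma> K x "VNum 0"] by simp

lemma poly_time_guard:
  assumes "poly_time \<sigma> K C x (\<lambda>k. truth (b k))"
    and "poly_time \<sigma> {k \<in> K. b k} P x (\<lambda>k. enc (a k))"
  shows "poly_time \<sigma> K (Cond C (singletonP P) (constP (VNum 0))) x
    (\<lambda>k. enc_list (map enc (if b k then [a k] else [])))"
proof -
  have "poly_bounded \<sigma> {k \<in> K. \<not> b k} (\<lambda>k. len (x k))"
    using poly_time_input[OF assms(1)] by (rule poly_bounded_subset) auto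
  from poly_time_Cond_truth[OF assms(1) poly_time_singleton[of _ _ _ _ enc a, OF assms(2)] poly_time_nil[OF this, of enc]]
  show ?thesis
    by (simp add: if_distrib[of "\<lambda>xs. enc_list (map enc xs)"])
qed

lemma poly_time_guard_num:
  assumes "poly_time \<sigma> K C x (\<lambda>k. VNum (b k))"
    and "poly_time \<sigma> {k \<in> K. b k \<noteq> 0} P x (\<lambda>k. enc_list (map enc (as k)))"
  shows "poly_time \<sigma> K (Cond C P (constP (VNum 0))) x
    (\<lambda>k. enc_list (map enc (if b k \<noteq> 0 then as k else [])))"
proof -
  have "poly_bounded \<sigma> {k \<in> K. b k = 0} (\<lambda>k. len (x k))"
    using poly_time_input[OF assms(1)] by (rule poly_bounded_subset) auto
  from poly_time_Cond_num[OF assms(1,2) poly_time_nil[OF this, of enc]]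
  show ?thesis
    by (simp add: if_distrib[of "\<lambda>xs. enc_list (map enc xs)"])
qed

subsection \<open>Elimination\<close>

definition enc_vecs :: "rat list list \<Rightarrow> val" where
  "enc_vecs B = enc_list (map enc_rats B)"

definition elim_vec :: "rat list \<Rightarrow> rat list \<Rightarrow> rat list \<Rightarrow> rat list" where
  "elim_vec g b z = axpy (- 1 * (dot z g / dot b g)) b z"

text \<open>Every vector that is not orthogonal to \<open>g\<close> is tried as a pivot; this saves the program a search
  for the first one. The pivot itself is mapped to zero and remains in the list, so that these are
  spanning families and in general no bases.\<close>

definition pivots :: "rat list list \<Rightarrow> rat list \<Rightarrow> rat list list list" where
  "pivots B g = collect (\<lambda>b. if dot b g \<noteq> 0 then [collect (\<lambda>z. [elim_vec g b z]) B] else []) B"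

definition expand :: "rat list list \<Rightarrow> rat list list list \<Rightarrow> rat list list list" where
  "expand G = collect (\<lambda>B. collect (pivots B) G)"

definition unit_lists :: "nat \<Rightarrow> rat list list" where
  "unit_lists n = map (\<lambda>i. map (\<lambda>j. if j = i then 1 else 0) [0..<n]) [0..<n]"

text \<open>The members of \<open>complements n G k\<close> span the orthogonal complements of the linearly independent
  subsets of \<open>G\<close> with \<open>k\<close> elements.\<close>

fun complements :: "nat \<Rightarrow> rat list list \<Rightarrow> nat \<Rightarrow> rat list list list" where
  "complements n G 0 = [unit_lists n]"
| "complements n G (Suc k) = expand G (complements n G k)"

definition elimP :: "nat \<Rightarrow> prog" where
  "elimP n = (let g = sndP (fstP (fstP input)); b = sndP (fstP input); z = sndP input in
     singletonP (axpy_ofP n (multP (constP (VNum (- 1))) (divideP (dot_ofP n z g) (dot_ofP n b g))) b z))"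

definition pivotP :: "nat \<Rightarrow> prog" where
  "pivotP n = Cond (dot_ofP n (sndP input) (sndP (fstP input)))
     (singletonP (Then (Fork input (sndP (fstP (fstP input)))) (collectP (elimP n)))) (constP (VNum 0))"

definition expandP :: "nat \<Rightarrow> prog" where
  "expandP n = Then input (collectP (Then (Fork input (fstP input)) (collectP
     (Then (Fork input (sndP (fstP input))) (collectP (pivotP n))))))"

fun complementsP :: "nat \<Rightarrow> nat \<Rightarrow> prog" where
  "complementsP n 0 = constP (enc_list (map enc_vecs [unit_lists n]))"
| "complementsP n (Suc k) = Then (Fork input (complementsP n k)) (expandP n)"

lemma poly_time_elim:
  assumes len: "\<And>k. k \<in> K \<Longrightarrow> length (g k) = n \<and> length (b k) = n \<and> length (z k) = n"
    and pb: "poly_bounded \<sigma> K (\<lambda>k. len (VPair (VPair (VPair (X k) (enc_rats (g k))) (enc_rats (b k))) (enc_rats (z k))))"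
  shows "poly_time \<sigma> K (elimP n) (\<lambda>k. VPair (VPair (VPair (X k) (enc_rats (g k))) (enc_rats (b k))) (enc_rats (z k)))
    (\<lambda>k. enc_list (map enc_rats [elim_vec (g k) (b k) (z k)]))"
proof -
  note id = poly_time_input_val[OF pb]
  show ?thesis
    unfolding elimP_def Let_def elim_vec_def
    using len by (intro poly_time_singleton poly_time_axpy poly_time_mult poly_time_divide poly_time_dot
        poly_time_const[OF pb] poly_time_snd[OF id] poly_time_snd[OF poly_time_fst[OF id]]
        poly_time_snd[OF poly_time_fst[OF poly_time_fst[OF id]]]) auto
qed

lemma poly_time_pivot:
  assumes len: "\<And>k. k \<in> K \<Longrightarrow> length (g k) = n \<and> length (b k) = n \<and> (\<forall>z\<in>set (B k). length z = n)"
    and pb: "poly_bounded \<sigma> K (\<lambda>k. len (VPair (VPair (VPair (X k) (enc_vecs (B k))) (enc_rats (g k))) (enc_rats (b k))))"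
  shows "poly_time \<sigma> K (pivotP n) (\<lambda>k. VPair (VPair (VPair (X k) (enc_vecs (B k))) (enc_rats (g k))) (enc_rats (b k)))
    (\<lambda>k. enc_list (map enc_vecs (if dot (b k) (g k) \<noteq> 0
      then [collect (\<lambda>z. [elim_vec (g k) (b k) z]) (B k)] else [])))"
proof -
  note id = poly_time_input_val[OF pb]
  let ?K = "{k \<in> K. dot (b k) (g k) \<noteq> 0}"
  have id': "poly_time \<sigma> ?K input (\<lambda>k. VPair (VPair (VPair (X k) (enc_vecs (B k))) (enc_rats (g k))) (enc_rats (b k)))
      (\<lambda>k. VPair (VPair (VPair (X k) (enc_vecs (B k))) (enc_rats (g k))) (enc_rats (b k)))"
    using id by (rule poly_time_subset) auto
  show ?thesis
    unfolding pivotP_def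
  proof (intro poly_time_guard_num poly_time_singleton poly_time_dot poly_time_snd[OF id]
      poly_time_snd[OF poly_time_fst[OF id]])
    have "poly_time \<sigma> ?K (Fork input (sndP (fstP (fstP input))))
        (\<lambda>k. VPair (VPair (VPair (X k) (enc_vecs (B k))) (enc_rats (g k))) (enc_rats (b k)))
        (\<lambda>k. VPair (VPair (VPair (VPair (X k) (enc_vecs (B k))) (enc_rats (g k))) (enc_rats (b k)))
           (enc_list (map enc_rats (B k))))"
      unfolding enc_vecs_def[symmetric]
      by (intro poly_time_Fork id' poly_time_snd[OF poly_time_fst[OF poly_time_fst[OF id']]])
    then show "poly_time \<sigma> ?K (Then (Fork input (sndP (fstP (fstP input)))) (collectP (elimP n)))
        (\<lambda>k. VPair (VPair (VPair (X k) (enc_vecs (B k))) (enc_rats (g k))) (enc_rats (b k)))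
        (\<lambda>k. enc_vecs (collect (\<lambda>z. [elim_vec (g k) (b k) z]) (B k)))"
      unfolding enc_vecs_def[of "collect _ _"]
      by (rule poly_time_collect) (rule poly_time_elim, use len in auto)
  qed (use len in auto)
qed

lemma poly_time_expand:
  assumes len: "\<And>k. k \<in> K \<Longrightarrow> (\<forall>g\<in>set (G k). length g = n) \<and> (\<forall>B\<in>set (Bs k). \<forall>z\<in>set B. length z = n)"
    and pb: "poly_bounded \<sigma> K (\<lambda>k. len (VPair (enc_vecs (G k)) (enc_list (map enc_vecs (Bs k)))))"
  shows "poly_time \<sigma> K (expandP n) (\<lambda>k. VPair (enc_vecs (G k)) (enc_list (map enc_vecs (Bs k))))
    (\<lambda>k. enc_list (map enc_vecs (expand (G k) (Bs k))))"
  unfolding expandP_def expand_def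
proof (rule poly_time_collect[OF poly_time_input_val[OF pb]])
  let ?K1 = "{(k, B). k \<in> K \<and> B \<in> set (Bs k)}"
  let ?x1 = "\<lambda>z. VPair (enc_vecs (G (fst z))) (enc_vecs (snd z))"
  assume pb1: "poly_bounded (\<lambda>z. \<sigma> (fst z)) ?K1 (\<lambda>z. len (?x1 z))"
  note id1 = poly_time_input_val[OF pb1]
  have L1: "poly_time (\<lambda>z. \<sigma> (fst z)) ?K1 (Fork input (fstP input)) ?x1
      (\<lambda>z. VPair (?x1 z) (enc_list (map enc_rats (G (fst z)))))"
    unfolding enc_vecs_def[symmetric] by (intro poly_time_Fork id1 poly_time_fst[OF id1])
  show "poly_time (\<lambda>z. \<sigma> (fst z)) ?K1 (Then (Fork input (fstP input))
      (collectP (Then (Fork input (sndP (fstP input))) (collectP (pivotP n))))) ?x1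
      (\<lambda>z. enc_list (map enc_vecs (collect (pivots (snd z)) (G (fst z)))))"
  proof (rule poly_time_collect[OF L1])
    let ?K2 = "{(k, g). k \<in> ?K1 \<and> g \<in> set (G (fst k))}"
    let ?x2 = "\<lambda>z. VPair (?x1 (fst z)) (enc_rats (snd z))"
    assume pb2: "poly_bounded (\<lambda>z. \<sigma> (fst (fst z))) ?K2 (\<lambda>z. len (?x2 z))"
    note id2 = poly_time_input_val[OF pb2]
    have L2: "poly_time (\<lambda>z. \<sigma> (fst (fst z))) ?K2 (Fork input (sndP (fstP input))) ?x2
        (\<lambda>z. VPair (?x2 z) (enc_list (map enc_rats (snd (fst z)))))"
      unfolding enc_vecs_def[symmetric]
      by (intro poly_time_Fork id2 poly_time_snd[OF poly_time_fst[OF id2]])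
    show "poly_time (\<lambda>z. \<sigma> (fst (fst z))) ?K2 (Then (Fork input (sndP (fstP input))) (collectP (pivotP n))) ?x2
        (\<lambda>z. enc_list (map enc_vecs (pivots (snd (fst z)) (snd z))))"
      unfolding pivots_def
    proof (rule poly_time_collect[OF L2])
      let ?K3 = "{(k, b). k \<in> ?K2 \<and> b \<in> set (snd (fst k))}"
      let ?x3 = "\<lambda>z. VPair (?x2 (fst z)) (enc_rats (snd z))"
      assume pb3: "poly_bounded (\<lambda>z. \<sigma> (fst (fst (fst z)))) ?K3 (\<lambda>z. len (?x3 z))"
      show "poly_time (\<lambda>z. \<sigma> (fst (fst (fst z)))) ?K3 (pivotP n) ?x3
          (\<lambda>z. enc_list (map enc_vecs (if dot (snd z) (snd (fst z)) \<noteq> 0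
            then [collect (\<lambda>y. [elim_vec (snd (fst z)) (snd z) y]) (snd (fst (fst z)))] else [])))"
        by (rule poly_time_pivot[OF _ pb3]) (use len in auto)
    qed
  qed
qed

lemma length_complements:
  assumes "\<And>g. g \<in> set G \<Longrightarrow> length g = n"
  shows "B \<in> set (complements n G k) \<Longrightarrow> b \<in> set B \<Longrightarrow> length b = n"
  by (induction k arbitrary: B b) (auto simp: unit_lists_def expand_def pivots_def elim_vec_def split: if_splits)

lemma poly_time_complements:
  assumes len: "\<And>k g. k \<in> K \<Longrightarrow> g \<in> set (G k) \<Longrightarrow> length g = n"
    and pb: "poly_bounded \<sigma> K (\<lambda>k. len (enc_vecs (G k)))"
  shows "poly_time \<sigma> K (complementsP n m) (\<lambda>k. enc_vecs (G k)) (\<lambda>k. enc_list (map enc_vecs (complements n (G k) m)))"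
proof (induction m)
  case 0
  show ?case
    using poly_time_const[OF pb] by simp
next
  case (Suc m)
  note F = poly_time_Fork[OF poly_time_input_val[OF pb] Suc]
  show ?case
    unfolding complementsP.simps complements.simps
  proof (intro poly_time_Then[OF F] poly_time_expand poly_time_output[OF F] conjI ballI)
    show "length g = n" if "k \<in> K" "g \<in> set (G k)" for k g
      using len that .
    show "length z = n" if "k \<in> K" "B \<in> set (complements n (G k) m)" "z \<in> set B" for k B z
      using length_complements[OF len[OF that(1)] that(2,3)] .
  qed
qed

subsection \<open>Candidates\<close>

text \<open>The inner product of \<open>ones d\<close> with \<open>(- c, w)\<close> is the sum of the weights \<open>w\<close>.\<close>

definition ones :: "nat \<Rightarrow> rat list" where "ones d = 0 # replicate d 1"
definition zeros :: "nat \<Rightarrow> rat list" where "zeros d = replicate (Suc d) 0"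

definition scaled :: "nat \<Rightarrow> rat \<Rightarrow> rat list \<Rightarrow> rat list" where
  "scaled d c v = axpy c v (zeros d)"

text \<open>A facet normal is found only up to a nonzero factor. As its weights are nonnegative and not all
  zero, dividing by their sum gives the correct sign.\<close>

definition normalise :: "nat \<Rightarrow> rat list \<Rightarrow> rat list" where
  "normalise d v = scaled d (1 / dot v (ones d)) v"

definition violated :: "rat list list \<Rightarrow> rat list \<Rightarrow> rat list list" where
  "violated G v = collect (\<lambda>g. if dot v g < 0 then [g] else []) G"

definition candidates :: "nat \<Rightarrow> rat list list \<Rightarrow> rat list list" where
  "candidates d G = collect (\<lambda>B. collect (\<lambda>v. if dot v (ones d) \<noteq> 0
     then (if violated G (normalise d v) = [] then [normalise d v] else []) else []) B) (complements (Suc d) G d)"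

definition scaledP :: "nat \<Rightarrow> prog \<Rightarrow> prog \<Rightarrow> prog" where
  "scaledP d C P = axpy_ofP (Suc d) C P (constP (enc_rats (zeros d)))"

definition normaliseP :: "nat \<Rightarrow> prog" where
  "normaliseP d = scaledP d (divideP (constP (VNum 1))
      (dot_ofP (Suc d) (sndP input) (constP (enc_rats (ones d))))) (sndP input)"

definition violatedP :: "nat \<Rightarrow> prog" where
  "violatedP d = Then (Fork (sndP input) (fstP input)) (collectP
     (Cond (lessP (dot_ofP (Suc d) (fstP input) (sndP input)) (constP (VNum 0)))
       (singletonP (sndP input)) (constP (VNum 0))))"

definition validP :: "nat \<Rightarrow> prog" where
  "validP d = Cond (nonemptyP (violatedP d)) (constP (VNum 0)) (singletonP (sndP input))"

definition candidatesP :: "nat \<Rightarrow> prog" where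
  "candidatesP d = Then (Fork input (complementsP (Suc d) d)) (collectP (Then input (collectP
     (Cond (dot_ofP (Suc d) (sndP input) (constP (enc_rats (ones d))))
       (Then (Fork (fstP input) (normaliseP d)) (validP d)) (constP (VNum 0))))))"

lemma length_ones_zeros [simp]: "length (ones d) = Suc d" "length (zeros d) = Suc d"
  by (simp_all add: ones_def zeros_def)

lemma length_scaled [simp]: "length (scaled d c v) = min (length v) (Suc d)"
  by (simp add: scaled_def)

lemma poly_time_scaled:
  assumes "poly_time \<sigma> K C x (\<lambda>k. VNum (c k))" "poly_time \<sigma> K P x (\<lambda>k. enc_rats (v k))"
    and "\<And>k. k \<in> K \<Longrightarrow> length (v k) = Suc d"
  shows "poly_time \<sigma> K (scaledP d C P) x (\<lambda>k. enc_rats (scaled d (c k) (v k)))"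
  unfolding scaledP_def scaled_def
  by (intro poly_time_axpy assms(1,2) poly_time_const[OF poly_time_input[OF assms(1)]]) (simp_all add: assms(3))

lemma poly_time_valid:
  assumes len: "\<And>k. k \<in> K \<Longrightarrow> length (v k) = Suc d \<and> (\<forall>g\<in>set (G k). length g = Suc d)"
    and pb: "poly_bounded \<sigma> K (\<lambda>k. len (VPair (enc_vecs (G k)) (enc_rats (v k))))"
  shows "poly_time \<sigma> K (validP d) (\<lambda>k. VPair (enc_vecs (G k)) (enc_rats (v k)))
    (\<lambda>k. enc_list (map enc_rats (if violated (G k) (v k) = [] then [v k] else [])))"
proof -
  let ?x = "\<lambda>k. VPair (enc_vecs (G k)) (enc_rats (v k))"
  note id = poly_time_input_val[OF pb]
  have L: "poly_time \<sigma> K (Fork (sndP input) (fstP input)) ?x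
      (\<lambda>k. VPair (enc_rats (v k)) (enc_list (map enc_rats (G k))))"
    unfolding enc_vecs_def[symmetric] by (intro poly_time_Fork poly_time_fst[OF id] poly_time_snd[OF id])
  have "poly_time \<sigma> K (violatedP d) ?x (\<lambda>k. enc_list (map enc_rats (violated (G k) (v k))))"
    unfolding violatedP_def violated_def
  proof (rule poly_time_collect[OF L])
    let ?K = "{(k, g). k \<in> K \<and> g \<in> set (G k)}"
    assume pb': "poly_bounded (\<lambda>z. \<sigma> (fst z)) ?K (\<lambda>z. len (VPair (enc_rats (v (fst z))) (enc_rats (snd z))))"
    note id' = poly_time_input_val[OF pb']
    show "poly_time (\<lambda>z. \<sigma> (fst z)) ?K
        (Cond (lessP (dot_ofP (Suc d) (fstP input) (sndP input)) (constP (VNum 0)))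
          (singletonP (sndP input)) (constP (VNum 0)))
        (\<lambda>z. VPair (enc_rats (v (fst z))) (enc_rats (snd z)))
        (\<lambda>z. enc_list (map enc_rats (if dot (v (fst z)) (snd z) < 0 then [snd z] else [])))"
      by (intro poly_time_guard poly_time_less poly_time_dot poly_time_fst[OF id'] poly_time_snd[OF id']
          poly_time_const[OF pb'] poly_time_subset[OF poly_time_snd[OF id']]) (use len in auto)
  qed
  then have "poly_time \<sigma> K (nonemptyP (violatedP d)) ?x (\<lambda>k. truth (map enc_rats (violated (G k) (v k)) \<noteq> []))"
    by (rule poly_time_nonempty)
  then have "poly_time \<sigma> K (validP d) ?x (\<lambda>k. if map enc_rats (violated (G k) (v k)) \<noteq> []
      then enc_list (map enc_rats []) else enc_list (map enc_rats [v k]))"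
    unfolding validP_def
    by (intro poly_time_Cond_truth poly_time_nil poly_bounded_subset[OF pb] poly_time_singleton
        poly_time_subset[OF poly_time_snd[OF id]]) auto
  then show ?thesis
    by (rule poly_time_cong) auto
qed

lemma poly_time_candidates:
  assumes len: "\<And>k g. k \<in> K \<Longrightarrow> g \<in> set (G k) \<Longrightarrow> length g = Suc d"
    and pb: "poly_bounded \<sigma> K (\<lambda>k. len (enc_vecs (G k)))"
  shows "poly_time \<sigma> K (candidatesP d) (\<lambda>k. enc_vecs (G k)) (\<lambda>k. enc_vecs (candidates d (G k)))"
  unfolding candidatesP_def candidates_def enc_vecs_def[of "collect _ _"]
proof (rule poly_time_collect[OF poly_time_Fork[OF poly_time_input_val[OF pb] poly_time_complements[OF len pb]]])
  let ?K1 = "{(k, B). k \<in> K \<and> B \<in> set (complements (Suc d) (G k) d)}"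
  let ?x1 = "\<lambda>z. VPair (enc_vecs (G (fst z))) (enc_list (map enc_rats (snd z)))"
  let ?f = "\<lambda>G v. if dot v (ones d) \<noteq> 0
     then (if violated G (normalise d v) = [] then [normalise d v] else []) else []"
  assume "poly_bounded (\<lambda>z. \<sigma> (fst z)) ?K1 (\<lambda>z. len (VPair (enc_vecs (G (fst z))) (enc_vecs (snd z))))"
  then have pb1: "poly_bounded (\<lambda>z. \<sigma> (fst z)) ?K1 (\<lambda>z. len (?x1 z))"
    by (simp add: enc_vecs_def)
  have "poly_time (\<lambda>z. \<sigma> (fst z)) ?K1 (Then input (collectP
     (Cond (dot_ofP (Suc d) (sndP input) (constP (enc_rats (ones d))))
       (Then (Fork (fstP input) (normaliseP d)) (validP d)) (constP (VNum 0))))) ?x1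
     (\<lambda>z. enc_list (map enc_rats (collect (?f (G (fst z))) (snd z))))"
  proof (rule poly_time_collect[OF poly_time_input_val[OF pb1]])
    let ?K2 = "{(k, v). k \<in> ?K1 \<and> v \<in> set (snd k)}"
    let ?x2 = "\<lambda>z. VPair (enc_vecs (G (fst (fst z)))) (enc_rats (snd z))"
    assume pb2: "poly_bounded (\<lambda>z. \<sigma> (fst (fst z))) ?K2 (\<lambda>z. len (?x2 z))"
    note id2 = poly_time_input_val[OF pb2]
    have lenv: "length (snd z) = Suc d" if "z \<in> ?K2" for z
      using that length_complements[of "G (fst (fst z))" "Suc d" "snd (fst z)" d "snd z"] len by auto
    let ?K3 = "{z \<in> ?K2. dot (snd z) (ones d) \<noteq> 0}"
    have "?K3 \<subseteq> ?K2"
      by blast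
    note id3 = poly_time_subset[OF id2 this]
    have F: "poly_time (\<lambda>z. \<sigma> (fst (fst z))) ?K3 (Fork (fstP input) (normaliseP d)) ?x2
        (\<lambda>z. VPair (enc_vecs (G (fst (fst z)))) (enc_rats (normalise d (snd z))))"
      unfolding normaliseP_def normalise_def
      by (intro poly_time_Fork poly_time_fst[OF id3] poly_time_scaled poly_time_divide poly_time_dot
          poly_time_snd[OF id3] poly_time_const[OF poly_time_input[OF id3]]) (use lenv in auto)
    show "poly_time (\<lambda>z. \<sigma> (fst (fst z))) ?K2
        (Cond (dot_ofP (Suc d) (sndP input) (constP (enc_rats (ones d))))
          (Then (Fork (fstP input) (normaliseP d)) (validP d)) (constP (VNum 0))) ?x2
        (\<lambda>z. enc_list (map enc_rats (?f (G (fst (fst z))) (snd z))))"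
    proof (intro poly_time_guard_num poly_time_dot poly_time_snd[OF id2] poly_time_const[OF pb2]
        poly_time_Then[OF F] poly_time_valid poly_time_output[OF F])
      show "length (normalise d (snd z)) = Suc d \<and> (\<forall>g\<in>set (G (fst (fst z))). length g = Suc d)"
        if "z \<in> ?K3" for z
        using that lenv[of z] len by (auto simp: normalise_def)
    qed (use lenv in auto)
  qed
  then show "poly_time (\<lambda>z. \<sigma> (fst z)) ?K1 (Then input (collectP
     (Cond (dot_ofP (Suc d) (sndP input) (constP (enc_rats (ones d))))
       (Then (Fork (fstP input) (normaliseP d)) (validP d)) (constP (VNum 0)))))
     (\<lambda>z. VPair (enc_vecs (G (fst z))) (enc_vecs (snd z)))
     (\<lambda>z. enc_list (map enc_rats (collect (?f (G (fst z))) (snd z))))"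
    by (simp add: enc_vecs_def)
qed

section \<open>The candidates are the facet normals\<close>

type_synonym 'd qvec = "(rat, 'd) Finite_Cartesian_Product.vec"
type_synonym 'd rvec = "(real, 'd) Finite_Cartesian_Product.vec"
type_synonym 'd hvec = "real \<times> 'd rvec"

definition vec_of :: "rat list \<Rightarrow> rat ^ 'd::enum" where
  "vec_of l = (\<chi> j. l ! inv_into {..<CARD('d)} ((!) enum_class.enum) j)"

definition coords :: "rat ^ 'd::enum \<Rightarrow> rat list" where
  "coords w = map (($) w) enum_class.enum"

definition homog :: "rat list \<Rightarrow> 'd::enum hvec" where
  "homog u = (of_rat (hd u), real_vec (vec_of (tl u)))"

lemma bij_enum: "bij_betw ((!) (enum_class.enum :: 'd list)) {..<CARD('d::enum)} UNIV"
  by (intro bij_betw_nth enum_distinct)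
    (auto simp: card_UNIV_length_enum enum_UNIV)

lemma enum_index:
  fixes j :: "'d::enum"
  obtains i where "i < CARD('d)" "j = enum_class.enum ! i"
proof -
  have "j \<in> (!) enum_class.enum ` {..<CARD('d)}"
    by (simp only: bij_betw_imp_surj_on[OF bij_enum] UNIV_I)
  then show thesis
    using that by auto
qed

lemma vec_of_nth: "i < CARD('d) \<Longrightarrow> (vec_of l :: rat ^ 'd::enum) $ (enum_class.enum ! i) = l ! i"
  using bij_betw_inv_into_left[OF bij_enum[where 'd = 'd], of i] by (simp add: vec_of_def)

lemma length_coords [simp]: "length (coords (w :: rat ^ 'd::enum)) = CARD('d)"
  by (simp add: coords_def card_UNIV_length_enum)

lemma coords_vec_of: "length l = CARD('d::enum) \<Longrightarrow> coords (vec_of l :: 'd qvec) = l"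
  by (rule nth_equalityI) (simp_all add: coords_def card_UNIV_length_enum[symmetric] vec_of_nth)

lemma vec_of_coords: "vec_of (coords w) = (w :: rat ^ 'd::enum)"
proof -
  have "(vec_of (coords w) :: 'd qvec) $ j = w $ j" for j
  proof -
    obtain i where "i < CARD('d)" "j = enum_class.enum ! i"
      by (rule enum_index)
    then show ?thesis
      by (simp add: vec_of_nth) (simp add: coords_def card_UNIV_length_enum)
  qed
  then show ?thesis
    by (simp add: Finite_Cartesian_Product.vec_eq_iff)
qed

lemma enc_vec_eq: "enc_vec w = enc_rats (coords w)"
  by (simp add: enc_vec_def enc_rats_def coords_def comp_def)

lemma sum_enum: "(\<Sum>j\<in>UNIV. f j) = (\<Sum>i<CARD('d). f (enum_class.enum ! i :: 'd::enum))"
  by (rule sum.reindex_bij_betw[symmetric, OF bij_enum])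

lemma dot_sum: "length u = length v \<Longrightarrow> dot u v = (\<Sum>i<length u. u ! i * v ! i)"
  by (induction u v rule: dot.induct) (auto simp: sum.lessThan_Suc_shift simp del: sum.lessThan_Suc)

lemma homog_dot:
  assumes "length u = Suc CARD('d::enum)" "length v = Suc CARD('d)"
  shows "(homog u :: 'd hvec) \<bullet> homog v = of_rat (dot u v)"
proof -
  obtain a l b m where uv: "u = a # l" "v = b # m" "length l = CARD('d)" "length m = CARD('d)"
    using assms by (metis length_Suc_conv)
  have "real_vec (vec_of l :: 'd qvec) \<bullet> real_vec (vec_of m) = (\<Sum>i<CARD('d). of_rat (l ! i * m ! i))"
    by (simp add: inner_vec_def sum_enum real_vec_def vec_of_nth of_rat_mult)
  then show ?thesis
    using uv by (simp add: homog_def inner_prod_def dot_sum of_rat_add of_rat_mult of_rat_sum)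
qed

lemma axpy_nth: "i < length u \<Longrightarrow> i < length v \<Longrightarrow> axpy c u v ! i = c * u ! i + v ! i"
  by (induction c u v arbitrary: i rule: axpy.induct) (auto simp: nth_Cons split: nat.split)

lemma homog_axpy:
  assumes "length u = Suc CARD('d::enum)" "length v = Suc CARD('d)"
  shows "(homog (axpy c u v) :: 'd hvec) = of_rat c *\<^sub>R homog u + homog v"
proof -
  obtain a l b m where uv: "u = a # l" "v = b # m" "length l = CARD('d)" "length m = CARD('d)"
    using assms by (metis length_Suc_conv)
  have "real_vec (vec_of (axpy c l m)) $ j = (of_rat c *\<^sub>R real_vec (vec_of l) + real_vec (vec_of m :: 'd qvec)) $ j" for j
  proof -
    obtain i where "i < CARD('d)" "j = enum_class.enum ! i"
      by (rule enum_index)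
    then show ?thesis
      using uv by (simp add: real_vec_def vec_of_nth axpy_nth of_rat_add of_rat_mult)
  qed
  then show ?thesis
    using uv by (simp add: homog_def of_rat_add of_rat_mult Finite_Cartesian_Product.vec_eq_iff)
qed

lemma homog_Cons_replicate:
  "(homog (a # replicate CARD('d) b) :: 'd::enum hvec) = (of_rat a, \<chi> j. of_rat b)"
proof -
  have "real_vec (vec_of (replicate CARD('d) b)) $ j = (of_rat b :: real)" for j :: 'd
  proof -
    obtain i where "i < CARD('d)" "j = enum_class.enum ! i"
      by (rule enum_index)
    then show ?thesis
      by (simp add: real_vec_def vec_of_nth)
  qed
  then show ?thesis
    by (simp add: homog_def Finite_Cartesian_Product.vec_eq_iff)
qed

lemma homog_scaled:
  "length v = Suc CARD('d::enum) \<Longrightarrow> (homog (scaled CARD('d) c v) :: 'd hvec) = of_rat c *\<^sub>R homog v"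
  by (simp add: scaled_def homog_axpy zeros_def homog_Cons_replicate)
    (simp add: zero_prod_def Finite_Cartesian_Product.vec_eq_iff)

lemma homog_elim_vec:
  assumes "length g = Suc CARD('d::enum)" "length b = Suc CARD('d)" "length z = Suc CARD('d)"
  shows "(homog (elim_vec g b z) :: 'd hvec) = eliminate (homog g) (homog b) (homog z)"
  using assms
  by (simp add: elim_vec_def homog_axpy eliminate_def homog_dot of_rat_minus of_rat_divide)

text \<open>Elimination starts from the standard basis.\<close>

lemma homog_unit_lists:
  "(homog ` set (unit_lists (Suc CARD('d))) :: ('d::enum hvec) set)
     = insert (1, 0) (range (\<lambda>j. (0, axis j 1)))"
  (is "?h ` _ = _")
proof -
  let ?n = "CARD('d)" and ?u = "\<lambda>i. map (\<lambda>j. if j = i then 1 else 0 :: rat) [0..<Suc CARD('d)]"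
  have u: "?u i = (if 0 = i then 1 else 0) # map (\<lambda>j. if Suc j = i then 1 else 0) [0..<?n]" for i
    by (simp add: upt_conv_Cons map_Suc_upt[symmetric] comp_def del: upt_Suc map_Suc_upt)
  have h: "?h (?u i) = (if 0 = i then 1 else 0, real_vec (vec_of (map (\<lambda>j. if Suc j = i then 1 else 0) [0..<?n])))" for i
    unfolding u by (simp add: homog_def)
  have comp: "real_vec (vec_of (map (\<lambda>j. if Suc j = i then 1 else 0) [0..<?n]) :: 'd qvec) $ (enum_class.enum ! l)
      = (if Suc l = i then 1 else 0 :: real)" if "l < ?n" for l i
    using that by (simp add: real_vec_def vec_of_nth)
  have ex: "\<exists>l<?n. j = enum_class.enum ! l" for j :: 'd
    using enum_index[of j] by blast
  have "?h (?u 0) = (1, 0)"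
  proof -
    have "real_vec (vec_of (map (\<lambda>j. if Suc j = 0 then 1 else 0) [0..<?n]) :: 'd qvec) $ j = 0" for j
      using ex[of j] comp[of _ 0] by auto
    then show ?thesis
      unfolding h by (simp add: Finite_Cartesian_Product.vec_eq_iff)
  qed
  moreover have "?h (?u (Suc l)) = (0, axis (enum_class.enum ! l) 1)" if l: "l < ?n" for l
  proof -
    have "real_vec (vec_of (map (\<lambda>j. if Suc j = Suc l then 1 else 0) [0..<?n]) :: 'd qvec) $ j
        = axis (enum_class.enum ! l) 1 $ j" for j
    proof -
      obtain m where m: "m < ?n" "j = enum_class.enum ! m"
        using ex by blast
      have "(enum_class.enum ! m = (enum_class.enum ! l :: 'd)) = (m = l)"
        using bij_enum[where 'd = 'd] m l by (auto simp: bij_betw_def inj_on_eq_iff)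
      then show ?thesis
        using comp[OF m(1), of "Suc l"] m by (auto simp: axis_def)
    qed
    then show ?thesis
      unfolding h by (simp add: Finite_Cartesian_Product.vec_eq_iff)
  qed
  moreover have "?h ` set (unit_lists (Suc ?n)) = insert (?h (?u 0)) ((\<lambda>l. ?h (?u (Suc l))) ` {..<?n})"
  proof -
    have "{0..<Suc ?n} = insert 0 (Suc ` {..<?n})"
      by (auto simp: image_iff less_Suc_eq_0_disj)
    then show ?thesis
      unfolding unit_lists_def set_map set_upt image_image by (simp only: image_insert image_image)
  qed
  moreover have "range (\<lambda>j::'d. (0::real, axis j 1 :: 'd rvec)) = (\<lambda>l. (0, axis (enum_class.enum ! l) 1)) ` {..<?n}"
  proof -
    have "range (\<lambda>j::'d. (0::real, axis j 1 :: 'd rvec))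
        = (\<lambda>j. (0, axis j 1)) ` (!) enum_class.enum ` {..<?n}"
      by (simp only: bij_betw_imp_surj_on[OF bij_enum])
    then show ?thesis
      by (simp only: image_image)
  qed
  ultimately show ?thesis
    by simp
qed

lemma span_unit_lists: "span (homog ` set (unit_lists (Suc CARD('d))) :: ('d::enum hvec) set) = UNIV"
proof -
  let ?S = "insert (1, 0) (range (\<lambda>j. (0, axis j 1))) :: ('d hvec) set"
  have "(a, w) \<in> span ?S" for a w
  proof -
    have w: "(0::real, w) = (\<Sum>j\<in>UNIV. w $ j *\<^sub>R (0, axis j 1))"
      by (subst sum_axis[of w]) (simp add: sum_prod zero_prod_def[symmetric] sum.neutral)
    have "(\<Sum>j\<in>UNIV. w $ j *\<^sub>R (0, axis j 1)) \<in> span ?S"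
      by (intro span_sum span_mul span_base) auto
    moreover have "a *\<^sub>R (1, 0) \<in> span ?S"
      by (intro span_mul span_base) auto
    ultimately have "a *\<^sub>R (1, 0) + (0, w) \<in> span ?S"
      unfolding w[symmetric] by (intro span_add)
    then show ?thesis
      by simp
  qed
  then show ?thesis
    unfolding homog_unit_lists by auto
qed

lemma homog_pivot:
  fixes g b :: "rat list"
  assumes "length g = Suc CARD('d::enum)" "length b = Suc CARD('d)" "\<forall>z\<in>set B. length z = Suc CARD('d)"
  shows "homog ` set (collect (\<lambda>z. [elim_vec g b z]) B)
    = eliminate (homog g :: 'd hvec) (homog b) ` homog ` set B"
proof -
  have "homog ` set (collect (\<lambda>z. [elim_vec g b z]) B)
      = (\<lambda>z. homog (elim_vec g b z) :: 'd hvec) ` set B"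
    by auto
  also have "\<dots> = (\<lambda>z. eliminate (homog g) (homog b) (homog z)) ` set B"
    using assms by (intro image_cong refl homog_elim_vec) auto
  finally show ?thesis
    by (simp only: image_image)
qed

text \<open>The type argument fixes the dimension, which the rational lists do not show.\<close>

definition spans_orthogonal :: "rat list set \<Rightarrow> nat \<Rightarrow> rat list list \<Rightarrow> 'd::enum itself \<Rightarrow> bool" where
  "spans_orthogonal S k B d \<longleftrightarrow>
     span (homog ` set B :: ('d hvec) set) = {z. \<forall>g\<in>S. z \<bullet> homog g = 0}
     \<and> dim (span (homog ` set B :: ('d hvec) set)) + k = Suc CARD('d)"

lemma spans_orthogonal_eliminate:
  assumes B: "spans_orthogonal S k B TYPE('d::enum)"
    and len: "length g = Suc CARD('d)" "\<forall>z\<in>set B. length z = Suc CARD('d)"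
    and b: "b \<in> set B" "dot b g \<noteq> 0"
  shows "spans_orthogonal (insert g S) (Suc k) (collect (\<lambda>z. [elim_vec g b z]) B) TYPE('d)"
proof -
  have nz: "(homog b :: 'd hvec) \<bullet> homog g \<noteq> 0"
    using len b by (simp add: homog_dot)
  have hb: "homog b \<in> (homog ` set B :: ('d hvec) set)"
    using b by blast
  have eq: "homog ` set (collect (\<lambda>z. [elim_vec g b z]) B)
      = eliminate (homog g :: 'd hvec) (homog b) ` homog ` set B"
    using len b by (intro homog_pivot) auto
  have "span (homog ` set B :: 'd hvec set) = {z. \<forall>g\<in>S. z \<bullet> homog g = 0}"
    and dim: "dim (span (homog ` set B :: 'd hvec set)) + k = Suc CARD('d)"
    using B unfolding spans_orthogonal_def by blast+
  from this(1) have "span (eliminate (homog g) (homog b) ` homog ` set B)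
      = {z :: 'd hvec. \<forall>g\<in>insert g S. z \<bullet> homog g = 0}"
    using span_eliminate[OF hb nz] by auto
  moreover have "dim (span (eliminate (homog g) (homog b) ` homog ` set B :: 'd hvec set)) + Suc k = Suc CARD('d)"
    using dim dim_eliminate[OF hb nz] by linarith
  ultimately show ?thesis
    unfolding spans_orthogonal_def eq by blast
qed

lemma spans_orthogonal_unit_lists: "spans_orthogonal {} 0 (unit_lists (Suc CARD('d))) TYPE('d::enum)"
  by (simp add: spans_orthogonal_def span_unit_lists)

lemma complements_sound:
  assumes "\<forall>g\<in>set G. length g = Suc CARD('d::enum)" "B \<in> set (complements (Suc CARD('d)) G k)"
  shows "\<exists>S\<subseteq>set G. spans_orthogonal S k B TYPE('d)"
  using assms(2)
proof (induction k arbitrary: B)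
  case 0
  then show ?case
    using spans_orthogonal_unit_lists[where 'd = 'd] by auto
next
  case (Suc k)
  then obtain B' g b where B': "B' \<in> set (complements (Suc CARD('d)) G k)" "g \<in> set G" "b \<in> set B'" "dot b g \<noteq> 0"
      "B = collect (\<lambda>z. [elim_vec g b z]) B'"
    by (auto simp: expand_def pivots_def split: if_splits)
  obtain S where "S \<subseteq> set G" "spans_orthogonal S k B' TYPE('d)"
    using Suc.IH[OF B'(1)] by blast
  moreover have "\<forall>z\<in>set B'. length z = Suc CARD('d)"
    using length_complements[of G] assms(1) B'(1) by blast
  ultimately have "spans_orthogonal (insert g S) (Suc k) B TYPE('d)" "insert g S \<subseteq> set G"
    using spans_orthogonal_eliminate[of S k B' g b] assms(1) B' by auto
  then show ?case by blast
qed

text \<open>As long as the complement has dimension at least two, it is not contained in the line spanned by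
  \<open>v\<close>. Then some element of \<open>T\<close> is not orthogonal to it and can be eliminated next.\<close>

lemma complements_complete:
  fixes v :: "'d::enum hvec"
  assumes len: "\<forall>g\<in>set G. length g = Suc CARD('d)" and T: "T \<subseteq> set G"
    and v: "\<And>u :: 'd hvec. (\<forall>g\<in>T. u \<bullet> homog g = 0) \<Longrightarrow> u \<in> span {v}"
    and k: "k \<le> CARD('d)"
  shows "\<exists>B\<in>set (complements (Suc CARD('d)) G k). \<exists>S\<subseteq>T. spans_orthogonal S k B TYPE('d)"
  using k
proof (induction k)
  case 0
  then show ?case
    using spans_orthogonal_unit_lists[where 'd = 'd] by auto
next
  case (Suc k)
  then obtain B S where B: "B \<in> set (complements (Suc CARD('d)) G k)" "S \<subseteq> T" "spans_orthogonal S k B TYPE('d)"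
    by auto
  have lenB: "\<forall>z\<in>set B. length z = Suc CARD('d)"
    using length_complements[of G] len B(1) by blast
  have "\<exists>b\<in>set B. \<exists>g\<in>T. (homog b :: 'd hvec) \<bullet> homog g \<noteq> 0"
  proof (rule ccontr)
    assume "\<not> ?thesis"
    then have "homog b \<in> span {v}" if "b \<in> set B" for b
      using v that by blast
    then have "homog ` set B \<subseteq> span {v}"
      by blast
    then have "span (homog ` set B :: ('d hvec) set) \<subseteq> span {v}"
      by (simp add: span_minimal)
    then have "dim (span (homog ` set B :: ('d hvec) set)) \<le> dim (span {v})"
      by (rule dim_subset)
    also have "\<dots> \<le> 1"
      using dim_le_card[of "{v}" "{v}"] by (simp add: span_superset)
    finally show False
      using B(3) Suc.prems by (simp add: spans_orthogonal_def)
  qed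
  then obtain b g where bg: "b \<in> set B" "g \<in> T" "(homog b :: 'd hvec) \<bullet> homog g \<noteq> 0"
    by blast
  have "dot b g \<noteq> 0"
    using bg homog_dot[of b g, where 'd = 'd] lenB len T by auto
  then have "spans_orthogonal (insert g S) (Suc k) (collect (\<lambda>z. [elim_vec g b z]) B) TYPE('d)"
    using B bg lenB len T by (intro spans_orthogonal_eliminate) auto
  moreover have "collect (\<lambda>z. [elim_vec g b z]) B \<in> set (complements (Suc CARD('d)) G (Suc k))"
    using B(1) bg T \<open>dot b g \<noteq> 0\<close> by (force simp: expand_def pivots_def)
  ultimately show ?case
    using B(2) bg(2) by blast
qed

lemma spans_orthogonal_line:
  fixes v :: "'d::enum hvec"
  assumes "spans_orthogonal S CARD('d) B TYPE('d)" "v \<in> span (homog ` set B)" "v \<noteq> 0"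
  shows "span (homog ` set B) = span {v}"
proof -
  have "dim (span (homog ` set B :: ('d hvec) set)) = 1"
    using assms(1) unfolding spans_orthogonal_def by linarith
  moreover have "dim (span {v}) = 1"
    using assms(3) by (simp add: dim_insert)
  moreover have "span {v} \<subseteq> span (homog ` set B)"
    using assms(2) by (simp add: span_minimal)
  ultimately show ?thesis
    using subspace_dim_equal[of "span {v}" "span (homog ` set B)"] by simp
qed

lemma set_candidates:
  "v \<in> set (candidates d G) \<longleftrightarrow> (\<exists>B\<in>set (complements (Suc d) G d). \<exists>b\<in>set B. dot b (ones d) \<noteq> 0
     \<and> v = normalise d b \<and> (\<forall>g\<in>set G. 0 \<le> dot v g))"
proof -
  have "violated G v = [] \<longleftrightarrow> (\<forall>g\<in>set G. 0 \<le> dot v g)" for v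
    by (auto simp: violated_def collect_eq_Nil_iff not_less)
  then show ?thesis
    unfolding candidates_def by (auto split: if_splits)
qed

lemma length_candidates:
  "\<forall>g\<in>set G. length g = Suc d \<Longrightarrow> v \<in> set (candidates d G) \<Longrightarrow> length v = Suc d"
  using length_complements[of G "Suc d"] by (auto simp: set_candidates normalise_def)

lemma homog_normalise:
  assumes "length b = Suc CARD('d::enum)"
  shows "(homog (normalise CARD('d) b) :: 'd hvec) = (1 / ((homog b :: 'd hvec) \<bullet> homog (ones CARD('d)))) *\<^sub>R homog b"
  using assms by (simp add: normalise_def homog_scaled homog_dot of_rat_divide)

lemma inner_hom_ones: "v \<bullet> homog (ones CARD('d)) = (\<Sum>j\<in>UNIV. snd v $ j)" for v :: "'d::enum hvec"
  by (simp add: ones_def homog_Cons_replicate inner_prod_def inner_vec_def)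

text \<open>After \<open>d\<close> eliminations the complement is a line, and \<open>v\<close> spans it. The eliminated generators are
  tight for \<open>v\<close>, so a vector orthogonal to all tight generators lies on the same line.\<close>

lemma candidates_sound:
  fixes Y :: "(real ^ 'd::enum) set"
  assumes len: "\<forall>g\<in>set G. length g = Suc CARD('d)" and G: "homog ` set G = generators Y"
    and v: "v \<in> set (candidates CARD('d) G)"
  shows "facet_normal (generators Y) (homog v)"
proof -
  obtain B b where B: "B \<in> set (complements (Suc CARD('d)) G CARD('d))" and b: "b \<in> set B"
    and nz: "dot b (ones CARD('d)) \<noteq> 0" and vb: "v = normalise CARD('d) b"
    and valid: "\<forall>g\<in>set G. 0 \<le> dot v g"
    using v unfolding set_candidates by blast
  obtain S where S: "S \<subseteq> set G" "spans_orthogonal S CARD('d) B TYPE('d)"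
    using complements_sound[OF len B] by blast
  have lenb: "length b = Suc CARD('d)" and lenv: "length v = Suc CARD('d)"
    using length_complements[of G] len B b length_candidates[OF len v] by blast+
  define h where "h = (homog v :: 'd hvec)"
  have nz': "(homog b :: 'd hvec) \<bullet> homog (ones CARD('d)) \<noteq> 0"
    using nz lenb by (simp add: homog_dot)
  have h: "h = (1 / ((homog b :: 'd hvec) \<bullet> homog (ones CARD('d)))) *\<^sub>R homog b"
    unfolding h_def vb by (rule homog_normalise[OF lenb])
  have "h \<bullet> homog (ones CARD('d)) = 1"
    using nz' by (simp add: h)
  then have "snd h \<noteq> 0"
    by (auto simp: inner_hom_ones)
  moreover have "0 \<le> h \<bullet> g" if g: "g \<in> generators Y" for g
  proof -
    obtain l where "l \<in> set G" "g = homog l"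
      using g G by (metis imageE)
    then show ?thesis
      using valid len lenv by (simp add: h_def homog_dot)
  qed
  moreover have "u \<in> span {h}" if u: "\<forall>g\<in>generators Y. h \<bullet> g = 0 \<longrightarrow> u \<bullet> g = 0" for u
  proof -
    have "h \<in> span (homog ` set B)"
      unfolding h using b by (intro span_mul span_base) blast
    moreover have "h \<noteq> 0"
      using \<open>snd h \<noteq> 0\<close> by auto
    ultimately have line: "span (homog ` set B) = span {h}"
      by (rule spans_orthogonal_line[OF S(2)])
    then have perp: "span {h} = {z. \<forall>g\<in>S. z \<bullet> homog g = 0}"
      using S(2) by (simp add: spans_orthogonal_def)
    have "h \<in> span {h}"
      by (simp add: span_base)
    then have "\<forall>g\<in>S. h \<bullet> homog g = 0"
      unfolding perp by simp
    then have "\<forall>g\<in>S. u \<bullet> homog g = 0"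
      using u S(1) unfolding G[symmetric] by blast
    then show ?thesis
      unfolding perp by simp
  qed
  ultimately show ?thesis
    unfolding facet_normal_def h_def[symmetric] by blast
qed

lemma facet_normal_nonneg:
  assumes "facet_normal (generators Y) v"
  shows "0 \<le> snd v" and "0 < (\<Sum>j\<in>UNIV. snd v $ j)"
proof -
  have nonneg: "0 \<le> snd v $ j" for j
    using assms by (simp add: facet_normal_def ball_generators)
  then show "0 \<le> snd v"
    by (simp add: Finite_Cartesian_Product.less_eq_vec_def)
  obtain j where "snd v $ j \<noteq> 0"
    using assms by (auto simp: facet_normal_def Finite_Cartesian_Product.vec_eq_iff)
  then show "0 < (\<Sum>j\<in>UNIV. snd v $ j)"
    using nonneg by (intro sum_pos2[of _ j]) (auto simp: order_less_le)
qed

text \<open>Eliminating only tight generators leads to the line spanned by the facet normal, and the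
  normalisation leads to a positive multiple of it.\<close>

lemma candidates_complete:
  fixes Y :: "(real ^ 'd::enum) set"
  assumes len: "\<forall>g\<in>set G. length g = Suc CARD('d)" and G: "homog ` set G = generators Y"
    and v: "facet_normal (generators Y) v"
  obtains c l where "c \<in> set (candidates CARD('d) G)" "0 < l" "homog c = l *\<^sub>R v"
proof -
  let ?T = "{g \<in> set G. v \<bullet> homog g = 0}"
  have span: "u \<in> span {v}" if "\<forall>g\<in>?T. u \<bullet> homog g = 0" for u
  proof -
    have "\<forall>g\<in>generators Y. v \<bullet> g = 0 \<longrightarrow> u \<bullet> g = 0"
      using that unfolding G[symmetric] by blast
    then show ?thesis
      using v unfolding facet_normal_def by blast
  qed
  obtain B S where B: "B \<in> set (complements (Suc CARD('d)) G CARD('d))" and S: "S \<subseteq> ?T"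
    "spans_orthogonal S CARD('d) B TYPE('d)"
    using complements_complete[OF len _ span, of ?T "CARD('d)"] by blast
  note pos = facet_normal_nonneg(2)[OF v]
  have "v \<noteq> 0"
    using v by (auto simp: facet_normal_def)
  moreover have "v \<in> span (homog ` set B)"
    using S by (auto simp: spans_orthogonal_def)
  ultimately have line: "span (homog ` set B) = span {v}"
    by (intro spans_orthogonal_line[OF S(2)])
  have "\<exists>b\<in>set B. (homog b :: 'd hvec) \<noteq> 0"
  proof (rule ccontr)
    assume "\<not> ?thesis"
    then have "(homog ` set B :: ('d hvec) set) \<subseteq> {0}"
      by auto
    then have "span (homog ` set B :: ('d hvec) set) \<subseteq> {0}"
      by (intro span_minimal subspace_single_0)
    then show False
      using line \<open>v \<noteq> 0\<close> span_base[of v "{v}"] by auto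
  qed
  then obtain b where b: "b \<in> set B" "(homog b :: 'd hvec) \<noteq> 0"
    by blast
  have "homog b \<in> span {v}"
    unfolding line[symmetric] using b(1) by (intro span_base imageI)
  then obtain m where m: "homog b = m *\<^sub>R v"
    by (auto simp: span_singleton)
  have "m \<noteq> 0"
    using m b by auto
  have lenb: "length b = Suc CARD('d)"
    using length_complements[of G] len B b by blast
  define s where "s = (\<Sum>j\<in>UNIV. snd v $ j)"
  have bs: "(homog b :: 'd hvec) \<bullet> homog (ones CARD('d)) = m * s"
    by (simp add: m inner_hom_ones s_def sum_distrib_left)
  have hc: "homog (normalise CARD('d) b) = (1 / s) *\<^sub>R v"
    unfolding homog_normalise[OF lenb] bs using \<open>m \<noteq> 0\<close> pos by (simp add: m s_def)
  have "normalise CARD('d) b \<in> set (candidates CARD('d) G)"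
    unfolding set_candidates
  proof (intro bexI conjI ballI refl)
    have "(homog b :: 'd hvec) \<bullet> homog (ones CARD('d)) \<noteq> 0"
      using bs \<open>m \<noteq> 0\<close> pos by (simp add: s_def)
    then show "dot b (ones CARD('d)) \<noteq> 0"
      using lenb homog_dot[of b "ones CARD('d)", where 'd = 'd] by auto
    fix g assume g: "g \<in> set G"
    then have "homog g \<in> generators Y"
      unfolding G[symmetric] by blast
    then have "0 \<le> v \<bullet> homog g"
      using v unfolding facet_normal_def by blast
    then have "0 \<le> (1 / s) *\<^sub>R v \<bullet> homog g"
      using pos by (simp add: s_def)
    then have "0 \<le> real_of_rat (dot (normalise CARD('d) b) g)"
      using len g lenb by (simp add: hc[symmetric] homog_dot normalise_def)
    then show "0 \<le> dot (normalise CARD('d) b) g"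
      by simp
  qed (use B b in auto)
  then show thesis
    using hc pos by (intro that[of "normalise CARD('d) b" "1 / s"]) (auto simp: s_def)
qed

lemma halfspace_of_scale: "0 < l \<Longrightarrow> halfspace_of (l *\<^sub>R v) = halfspace_of v"
  by (rule Set.set_eqI) (simp add: in_halfspace_of zero_le_mult_iff del: inner_generators)

lemma facet_halfspaces_candidates:
  fixes Y :: "(real ^ 'd::enum) set"
  assumes "\<forall>g\<in>set G. length g = Suc CARD('d)" "homog ` set G = generators Y" "finite Y" "Y \<noteq> {}"
  shows "facet_halfspaces (upper_hull Y) = (\<lambda>c. halfspace_of (homog c)) ` set (candidates CARD('d) G)"
proof (intro equalityI subsetI)
  fix H assume "H \<in> facet_halfspaces (upper_hull Y)"
  then obtain v where v: "facet_normal (generators Y) v" "H = halfspace_of v"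
    using facet_halfspace_imp_facet_normal[OF assms(3,4)] by blast
  obtain c l where "c \<in> set (candidates CARD('d) G)" "0 < l" "homog c = l *\<^sub>R v"
    using candidates_complete[OF assms(1,2) v(1)] by blast
  then show "H \<in> (\<lambda>c. halfspace_of (homog c)) ` set (candidates CARD('d) G)"
    using v(2) halfspace_of_scale[of l v] by (intro image_eqI[of _ _ c]) simp_all
next
  fix H assume "H \<in> (\<lambda>c. halfspace_of (homog c :: 'd hvec)) ` set (candidates CARD('d) G)"
  then show "H \<in> facet_halfspaces (upper_hull Y)"
    using facet_normal_imp_facet_halfspace candidates_sound[OF assms(1,2)] by blast
qed

lemma candidates_separate:
  fixes Y :: "(real ^ 'd::enum) set"
  assumes "\<forall>g\<in>set G. length g = Suc CARD('d)" "homog ` set G = generators Y" "finite Y" "Y \<noteq> {}"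
    and "\<forall>c\<in>set (candidates CARD('d) G). 0 \<le> homog c \<bullet> (1, p)"
  shows "p \<in> upper_hull Y"
proof (rule ccontr)
  assume "p \<notin> upper_hull Y"
  then obtain v where v: "facet_normal (generators Y) v" "v \<bullet> (1, p) < 0"
    using facet_normal_separates[OF assms(3,4)] by blast
  obtain c l where c: "c \<in> set (candidates CARD('d) G)" "0 < l" "homog c = l *\<^sub>R v"
    using candidates_complete[OF assms(1,2) v(1)] by blast
  have "0 \<le> l *\<^sub>R v \<bullet> (1, p)"
    using assms(5) c(1) unfolding c(3)[symmetric] by blast
  then show False
    using v(2) c(2) by (simp add: zero_le_mult_iff del: inner_generators)
qed

section \<open>The run of the inner approximation algorithm\<close>

definition ray_lists :: "nat \<Rightarrow> rat list list" where
  "ray_lists d = map ((#) 0) (unit_lists d)"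

lemma unit_lists_Suc: "unit_lists (Suc d) = (1 # replicate d 0) # ray_lists d"
proof -
  have "[0..<Suc d] = 0 # map Suc [0..<d]"
    by (simp add: upt_conv_Cons map_Suc_upt del: upt_Suc)
  then show ?thesis
    by (simp add: unit_lists_def ray_lists_def comp_def map_replicate_const del: upt_Suc)
qed

lemma homog_ray_lists: "homog ` set (ray_lists CARD('d)) = range (\<lambda>j::'d::enum. (0, axis j 1))"
proof -
  have "homog ` set (unit_lists (Suc CARD('d))) = insert (homog (1 # replicate CARD('d) 0) :: 'd hvec) (homog ` set (ray_lists CARD('d)))"
    by (simp add: unit_lists_Suc)
  moreover have "homog (1 # replicate CARD('d) 0) = (1 :: real, 0 :: 'd rvec)"
    by (simp add: homog_Cons_replicate Finite_Cartesian_Product.vec_eq_iff)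
  ultimately have *: "insert (1, 0) (homog ` set (ray_lists CARD('d))) = insert (1, 0) (range (\<lambda>j::'d. (0::real, axis j 1 :: 'd rvec)))"
    unfolding homog_unit_lists by simp
  have fst0: "fst z = 0" if "z \<in> homog ` set (ray_lists CARD('d))" for z :: "'d hvec"
    using that by (auto simp: ray_lists_def homog_def)
  have "(1, 0) \<notin> (homog ` set (ray_lists CARD('d)) :: 'd hvec set)"
    using fst0[of "(1, 0)"] by auto
  moreover have "(1, 0) \<notin> range (\<lambda>j::'d. (0::real, axis j 1 :: 'd rvec))"
    by auto
  ultimately show ?thesis
    using * by (metis insert_ident)
qed

definition gens :: "nat \<Rightarrow> ('s \<Rightarrow> rat list) \<Rightarrow> 's list \<Rightarrow> rat list list" where
  "gens d ev xs = map (\<lambda>x. 1 # ev x) xs @ ray_lists d"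

text \<open>For the inequality \<open>v = (- c, w)\<close>, the oracle is called with the weights \<open>\<kappa> w\<close>, where \<open>\<kappa> = 1 + \<eta>\<close>;
  its answer \<open>x\<close> is reported, together with its generator, if \<open>\<kappa> w\<^sup>T f(x) < c\<close>.\<close>

definition judge :: "nat \<Rightarrow> rat \<Rightarrow> (rat list \<Rightarrow> 's) \<Rightarrow> ('s \<Rightarrow> rat list) \<Rightarrow> rat list \<Rightarrow> ('s \<times> rat list) list" where
  "judge d \<kappa> ws ev v = (let w = tl (scaled d \<kappa> v); x = ws w; y = 1 # ev x in
     if dot (hd v # w) y < 0 then [(x, y)] else [])"

definition pending :: "nat \<Rightarrow> rat \<Rightarrow> (rat list \<Rightarrow> 's) \<Rightarrow> ('s \<Rightarrow> rat list) \<Rightarrow> rat list list \<Rightarrow> ('s \<times> rat list) list" where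
  "pending d \<kappa> ws ev G = collect (judge d \<kappa> ws ev) (candidates d G)"

lemma inj_real_vec: "real_vec u = real_vec w \<Longrightarrow> u = w"
  by (simp add: real_vec_def Finite_Cartesian_Product.vec_eq_iff)

lemma vec_of_scaled:
  assumes "length v = Suc CARD('d::enum)"
  shows "(vec_of (tl (scaled CARD('d) c v)) :: 'd qvec) = c *s vec_of (tl v)"
proof -
  have "snd (homog (scaled CARD('d) c v) :: 'd hvec) = snd (of_rat c *\<^sub>R (homog v :: 'd hvec))"
    using homog_scaled[OF assms, of c] by simp
  then have "real_vec (vec_of (tl (scaled CARD('d) c v)) :: 'd qvec) = of_rat c *\<^sub>R real_vec (vec_of (tl v))"
    by (simp add: homog_def)
  also have "\<dots> = real_vec (c *s vec_of (tl v))"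
    by (simp add: real_vec_def Finite_Cartesian_Product.vec_eq_iff of_rat_mult)
  finally show ?thesis
    by (rule inj_real_vec)
qed

text \<open>A run for a single instance and accuracy. The function \<open>ev\<close> lists the objective values of a
  solution.\<close>

locale inner_run =
  fixes M :: "'d::enum momilp" and wsf :: "'d qvec \<Rightarrow> rat Matrix.vec" and ev :: "rat Matrix.vec \<Rightarrow> rat list"
    and \<eta> \<delta> :: rat and x0 :: "rat Matrix.vec"
  assumes eta: "0 < \<eta>" and delta: "0 < \<delta>"
    and ws: "\<And>w. 0 \<le> w \<Longrightarrow> ws_approx M (1 + of_rat \<delta>) (real_vec w) (real_sol (wsf w))"
    and ev: "\<And>x. real_sol x \<in> feasible M \<Longrightarrow>
      length (ev x) = CARD('d) \<and> real_vec (vec_of (ev x)) = objective M (real_sol x)"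
    and x0: "real_sol x0 \<in> feasible M"
    and nonneg: "images M \<subseteq> {y. 0 \<le> y}"
begin

abbreviation "f x \<equiv> objective M (real_sol x)"
abbreviation "pend xs \<equiv> pending CARD('d) (1 + \<eta>) (\<lambda>w. wsf (vec_of w)) ev (gens CARD('d) ev xs)"

text \<open>In each round one of the reported solutions is added. Marking a facet as treated has no influence
  on the solutions, so all marking is deferred to the end: this avoids keeping the set \<open>F\<close>, and the
  halfspaces of violated inequalities are never marked.\<close>

definition grow :: "rat Matrix.vec list \<Rightarrow> rat Matrix.vec list" where
  "grow xs = fst (hd (pend xs)) # xs"

definition sols :: "nat \<Rightarrow> rat Matrix.vec list" where
  "sols i = (grow ^^ i) [x0]"

definition feasible_list :: "rat Matrix.vec list \<Rightarrow> bool" where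
  "feasible_list xs \<longleftrightarrow> xs \<noteq> [] \<and> (\<forall>x\<in>set xs. real_sol x \<in> feasible M)"

lemma ws_feasible: "0 \<le> w \<Longrightarrow> real_sol (wsf w) \<in> feasible M"
  using ws by (simp add: ws_approx_def)

lemma homog_point: "real_sol x \<in> feasible M \<Longrightarrow> (homog (1 # ev x) :: 'd hvec) = (1, f x)"
  using ev by (simp add: homog_def)

lemma length_gens:
  assumes "feasible_list xs"
  shows "\<forall>g\<in>set (gens CARD('d) ev xs). length g = Suc CARD('d)"
  using assms ev by (auto simp: gens_def feasible_list_def ray_lists_def unit_lists_def)

lemma homog_gens:
  assumes "feasible_list xs"
  shows "homog ` set (gens CARD('d) ev xs) = generators (f ` set xs)"
proof -
  have "(\<lambda>x. homog (1 # ev x) :: 'd hvec) ` set xs = (\<lambda>x. (1, f x)) ` set xs"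
    using assms by (intro image_cong refl homog_point) (simp add: feasible_list_def)
  then show ?thesis
    using homog_ray_lists[where 'd = 'd] by (simp add: gens_def generators_def image_Un image_image)
qed

lemma facets_cands:
  assumes "feasible_list xs"
  shows "facet_halfspaces (inner_approx f (set xs)) = (\<lambda>c. halfspace_of (homog c)) ` set (candidates CARD('d) (gens CARD('d) ev xs))"
  unfolding inner_approx_def upper_hull_def[symmetric]
  using assms by (intro facet_halfspaces_candidates length_gens homog_gens) (auto simp: feasible_list_def)

lemma cand_facts:
  assumes xs: "feasible_list xs" and v: "v \<in> set (candidates CARD('d) (gens CARD('d) ev xs))"
  shows "length v = Suc CARD('d)" "0 \<le> (vec_of (tl v) :: 'd qvec)"
    and "\<And>x. x \<in> set xs \<Longrightarrow> 0 \<le> of_rat (hd v) + real_vec (vec_of (tl v)) \<bullet> f x"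
    and "0 \<le> (1 + \<eta>) *s (vec_of (tl v) :: 'd qvec)"
proof -
  show "length v = Suc CARD('d)"
    using length_candidates[OF length_gens[OF xs] v] .
  have fn: "facet_normal (generators (f ` set xs)) (homog v)"
    using candidates_sound[OF length_gens[OF xs] homog_gens[OF xs] v] .
  show nn: "0 \<le> (vec_of (tl v) :: 'd qvec)"
    using facet_normal_nonneg(1)[OF fn]
    by (simp add: homog_def real_vec_def Finite_Cartesian_Product.less_eq_vec_def)
  show "0 \<le> (1 + \<eta>) *s (vec_of (tl v) :: 'd qvec)"
    using nn eta by (simp add: Finite_Cartesian_Product.less_eq_vec_def)
  show "0 \<le> of_rat (hd v) + real_vec (vec_of (tl v)) \<bullet> f x" if "x \<in> set xs" for x
    using fn that by (auto simp: facet_normal_def ball_generators homog_def)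
qed

lemma judge_eq:
  assumes xs: "feasible_list xs" and v: "v \<in> set (candidates CARD('d) (gens CARD('d) ev xs))"
  defines "w \<equiv> (1 + \<eta>) *s (vec_of (tl v) :: 'd qvec)"
  shows "judge CARD('d) (1 + \<eta>) (\<lambda>w. wsf (vec_of w)) ev v
    = (if real_vec w \<bullet> f (wsf w) < - of_rat (hd v) then [(wsf w, 1 # ev (wsf w))] else [])"
proof -
  note facts = cand_facts[OF xs v]
  define l where "l = tl (scaled CARD('d) (1 + \<eta>) v)"
  have vl: "vec_of l = w"
    unfolding l_def w_def by (rule vec_of_scaled[OF facts(1)])
  have feas: "real_sol (wsf w) \<in> feasible M"
    using ws_feasible facts(4) by (simp add: w_def)
  have "length l = CARD('d)"
    using facts(1) by (simp add: l_def)
  then have "of_rat (dot (hd v # l) (1 # ev (wsf w))) = (homog (hd v # l) :: 'd hvec) \<bullet> homog (1 # ev (wsf w))"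
    using ev[OF feas] by (subst homog_dot) auto
  also have "\<dots> = of_rat (hd v) + real_vec w \<bullet> f (wsf w)"
    unfolding homog_point[OF feas] by (simp add: homog_def vl)
  finally have "dot (hd v # l) (1 # ev (wsf w)) < 0 \<longleftrightarrow> of_rat (hd v) + real_vec w \<bullet> f (wsf w) < 0"
    using of_rat_less_0_iff by metis
  then have "dot (hd v # l) (1 # ev (wsf w)) < 0 \<longleftrightarrow> real_vec w \<bullet> f (wsf w) < - of_rat (hd v)"
    by linarith
  then show ?thesis
    unfolding judge_def Let_def l_def[symmetric] vl by presburger
qed

lemma pendE:
  assumes xs: "feasible_list xs" and p: "p \<in> set (pend xs)"
  obtains v where "v \<in> set (candidates CARD('d) (gens CARD('d) ev xs))"
    "fst p = wsf ((1 + \<eta>) *s vec_of (tl v))" "snd p = 1 # ev (fst p)"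
    "real_vec ((1 + \<eta>) *s vec_of (tl v)) \<bullet> f (fst p) < - of_rat (hd v)"
proof -
  obtain v where v: "v \<in> set (candidates CARD('d) (gens CARD('d) ev xs))"
    and p: "p \<in> set (judge CARD('d) (1 + \<eta>) (\<lambda>w. wsf (vec_of w)) ev v)"
    using p unfolding pending_def by auto
  show thesis
    using that[OF v] p unfolding judge_eq[OF xs v] by (auto split: if_splits)
qed

lemma pend_NilD:
  assumes xs: "feasible_list xs" and fin: "pend xs = []"
    and v: "v \<in> set (candidates CARD('d) (gens CARD('d) ev xs))"
  shows "- of_rat (hd v) \<le> real_vec ((1 + \<eta>) *s vec_of (tl v)) \<bullet> f (wsf ((1 + \<eta>) *s vec_of (tl v)))"
proof -
  have "judge CARD('d) (1 + \<eta>) (\<lambda>w. wsf (vec_of w)) ev v = []"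
    using fin v unfolding pending_def collect_eq_Nil_iff by blast
  then show ?thesis
    unfolding judge_eq[OF xs v] by (simp split: if_splits)
qed

text \<open>If an earlier image were at most \<open>(1 + \<eta>)\<close> times the new one, then the nonnegative weights would
  make the violated inequality fail at the earlier image, where it is valid.\<close>

lemma grow_step:
  assumes xs: "feasible_list xs" and ne: "pend xs \<noteq> []"
  shows "feasible_list (grow xs)" and "inner_step f wsf \<eta> (set xs, {}) (set (grow xs), {})"
    and "\<exists>w. 0 \<le> w \<and> hd (grow xs) = wsf w"
    and "\<And>x. x \<in> set xs \<Longrightarrow> \<exists>c. (1 + of_rat \<eta>) * f (hd (grow xs)) $ c < f x $ c"
    and "gens CARD('d) ev (grow xs) = snd (hd (pend xs)) # gens CARD('d) ev xs"
proof -
  have "hd (pend xs) \<in> set (pend xs)"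
    using ne by simp
  then obtain v where v: "v \<in> set (candidates CARD('d) (gens CARD('d) ev xs))" and x: "fst (hd (pend xs)) = wsf ((1 + \<eta>) *s vec_of (tl v))"
    and y: "snd (hd (pend xs)) = 1 # ev (fst (hd (pend xs)))"
    and less: "real_vec ((1 + \<eta>) *s vec_of (tl v)) \<bullet> f (fst (hd (pend xs))) < - of_rat (hd v)"
    by (rule pendE[OF xs])
  note facts = cand_facts[OF xs v]
  define w where "w = (vec_of (tl v) :: 'd qvec)"
  show "\<exists>w. 0 \<le> w \<and> hd (grow xs) = wsf w"
    using facts(4) x by (auto simp: grow_def)
  show "feasible_list (grow xs)"
    using xs x ws_feasible[OF facts(4)] by (auto simp: feasible_list_def grow_def)
  have "halfspace (real_vec w) (- of_rat (hd v)) \<in> facet_halfspaces (inner_approx f (set xs)) - {}"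
    using v facets_cands[OF xs] by (auto simp: halfspace_of_def homog_def w_def)
  moreover have "hpO_WS f wsf ((1 + \<eta>) *s w) (- of_rat (hd v)) = NotInside (fst (hd (pend xs)))"
    using less x by (simp add: hpO_WS_def Let_def w_def)
  ultimately show "inner_step f wsf \<eta> (set xs, {}) (set (grow xs), {})"
    using inner_step.not_inside[of w "- of_rat (hd v)" f "set xs" "{}" wsf \<eta>] by (simp add: grow_def)
  show "\<exists>c. (1 + of_rat \<eta>) * f (hd (grow xs)) $ c < f x $ c" if "x \<in> set xs" for x
  proof (rule ccontr)
    assume "\<not> ?thesis"
    then have "f x \<le> (1 + of_rat \<eta>) *\<^sub>R f (hd (grow xs))"
      by (simp add: Finite_Cartesian_Product.less_eq_vec_def not_less)
    then have "0 \<le> (1 + of_rat \<eta>) *\<^sub>R f (hd (grow xs)) - f x"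
      by (simp add: Finite_Cartesian_Product.less_eq_vec_def)
    moreover have "0 \<le> real_vec w"
      using facts(2) by (simp add: real_vec_def w_def Finite_Cartesian_Product.less_eq_vec_def)
    ultimately have "0 \<le> real_vec w \<bullet> ((1 + of_rat \<eta>) *\<^sub>R f (hd (grow xs)) - f x)"
      by (intro inner_nonneg)
    then have "real_vec w \<bullet> f x \<le> (1 + of_rat \<eta>) * (real_vec w \<bullet> f (hd (grow xs)))"
      by (simp add: inner_diff_right)
    also have "\<dots> = real_vec ((1 + \<eta>) *s w) \<bullet> f (hd (grow xs))"
      by (simp add: real_vec_def inner_vec_def sum_distrib_left of_rat_mult of_rat_add algebra_simps)
    also have "\<dots> < - of_rat (hd v)"
      using less by (simp add: grow_def w_def)
    finally show False
      using facts(3)[OF that] by (simp add: w_def)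
  qed
  show "gens CARD('d) ev (grow xs) = snd (hd (pend xs)) # gens CARD('d) ev xs"
    unfolding y by (simp add: gens_def grow_def)
qed

lemma sols_0 [simp]: "sols 0 = [x0]"
  by (simp add: sols_def)

lemma sols_Suc: "sols (Suc i) = grow (sols i)"
  by (simp add: sols_def)

lemma feasible_sols: "(\<And>j. j < i \<Longrightarrow> pend (sols j) \<noteq> []) \<Longrightarrow> feasible_list (sols i)"
proof (induction i)
  case 0
  then show ?case
    using x0 by (simp add: feasible_list_def)
next
  case (Suc i)
  then show ?case
    unfolding sols_Suc by (intro grow_step(1)) auto
qed

lemma steps_sols:
  "(\<And>j. j < i \<Longrightarrow> pend (sols j) \<noteq> []) \<Longrightarrow> (inner_step f wsf \<eta>)\<^sup>*\<^sup>* ({x0}, {}) (set (sols i), {})"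
proof (induction i)
  case (Suc i)
  then have "inner_step f wsf \<eta> (set (sols i), {}) (set (sols (Suc i)), {})"
    unfolding sols_Suc by (intro grow_step(2) feasible_sols) auto
  then show ?case
    using Suc by (meson less_SucI rtranclp.rtrancl_into_rtrancl)
qed simp

text \<open>The last round has asked the oracle about every facet, always with the answer that nothing is
  violated. The answer depends only on the weights, so each facet can be marked in turn.\<close>

lemma mark_facets:
  assumes xs: "feasible_list xs" and fin: "pend xs = []"
  shows "(inner_step f wsf \<eta>)\<^sup>*\<^sup>* (set xs, {}) (set xs, facet_halfspaces (inner_approx f (set xs)))"
proof -
  let ?H = "facet_halfspaces (inner_approx f (set xs))"
  have "(inner_step f wsf \<eta>)\<^sup>*\<^sup>* (set xs, {}) (set xs, F)" if "finite F" "F \<subseteq> ?H" for F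
    using that
  proof (induction F)
    case (insert H F)
    obtain v where v: "v \<in> set (candidates CARD('d) (gens CARD('d) ev xs))" "H = halfspace_of (homog v)"
      using insert.prems facets_cands[OF xs] by auto
    define w where "w = (vec_of (tl v) :: 'd qvec)"
    have H: "H = halfspace (real_vec w) (- of_rat (hd v))"
      by (simp add: v(2) halfspace_of_def homog_def w_def)
    have "hpO_WS f wsf ((1 + \<eta>) *s w) (- of_rat (hd v)) = Inside"
      using pend_NilD[OF xs fin v(1)] by (simp add: hpO_WS_def w_def)
    then have "inner_step f wsf \<eta> (set xs, F) (set xs, insert H F)"
      using insert.prems insert.hyps(2) unfolding H by (intro inner_step.inside) auto
    then show ?case
      using insert by (meson insert_subset rtranclp.rtrancl_into_rtrancl)
  qed simp
  moreover have "finite ?H"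
    by (simp add: facets_cands[OF xs])
  ultimately show ?thesis
    by blast
qed

lemma output_sols:
  assumes "\<And>j. j < i \<Longrightarrow> pend (sols j) \<noteq> []" and "pend (sols i) = []"
  shows "inner_algorithm_output f wsf \<eta> x0 (set (sols i))"
  unfolding inner_algorithm_output_def
  using steps_sols[OF assms(1)] mark_facets[OF feasible_sols[OF assms(1)] assms(2)]
  by (intro exI[of _ "facet_halfspaces (inner_approx f (set (sols i)))"]) (auto intro: rtranclp_trans)

text \<open>Every facet inequality holds for the images of all solutions up to the factor \<open>1 + \<epsilon>\<close>, the
  product of the factor of the relaxation and that of the oracle.\<close>

lemma convex_approx_sols:
  assumes i: "\<And>j. j < i \<Longrightarrow> pend (sols j) \<noteq> []" and fin: "pend (sols i) = []"
    and eps: "(1 + \<eta>) * (1 + \<delta>) = 1 + \<epsilon>"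
  shows "convex_approx_set M (1 + of_rat \<epsilon>) (real_sol ` set (sols i))"
proof -
  note xs = feasible_sols[OF i]
  let ?xs = "sols i"
  have "\<exists>u\<in>convex hull (objective M ` real_sol ` set ?xs). u \<le> (1 + of_rat \<epsilon>) *\<^sub>R objective M x"
    if x: "x \<in> feasible M" for x
  proof -
    let ?p = "(1 + of_rat \<epsilon>) *\<^sub>R objective M x"
    have "?p \<in> upper_hull (f ` set ?xs)"
    proof (rule candidates_separate[OF length_gens[OF xs] homog_gens[OF xs]])
      show "\<forall>c\<in>set (candidates CARD('d) (gens CARD('d) ev ?xs)). 0 \<le> homog c \<bullet> (1, ?p)"
      proof
        fix v assume v: "v \<in> set (candidates CARD('d) (gens CARD('d) ev ?xs))"
        define w where "w = (1 + \<eta>) *s (vec_of (tl v) :: 'd qvec)"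
        have "- of_rat (hd v) \<le> real_vec w \<bullet> f (wsf w)"
          using pend_NilD[OF xs fin v] by (simp add: w_def)
        also have "\<dots> \<le> (1 + of_rat \<delta>) * (real_vec w \<bullet> objective M x)"
          using ws[OF cand_facts(4)[OF xs v]] x by (simp add: ws_approx_def w_def)
        also have "\<dots> = of_rat ((1 + \<eta>) * (1 + \<delta>)) * (real_vec (vec_of (tl v)) \<bullet> objective M x)"
          by (simp add: w_def real_vec_def inner_vec_def sum_distrib_left of_rat_mult of_rat_add algebra_simps)
        also have "\<dots> = real_vec (vec_of (tl v)) \<bullet> ?p"
          by (simp add: eps of_rat_add)
        finally show "0 \<le> homog v \<bullet> (1, ?p)"
          by (simp add: homog_def)
      qed
    qed (use xs in \<open>auto simp: feasible_list_def\<close>)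
    then obtain h r where hr: "?p = h + r" "h \<in> convex hull (f ` set ?xs)" "0 \<le> r"
      unfolding upper_hull_eq by blast
    then have "h \<le> ?p"
      by (simp add: Finite_Cartesian_Product.less_eq_vec_def)
    then show ?thesis
      using hr(2) by (auto simp: image_image)
  qed
  moreover have "real_sol ` set ?xs \<subseteq> feasible M"
    using xs by (auto simp: feasible_list_def)
  ultimately show ?thesis
    unfolding convex_approx_set_def by blast
qed

text \<open>The solutions whose lengths have to be bounded: the initial one and all possible answers of the
  oracle.\<close>

definition reached :: "rat Matrix.vec set" where
  "reached = insert x0 (wsf ` {w. 0 \<le> w})"

lemma reached_feasible: "x \<in> reached \<Longrightarrow> real_sol x \<in> feasible M"
  using x0 ws_feasible by (auto simp: reached_def)

lemma sols_reached: "(\<And>j. j < i \<Longrightarrow> pend (sols j) \<noteq> []) \<Longrightarrow> set (sols i) \<subseteq> reached \<and> length (sols i) = Suc i"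
proof (induction i)
  case 0
  then show ?case
    by (simp add: reached_def)
next
  case (Suc i)
  then have ih: "set (sols i) \<subseteq> reached" "length (sols i) = Suc i" and ne: "pend (sols i) \<noteq> []"
    and xs: "feasible_list (sols i)"
    by (auto intro: feasible_sols)
  from grow_step(3)[OF xs ne] ih show ?case
    unfolding sols_Suc by (auto simp: grow_def reached_def)
qed

lemma iterations_bounded:
  assumes l: "\<And>x q. x \<in> reached \<Longrightarrow> q \<in> set (ev x) \<Longrightarrow> rat_len q \<le> l"
    and r: "1 \<le> \<eta> * of_nat r"
    and ne: "\<And>j. j < i \<Longrightarrow> pend (sols j) \<noteq> []"
  shows "i < (2 * r * l + 2) ^ CARD('d)"
proof (rule card_pairwise_nonapproximating[of "of_rat \<eta>" r i "\<lambda>j. f (hd (sols j))" l])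
  show "0 < real_of_rat \<eta>"
    using eta by simp
  have "real_of_rat 1 \<le> real_of_rat (\<eta> * of_nat r)"
    using r by (simp only: of_rat_less_eq)
  then show "1 \<le> real_of_rat \<eta> * real r"
    by (simp add: of_rat_mult)
next
  fix j and c :: 'd assume j: "j \<le> i"
  have ne': "\<And>k. k < j \<Longrightarrow> pend (sols k) \<noteq> []"
    using ne j by simp
  have "hd (sols j) \<in> reached"
    using sols_reached[OF ne'] hd_in_set[of "sols j"] by fastforce
  then have feas: "real_sol (hd (sols j)) \<in> feasible M" and lq: "\<And>q. q \<in> set (ev (hd (sols j))) \<Longrightarrow> rat_len q \<le> l"
    using l reached_feasible by auto
  define q where "q = (vec_of (ev (hd (sols j))) :: 'd qvec) $ c"
  have fc: "f (hd (sols j)) $ c = of_rat q"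
    using ev[OF feas] by (simp add: q_def real_vec_def flip: ev[OF feas, THEN conjunct2])
  have "q \<in> set (coords (vec_of (ev (hd (sols j))) :: 'd qvec))"
    by (auto simp: coords_def q_def enum_UNIV)
  then have len: "rat_len q \<le> l"
    using ev[OF feas] lq by (simp add: coords_vec_of)
  have "0 \<le> f (hd (sols j)) $ c"
    using nonneg feas by (auto simp: images_def Finite_Cartesian_Product.less_eq_vec_def)
  then have q0: "0 \<le> q"
    by (simp add: fc)
  show "f (hd (sols j)) $ c = 0 \<or> 0 < f (hd (sols j)) $ c \<and> 1 \<le> f (hd (sols j)) $ c * 2 ^ l \<and> f (hd (sols j)) $ c \<le> 2 ^ l"
  proof (cases "q = 0")
    case False
    then have "q \<le> 2 ^ l" "1 \<le> q * 2 ^ l"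
      using rat_abs_bounds[OF False len] q0 by auto
    then have "real_of_rat q \<le> real_of_rat (2 ^ l)" "real_of_rat 1 \<le> real_of_rat (q * 2 ^ l)"
      by (simp_all only: of_rat_less_eq)
    then show ?thesis
      using q0 False by (simp add: fc of_rat_power of_rat_mult)
  qed (simp add: fc)
next
  fix k j assume kj: "k < j" "j \<le> i"
  have later: "hd (sols k) \<in> set (sols (k + n))" for n
  proof (induction n)
    case 0
    have "sols k \<noteq> []"
      by (cases k) (simp_all add: sols_Suc grow_def)
    then show ?case by simp
  qed (simp add: sols_Suc grow_def)
  obtain m where m: "j = Suc m" "k \<le> m"
    using kj by (cases j) auto
  then have "hd (sols k) \<in> set (sols m)"
    using later[of "m - k"] by simp
  moreover have "feasible_list (sols m)" "pend (sols m) \<noteq> []"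
    using ne kj m by (auto intro: feasible_sols)
  ultimately show "\<exists>c. (1 + real_of_rat \<eta>) * f (hd (sols j)) $ c < f (hd (sols k)) $ c"
    unfolding m(1) sols_Suc by (rule grow_step(4)[rotated 2])
qed

end

section \<open>The inner approximation program\<close>

lemma poly_time_hd: "poly_time \<sigma> K P x (\<lambda>k. enc_rats (u k)) \<Longrightarrow> (\<And>k. k \<in> K \<Longrightarrow> length (u k) = Suc n)
    \<Longrightarrow> poly_time \<sigma> K (fstP P) x (\<lambda>k. VNum (hd (u k)))"
  by (rule poly_time_fst[of _ _ _ _ _ "\<lambda>k. enc_rats (tl (u k))"])
    (erule poly_time_cong, simp_all add: enc_rats_Suc)

lemma poly_time_tl: "poly_time \<sigma> K P x (\<lambda>k. enc_rats (u k)) \<Longrightarrow> (\<And>k. k \<in> K \<Longrightarrow> length (u k) = Suc n)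
    \<Longrightarrow> poly_time \<sigma> K (sndP P) x (\<lambda>k. enc_rats (tl (u k)))"
  by (rule poly_time_snd[of _ _ _ _ "\<lambda>k. VNum (hd (u k))"])
    (erule poly_time_cong, simp_all add: enc_rats_Suc)

lemma poly_time_cons_rats:
  "poly_time \<sigma> K P x (\<lambda>k. VNum (a k)) \<Longrightarrow> poly_time \<sigma> K Q x (\<lambda>k. enc_rats (u k))
    \<Longrightarrow> poly_time \<sigma> K (Fork P Q) x (\<lambda>k. enc_rats (a k # u k))"
  using poly_time_Fork by fastforce

text \<open>The size of an arbitrary program may include the length of an argument of its own. It is
  exchanged for the size of the caller, in which that length is bounded.\<close>

lemma poly_time_call:
  assumes "poly_time \<tau> J P x y" "\<And>k. k \<in> K \<Longrightarrow> h k \<in> J" "poly_bounded \<sigma> K (\<lambda>k. \<tau> (h k))"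
  shows "poly_time \<sigma> K P (\<lambda>k. x (h k)) (\<lambda>k. y (h k))"
proof -
  obtain R where R: "poly_bounded (\<lambda>k. \<tau> (h k)) K R" "\<And>k. k \<in> K \<Longrightarrow> run P (x (h k)) (R k) (y (h k))"
    using poly_timeE[OF poly_time_reindex[OF assms(1), where h = h, OF assms(2)]] by blast
  show ?thesis
    by (rule poly_timeI[OF poly_bounded_compose[OF R(1) assms(3)]]) (use R(2) in auto)
qed

text \<open>With these choices the errors of the oracle and of the relaxed halfspaces multiply to exactly
  \<open>1 + \<epsilon>\<close>.\<close>

definition accuracy :: "rat \<Rightarrow> rat" where "accuracy \<epsilon> = \<epsilon> / (\<epsilon> + 2)"
definition slack :: "rat \<Rightarrow> rat" where "slack \<epsilon> = 1 / 2 * \<epsilon>"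

lemma accuracy_slack:
  assumes "0 < \<epsilon>"
  shows "0 < accuracy \<epsilon>" "0 < slack \<epsilon>" "(1 + slack \<epsilon>) * (1 + accuracy \<epsilon>) = 1 + \<epsilon>"
  using assms by (simp_all add: accuracy_def slack_def field_simps)

definition enc_found :: "rat Matrix.vec \<times> rat list \<Rightarrow> val" where
  "enc_found p = VPair (enc_sol (fst p)) (enc_rats (snd p))"

text \<open>Each stage pairs its input with a newly computed value, so that the earlier values are reached by
  iterated first components: the test receives \<open>((((ctx, v), w), x), y)\<close>.\<close>

definition testP :: "nat \<Rightarrow> prog" where
  "testP d = (let v = sndP (fstP (fstP (fstP input))); w = sndP (fstP (fstP input));
      y = Fork (constP (VNum 1)) (sndP input) in
    Cond (lessP (dot_ofP (Suc d) (Fork (fstP v) w) y) (constP (VNum 0)))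
      (singletonP (Fork (sndP (fstP input)) y)) (constP (VNum 0)))"

definition judgeP :: "nat \<Rightarrow> prog \<Rightarrow> prog \<Rightarrow> prog" where
  "judgeP d WS E =
     Then (Fork input (sndP (scaledP d (sndP (sndP (fstP input))) (sndP input))))
     (Then (Fork input (Then (Fork (fstP (fstP (fstP input)))
         (Fork (fstP (sndP (fstP (fstP input)))) (sndP input))) WS))
     (Then (Fork input (Then (Fork (fstP (fstP (fstP (fstP input)))) (sndP input)) E))
     (testP d)))"

definition pendingP :: "nat \<Rightarrow> prog \<Rightarrow> prog \<Rightarrow> prog" where
  "pendingP d WS E = Then (Fork (fstP input) (Then (sndP (sndP input)) (candidatesP d)))
     (collectP (judgeP d WS E))"

definition growP :: "nat \<Rightarrow> prog \<Rightarrow> prog \<Rightarrow> prog" where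
  "growP d WS E = Then (Fork input (fstP (pendingP d WS E)))
     (Fork (fstP (fstP input))
       (Fork (Fork (fstP (sndP input)) (fstP (sndP (fstP input))))
         (Fork (sndP (sndP input)) (sndP (sndP (fstP input))))))"

definition initP :: "nat \<Rightarrow> prog \<Rightarrow> prog \<Rightarrow> prog" where
  "initP d WS E =
     Then (Fork (Fork (fstP input)
         (Fork (divideP (sndP input) (addP (sndP input) (constP (VNum 2))))
           (addP (constP (VNum 1)) (multP (constP (VNum (1 / 2))) (sndP input)))))
       (Then (Fork (fstP input) (Fork (constP (VNum 1)) (constP (enc_rats (replicate d 0))))) WS))
     (Then (Fork input (Then (Fork (fstP (fstP input)) (sndP input)) E))
     (Fork (fstP (fstP input)) (Fork (singletonP (sndP (fstP input)))
       (Fork (Fork (constP (VNum 1)) (sndP input)) (constP (enc_vecs (ray_lists d)))))))"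

definition inner_prog :: "nat \<Rightarrow> prog \<Rightarrow> prog \<Rightarrow> prog" where
  "inner_prog d WS E = fstP (sndP (Then (initP d WS E) (While (nonemptyP (pendingP d WS E)) (growP d WS E))))"

abbreviation context_val :: "('i \<Rightarrow> val) \<Rightarrow> 'i \<times> rat \<Rightarrow> val" where
  "context_val code s \<equiv> VPair (code (fst s)) (VPair (VNum (accuracy (snd s))) (VNum (1 + slack (snd s))))"

text \<open>All bounds are uniform over a set \<open>T\<close> of pairs of an instance and an accuracy. For a polynomial-time
  approximation scheme \<open>T\<close> consists of all instances with one fixed accuracy, for a fully polynomial
  one of all pairs; the program is the same. The size \<open>\<tau>\<close> accounts for the inverse of the accuracy.
  The initial solution must not depend on the accuracy of the scheme, which is why it is computed
  with accuracy \<open>1\<close> for the weight \<open>0\<close>.\<close>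

locale inner_program =
  fixes code :: "'i \<Rightarrow> val" and prob :: "'i \<Rightarrow> 'd::enum momilp" and WS E :: prog
    and ev :: "'i \<Rightarrow> rat Matrix.vec \<Rightarrow> rat list"
    and wsf :: "'i \<Rightarrow> rat \<Rightarrow> 'd qvec \<Rightarrow> rat Matrix.vec"
    and T :: "('i \<times> rat) set" and \<tau> :: "'i \<times> rat \<Rightarrow> nat"
  assumes nonneg: "\<And>I. images (prob I) \<subseteq> {y. 0 \<le> y}"
    and ws: "\<And>I \<epsilon> w. 0 < \<epsilon> \<Longrightarrow> 0 \<le> w \<Longrightarrow> ws_approx (prob I) (1 + of_rat \<epsilon>) (real_vec w) (real_sol (wsf I \<epsilon> w))"
    and ev: "\<And>I x. real_sol x \<in> feasible (prob I) \<Longrightarrow>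
      length (ev I x) = CARD('d) \<and> real_vec (vec_of (ev I x)) = objective (prob I) (real_sol x)"
    and pos: "\<And>s. s \<in> T \<Longrightarrow> 0 < snd s"
    and code_size: "\<And>s. s \<in> T \<Longrightarrow> len (code (fst s)) \<le> \<tau> s"
    and eps_size: "\<And>s. s \<in> T \<Longrightarrow> rat_len (snd s) \<le> \<tau> s"
    and eps_inverse: "\<And>s. s \<in> T \<Longrightarrow> 1 \<le> snd s * of_nat (\<tau> s)"
    and WS_time: "poly_time (\<lambda>z. \<tau> (fst z) + len (enc_rats (snd z)))
      {(s, w). s \<in> T \<and> length w = CARD('d) \<and> 0 \<le> (vec_of w :: 'd qvec)} WS
      (\<lambda>z. VPair (code (fst (fst z))) (VPair (VNum (accuracy (snd (fst z)))) (enc_rats (snd z))))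
      (\<lambda>z. enc_sol (wsf (fst (fst z)) (accuracy (snd (fst z))) (vec_of (snd z))))"
    and WS_size: "poly_bounded (\<lambda>z. \<tau> (fst z)) {(s, w). s \<in> T \<and> 0 \<le> w}
      (\<lambda>z. len (enc_sol (wsf (fst (fst z)) (accuracy (snd (fst z))) (snd z))))"
    and WS_init: "poly_time \<tau> T WS
      (\<lambda>s. VPair (code (fst s)) (VPair (VNum 1) (enc_rats (replicate CARD('d) 0))))
      (\<lambda>s. enc_sol (wsf (fst s) 1 0))"
    and E_time: "poly_time (\<lambda>z. \<tau> (fst z) + len (enc_sol (snd z)))
      {(s, x). s \<in> T \<and> real_sol x \<in> feasible (prob (fst s))} E
      (\<lambda>z. VPair (code (fst (fst z))) (enc_sol (snd z))) (\<lambda>z. enc_rats (ev (fst (fst z)) (snd z)))"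
begin

abbreviation "wsa s \<equiv> wsf (fst s) (accuracy (snd s))"
abbreviation "start s \<equiv> wsf (fst s) 1 0"
abbreviation "reach s \<equiv> inner_run.reached (wsa s) (start s)"
abbreviation "ctx \<equiv> context_val code"
abbreviation "eva s \<equiv> ev (fst s)"

lemma run_loc: "s \<in> T \<Longrightarrow>
    inner_run (prob (fst s)) (wsa s) (eva s) (slack (snd s)) (accuracy (snd s)) (start s)"
proof
  assume s: "s \<in> T"
  note eps = accuracy_slack[OF pos[OF s]]
  show "0 < slack (snd s)" "0 < accuracy (snd s)"
    using eps by auto
  show "ws_approx (prob (fst s)) (1 + of_rat (accuracy (snd s))) (real_vec w) (real_sol (wsa s w))"
    if "0 \<le> w" for w
    using ws[OF eps(1) that] .
  show "real_sol (start s) \<in> feasible (prob (fst s))"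
    using ws[of 1 0 "fst s"] by (simp add: ws_approx_def)
qed (use ev nonneg in auto)

definition sol_list :: "'i \<times> rat \<Rightarrow> nat \<Rightarrow> rat Matrix.vec list" where
  "sol_list s = inner_run.sols (wsa s) (eva s) (slack (snd s)) (start s)"

definition gen_list :: "'i \<times> rat \<Rightarrow> nat \<Rightarrow> rat list list" where
  "gen_list s i = gens CARD('d) (eva s) (sol_list s i)"

definition found :: "'i \<times> rat \<Rightarrow> nat \<Rightarrow> (rat Matrix.vec \<times> rat list) list" where
  "found s i = pending CARD('d) (1 + slack (snd s)) (\<lambda>w. wsa s (vec_of w)) (eva s) (gen_list s i)"

definition rounds :: "'i \<times> rat \<Rightarrow> nat" where
  "rounds s = (LEAST i. found s i = [])"

text \<open>The family of calls is arbitrary: \<open>sit k\<close> is the instance and accuracy in which the \<open>k\<close>-th call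
  takes place.\<close>

lemma poly_time_judge:
  assumes sit: "\<And>k. k \<in> K \<Longrightarrow> sit k \<in> T" and len: "\<And>k. k \<in> K \<Longrightarrow> length (v k) = Suc CARD('d)"
    and nn: "\<And>k. k \<in> K \<Longrightarrow> 0 \<le> (1 + slack (snd (sit k))) *s (vec_of (tl (v k)) :: 'd qvec)"
    and pb\<tau>: "poly_bounded \<sigma> K (\<lambda>k. \<tau> (sit k))"
    and pb: "poly_bounded \<sigma> K (\<lambda>k. len (VPair (ctx (sit k)) (enc_rats (v k))))"
  shows "poly_time \<sigma> K (judgeP CARD('d) WS E) (\<lambda>k. VPair (ctx (sit k)) (enc_rats (v k)))
    (\<lambda>k. enc_list (map enc_found (judge CARD('d) (1 + slack (snd (sit k))) (\<lambda>w. wsa (sit k) (vec_of w))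
      (eva (sit k)) (v k))))"
proof -
  define w where "w k = tl (scaled CARD('d) (1 + slack (snd (sit k))) (v k))" for k
  define x where "x k = wsa (sit k) (vec_of (w k))" for k
  define x0 where "x0 k = VPair (ctx (sit k)) (enc_rats (v k))" for k
  define x1 where "x1 k = VPair (x0 k) (enc_rats (w k))" for k
  define x2 where "x2 k = VPair (x1 k) (enc_sol (x k))" for k
  define x3 where "x3 k = VPair (x2 k) (enc_rats (eva (sit k) (x k)))" for k
  have lenw: "length (w k) = CARD('d)" and vw: "0 \<le> (vec_of (w k) :: 'd qvec)" if "k \<in> K" for k
    using len[OF that] nn[OF that] vec_of_scaled[OF len[OF that]] by (simp_all add: w_def)
  have feas: "real_sol (x k) \<in> feasible (prob (fst (sit k)))" if "k \<in> K" for k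
    using ws[OF accuracy_slack(1)[OF pos[OF sit[OF that]]] vw[OF that]] by (simp add: x_def ws_approx_def)
  have id0: "poly_time \<sigma> K input x0 (\<lambda>k. VPair (ctx (sit k)) (enc_rats (v k)))"
    using poly_time_input_val[OF pb] by (simp add: x0_def[abs_def])
  have "poly_time \<sigma> K (sndP (scaledP CARD('d) (sndP (sndP (fstP input))) (sndP input))) x0 (\<lambda>k. enc_rats (w k))"
    unfolding w_def
    by (intro poly_time_tl poly_time_scaled poly_time_snd[OF poly_time_snd[OF poly_time_fst[OF id0]]]
        poly_time_snd[OF id0]) (use len in auto)
  from poly_time_Fork[OF id0 this]
  have F1: "poly_time \<sigma> K (Fork input (sndP (scaledP CARD('d) (sndP (sndP (fstP input))) (sndP input)))) x0 x1"
    by (simp add: x1_def[abs_def] x0_def[abs_def])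
  have id1: "poly_time \<sigma> K input x1 (\<lambda>k. VPair (VPair (ctx (sit k)) (enc_rats (v k))) (enc_rats (w k)))"
    using poly_time_input_val[OF poly_time_output[OF F1]] by (simp add: x1_def[abs_def] x0_def[abs_def])
  note w1 = poly_time_snd[OF id1]
  have pbw: "poly_bounded \<sigma> K (\<lambda>k. \<tau> (sit k) + len (enc_rats (w k)))"
    by (intro poly_bounded_add pb\<tau> poly_time_output[OF w1])
  have WSk: "poly_time \<sigma> K WS
      (\<lambda>k. VPair (code (fst (sit k))) (VPair (VNum (accuracy (snd (sit k)))) (enc_rats (w k))))
      (\<lambda>k. enc_sol (x k))"
    using poly_time_call[OF WS_time, of K "\<lambda>k. (sit k, w k)" \<sigma>] pbw sit lenw vw by (simp add: x_def)
  have "poly_time \<sigma> K (Then (Fork (fstP (fstP (fstP input)))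
         (Fork (fstP (sndP (fstP (fstP input)))) (sndP input))) WS) x1 (\<lambda>k. enc_sol (x k))"
    by (intro poly_time_Then[OF _ WSk] poly_time_Fork w1 poly_time_fst[OF poly_time_fst[OF poly_time_fst[OF id1]]]
        poly_time_fst[OF poly_time_snd[OF poly_time_fst[OF poly_time_fst[OF id1]]]])
  from poly_time_Fork[OF id1 this]
  have F2: "poly_time \<sigma> K (Fork input (Then (Fork (fstP (fstP (fstP input)))
         (Fork (fstP (sndP (fstP (fstP input)))) (sndP input))) WS)) x1 x2"
    by (simp add: x2_def[abs_def] x1_def[abs_def] x0_def[abs_def])
  have id2: "poly_time \<sigma> K input x2 (\<lambda>k. VPair (VPair (VPair (ctx (sit k)) (enc_rats (v k))) (enc_rats (w k))) (enc_sol (x k)))"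
    using poly_time_input_val[OF poly_time_output[OF F2]] by (simp add: x2_def[abs_def] x1_def[abs_def] x0_def[abs_def])
  have Ek: "poly_time \<sigma> K E (\<lambda>k. VPair (code (fst (sit k))) (enc_sol (x k))) (\<lambda>k. enc_rats (eva (sit k) (x k)))"
    using poly_time_call[OF E_time, of K "\<lambda>k. (sit k, x k)" \<sigma>] sit feas
      poly_bounded_add[OF pb\<tau> poly_time_output[OF poly_time_snd[OF id2]]] by simp
  have "poly_time \<sigma> K (Then (Fork (fstP (fstP (fstP (fstP input)))) (sndP input)) E) x2
      (\<lambda>k. enc_rats (eva (sit k) (x k)))"
    by (intro poly_time_Then[OF _ Ek] poly_time_Fork poly_time_snd[OF id2]
        poly_time_fst[OF poly_time_fst[OF poly_time_fst[OF poly_time_fst[OF id2]]]])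
  from poly_time_Fork[OF id2 this]
  have F3: "poly_time \<sigma> K (Fork input (Then (Fork (fstP (fstP (fstP (fstP input)))) (sndP input)) E)) x2 x3"
    by (simp add: x3_def[abs_def] x2_def[abs_def] x1_def[abs_def] x0_def[abs_def])
  note pb3 = poly_time_output[OF F3]
  have id3: "poly_time \<sigma> K input x3 (\<lambda>k. VPair (VPair (VPair (VPair (ctx (sit k)) (enc_rats (v k))) (enc_rats (w k)))
      (enc_sol (x k))) (enc_rats (eva (sit k) (x k))))"
    using poly_time_input_val[OF pb3] by (simp add: x3_def[abs_def] x2_def[abs_def] x1_def[abs_def] x0_def[abs_def])
  have y: "poly_time \<sigma> K (Fork (constP (VNum 1)) (sndP input)) x3 (\<lambda>k. enc_rats (1 # eva (sit k) (x k)))"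
    by (intro poly_time_cons_rats poly_time_const[OF pb3] poly_time_snd[OF id3])
  have found: "poly_time \<sigma> K (Fork (sndP (fstP input)) (Fork (constP (VNum 1)) (sndP input))) x3
      (\<lambda>k. enc_found (x k, 1 # eva (sit k) (x k)))"
    unfolding enc_found_def fst_conv snd_conv
    by (intro poly_time_Fork[OF _ y] poly_time_snd[OF poly_time_fst[OF id3]])
  have t: "poly_time \<sigma> K (testP CARD('d)) x3 (\<lambda>k. enc_list (map enc_found
      (if dot (hd (v k) # w k) (1 # eva (sit k) (x k)) < 0 then [(x k, 1 # eva (sit k) (x k))] else [])))"
    unfolding testP_def Let_def
  proof (intro poly_time_guard poly_time_less poly_time_dot poly_time_subset[OF found] poly_time_const[OF pb3])
    show "poly_time \<sigma> K (Fork (fstP (sndP (fstP (fstP (fstP input))))) (sndP (fstP (fstP input)))) x3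
        (\<lambda>k. enc_rats (hd (v k) # w k))"
      by (intro poly_time_cons_rats poly_time_hd[OF poly_time_snd[OF poly_time_fst[OF poly_time_fst[OF poly_time_fst[OF id3]]]]]
          poly_time_snd[OF poly_time_fst[OF poly_time_fst[OF id3]]], rule len)
    show "poly_time \<sigma> K (Fork (constP (VNum 1)) (sndP input)) x3 (\<lambda>k. enc_rats (1 # eva (sit k) (x k)))"
      by (rule y)
  qed (use lenw ev[OF feas] in auto)
  show ?thesis
    unfolding judgeP_def judge_def Let_def x0_def[symmetric] w_def[symmetric] x_def[symmetric]
    by (rule poly_time_Then[OF F1 poly_time_Then[OF F2 poly_time_Then[OF F3 t]]])
qed

definition state_val :: "('i \<times> rat) \<times> nat \<Rightarrow> val" where
  "state_val z = VPair (ctx (fst z)) (VPair (enc_list (map enc_sol (sol_list (fst z) (snd z))))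
     (enc_vecs (gen_list (fst z) (snd z))))"

lemma before_rounds: "j < i \<Longrightarrow> i \<le> rounds s \<Longrightarrow> found s j \<noteq> []"
  unfolding rounds_def using not_less_Least[of j "\<lambda>i. found s i = []"] by simp

lemma sol_list_facts:
  assumes s: "s \<in> T" and i: "i \<le> rounds s"
  shows "inner_run.feasible_list (prob (fst s)) (sol_list s i)"
    and "set (sol_list s i) \<subseteq> reach s"
    and "length (sol_list s i) = Suc i"
proof -
  interpret inner_run "prob (fst s)" "wsa s" "eva s" "slack (snd s)" "accuracy (snd s)" "start s"
    by (rule run_loc[OF s])
  have ne: "pend (sols j) \<noteq> []" if "j < i" for j
    using before_rounds[OF that i] by (simp add: found_def gen_list_def sol_list_def)
  show "feasible_list (sol_list s i)"
    unfolding sol_list_def by (rule feasible_sols[OF ne])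
  show "set (sol_list s i) \<subseteq> reached" "length (sol_list s i) = Suc i"
    unfolding sol_list_def using sols_reached[OF ne] by auto
qed

lemma poly_time_pending:
  assumes pb: "poly_bounded (\<lambda>z. \<tau> (fst z)) K (\<lambda>z. len (state_val z))"
    and K: "K \<subseteq> {(s, i). s \<in> T \<and> i \<le> rounds s}"
  shows "poly_time (\<lambda>z. \<tau> (fst z)) K (pendingP CARD('d) WS E) state_val
    (\<lambda>z. enc_list (map enc_found (found (fst z) (snd z))))"
proof -
  have id: "poly_time (\<lambda>z. \<tau> (fst z)) K input state_val (\<lambda>z. VPair (ctx (fst z))
      (VPair (enc_list (map enc_sol (sol_list (fst z) (snd z)))) (enc_vecs (gen_list (fst z) (snd z)))))"
    using poly_time_input_val[OF pb] by (simp add: state_val_def[abs_def])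
  note G = poly_time_snd[OF poly_time_snd[OF id]]
  have facts: "length g = Suc CARD('d)" if "z \<in> K" "g \<in> set (gen_list (fst z) (snd z))" for z g
  proof -
    have s: "fst z \<in> T" "snd z \<le> rounds (fst z)"
      using that K by auto
    interpret inner_run "prob (fst (fst z))" "wsa (fst z)" "eva (fst z)" "slack (snd (fst z))"
      "accuracy (snd (fst z))" "start (fst z)"
      by (rule run_loc[OF s(1)])
    show ?thesis
      using length_gens[OF sol_list_facts(1)[OF s]] that(2) by (simp add: gen_list_def)
  qed
  have C: "poly_time (\<lambda>z. \<tau> (fst z)) K (Then (sndP (sndP input)) (candidatesP CARD('d))) state_val
      (\<lambda>z. enc_list (map enc_rats (candidates CARD('d) (gen_list (fst z) (snd z)))))"
    unfolding enc_vecs_def[symmetric]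
    by (rule poly_time_Then[OF G poly_time_candidates[OF facts poly_time_output[OF G]]])
  show ?thesis
    unfolding pendingP_def found_def pending_def
  proof (rule poly_time_collect[OF poly_time_Fork[OF poly_time_fst[OF id] C]])
    let ?K = "{(k, v). k \<in> K \<and> v \<in> set (candidates CARD('d) (gen_list (fst k) (snd k)))}"
    assume pb': "poly_bounded (\<lambda>z. \<tau> (fst (fst z))) ?K (\<lambda>z. len (VPair (ctx (fst (fst z))) (enc_rats (snd z))))"
    have K': "length (snd z) = Suc CARD('d) \<and> 0 \<le> (1 + slack (snd (fst (fst z)))) *s (vec_of (tl (snd z)) :: 'd qvec)"
      if "z \<in> ?K" for z
    proof -
      have s: "fst (fst z) \<in> T" "snd (fst z) \<le> rounds (fst (fst z))"
        using that K by auto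
      interpret inner_run "prob (fst (fst (fst z)))" "wsa (fst (fst z))" "eva (fst (fst z))" "slack (snd (fst (fst z)))"
        "accuracy (snd (fst (fst z)))" "start (fst (fst z))"
        by (rule run_loc[OF s(1)])
      have "snd z \<in> set (candidates CARD('d) (gens CARD('d) (eva (fst (fst z))) (sol_list (fst (fst z)) (snd (fst z)))))"
        using that by (auto simp: gen_list_def)
      then show ?thesis
        using cand_facts(1,4)[OF sol_list_facts(1)[OF s]] by blast
    qed
    show "poly_time (\<lambda>z. \<tau> (fst (fst z))) ?K (judgeP CARD('d) WS E) (\<lambda>z. VPair (ctx (fst (fst z))) (enc_rats (snd z)))
       (\<lambda>z. enc_list (map enc_found (judge CARD('d) (1 + slack (snd (fst (fst z))))
         (\<lambda>w. wsa (fst (fst z)) (vec_of w)) (eva (fst (fst z))) (snd z))))"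
    proof (rule poly_time_judge)
      show "poly_bounded (\<lambda>z. \<tau> (fst (fst z))) ?K (\<lambda>z. \<tau> (fst (fst z)))"
        by (rule poly_bounded_self)
    qed (use K K' pb' in auto)
  qed
qed

text \<open>The answers of the oracle have polynomial length whatever the weights are. So the lengths of the
  weights, which are computed from earlier answers, do not feed back into the lengths of later
  answers and of their images.\<close>

lemma reached_size:
  obtains a b where
    "\<And>s x. s \<in> T \<Longrightarrow> x \<in> reach s \<Longrightarrow> len (enc_sol x) \<le> a s"
    "\<And>s x. s \<in> T \<Longrightarrow> x \<in> reach s \<Longrightarrow> len (enc_rats (1 # eva s x)) \<le> b s"
    "poly_bounded \<tau> T a" "poly_bounded \<tau> T b"
proof -
  obtain n where n: "\<And>s w. s \<in> T \<Longrightarrow> 0 \<le> w \<Longrightarrow> len (enc_sol (wsa s w)) \<le> (\<tau> s + 2) ^ n"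
    using WS_size unfolding poly_bounded_def by fastforce
  define a where "a s = (\<tau> s + 2) ^ n + len (enc_sol (start s))" for s
  have a: "poly_bounded \<tau> T a"
    unfolding a_def by (intro poly_bounded_intros poly_bounded_self poly_time_output[OF WS_init])
  have xa: "len (enc_sol x) \<le> a s" if s: "s \<in> T" and x: "x \<in> reach s" for s x
  proof -
    from x consider "x = start s" | w where "0 \<le> w" "x = wsa s w"
      unfolding inner_run.reached_def[OF run_loc[OF s]] by blast
    then show ?thesis
    proof cases
      case 2
      then show ?thesis
        using n[OF s 2(1)] 2(2) by (simp add: a_def)
    qed (simp add: a_def)
  qed
  let ?J = "{(s, x). s \<in> T \<and> x \<in> reach s}"
  have "poly_bounded (\<lambda>z. \<tau> (fst z)) ?J (\<lambda>z. a (fst z))"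
    by (rule poly_bounded_reindex[OF a]) auto
  then have "poly_bounded (\<lambda>z. \<tau> (fst z)) ?J (\<lambda>z. \<tau> (fst z) + len (enc_sol (snd z)))"
    by (intro poly_bounded_add poly_bounded_self) (erule poly_bounded_mono, use xa in auto)
  then have "poly_time (\<lambda>z. \<tau> (fst z)) ?J E (\<lambda>z. VPair (code (fst (fst z))) (enc_sol (snd z)))
      (\<lambda>z. enc_rats (ev (fst (fst z)) (snd z)))"
    using inner_run.reached_feasible[OF run_loc]
    by (intro poly_time_call[OF E_time, where h = "\<lambda>z. z"]) auto
  then obtain m where m: "\<And>s x. s \<in> T \<Longrightarrow> x \<in> reach s \<Longrightarrow>
      len (enc_rats (eva s x)) \<le> (\<tau> s + 2) ^ m"
    using poly_time_output unfolding poly_bounded_def by fastforce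
  show thesis
  proof (rule that[OF xa _ a])
    show "len (enc_rats (1 # eva s x)) \<le> 1 + rat_len 1 + (\<tau> s + 2) ^ m"
      if "s \<in> T" "x \<in> reach s" for s x
      using m[OF that] by simp
    show "poly_bounded \<tau> T (\<lambda>s. 1 + rat_len 1 + (\<tau> s + 2) ^ m)"
      by (intro poly_bounded_intros poly_bounded_self)
  qed
qed

text \<open>The images found in the rounds lie in different cells of a grid whose number of cells is
  polynomial, because its dimension \<open>d\<close> is constant.\<close>

lemma found_rounds: "s \<in> T \<Longrightarrow> found s (rounds s) = []"
  and poly_bounded_rounds: "poly_bounded \<tau> T rounds"
proof -
  obtain b where b: "poly_bounded \<tau> T b"
    "\<And>s x. s \<in> T \<Longrightarrow> x \<in> reach s \<Longrightarrow> len (enc_rats (1 # eva s x)) \<le> b s"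
    using reached_size by metis
  define N where "N s = (2 * (2 * \<tau> s) * b s + 2) ^ CARD('d)" for s
  have bound: "i < N s" if s: "s \<in> T" and ne: "\<And>j. j < i \<Longrightarrow> found s j \<noteq> []" for s i
  proof -
    interpret inner_run "prob (fst s)" "wsa s" "eva s" "slack (snd s)" "accuracy (snd s)" "start s"
      by (rule run_loc[OF s])
    show ?thesis
      unfolding N_def
    proof (rule iterations_bounded)
      show "rat_len q \<le> b s" if "x \<in> reached" "q \<in> set (eva s x)" for x q
        using b(2)[OF s that(1)] len_enc_list_bounds(2)[of "VNum q" "map VNum (eva s x)"] that(2)
        by (simp add: enc_rats_def[of "eva s x"])
      have "1 \<le> snd s * of_nat (\<tau> s)"
        by (rule eps_inverse[OF s])
      \<comment> \<open>The factor two undoes the halving of the accuracy in the slack.\<close>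
      then show "1 \<le> slack (snd s) * of_nat (2 * \<tau> s)"
        by (simp add: slack_def)
      show "pend (sols j) \<noteq> []" if "j < i" for j
        using ne[OF that] by (simp add: found_def gen_list_def sol_list_def)
    qed
  qed
  have ex: "\<exists>i. found s i = []" if "s \<in> T" for s
    using bound[OF that, of "N s"] by auto
  show "found s (rounds s) = []" if "s \<in> T" for s
    unfolding rounds_def by (rule LeastI_ex[OF ex[OF that]])
  have "rounds s \<le> N s" if "s \<in> T" for s
    using bound[OF that, of "rounds s"] before_rounds[of _ "rounds s" s] by fastforce
  moreover have "poly_bounded \<tau> T N"
    unfolding N_def by (intro poly_bounded_intros poly_bounded_self b(1))
  ultimately show "poly_bounded \<tau> T rounds"
    using poly_bounded_mono by blast
qed

lemma poly_bounded_ctx: "poly_bounded \<tau> T (\<lambda>s. len (ctx s))"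
proof -
  have acc: "rat_len (accuracy \<epsilon>) \<le> 3 * rat_len \<epsilon> + 2 * rat_len 2"
    and slk: "rat_len (1 + slack \<epsilon>) \<le> 2 * (rat_len 1 + (rat_len (1 / 2) + rat_len \<epsilon>))" for \<epsilon>
    using rat_len_divide[of \<epsilon> "\<epsilon> + 2"] rat_len_add[of \<epsilon> 2]
      rat_len_mult[of "1 / 2" \<epsilon>] rat_len_add[of 1 "slack \<epsilon>"] by (simp_all add: accuracy_def slack_def)
  have le: "len (ctx s) \<le> 2 + (len (code (fst s)) + (3 * rat_len (snd s) + 2 * rat_len 2
      + 2 * (rat_len 1 + (rat_len (1 / 2) + rat_len (snd s)))))" for s
    using acc[of "snd s"] slk[of "snd s"] by (simp del: mult_Suc)
  have bound: "poly_bounded \<tau> T (\<lambda>s. 2 + (len (code (fst s)) + (3 * rat_len (snd s) + 2 * rat_len 2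
      + 2 * (rat_len 1 + (rat_len (1 / 2) + rat_len (snd s))))))"
    using code_size eps_size
    by (intro poly_bounded_intros poly_bounded_mono[OF poly_bounded_self, of T "\<lambda>s. len (code (fst s))"]
        poly_bounded_mono[OF poly_bounded_self, of T "\<lambda>s. rat_len (snd s)"]) auto
  show ?thesis
    by (rule poly_bounded_mono[OF bound le])
qed

lemma poly_bounded_state: "poly_bounded (\<lambda>z. \<tau> (fst z)) {(s, i). s \<in> T \<and> i \<le> rounds s} (\<lambda>z. len (state_val z))"
proof -
  obtain a b where ab: "\<And>s x. s \<in> T \<Longrightarrow> x \<in> reach s \<Longrightarrow> len (enc_sol x) \<le> a s"
    "\<And>s x. s \<in> T \<Longrightarrow> x \<in> reach s \<Longrightarrow> len (enc_rats (1 # eva s x)) \<le> b s"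
    "poly_bounded \<tau> T a" "poly_bounded \<tau> T b"
    using reached_size by blast
  define c where "c = len (enc_vecs (ray_lists CARD('d)))"
  define B where "B s = 2 + (len (ctx s) + ((2 + (rounds s + 1) * (a s + 1))
      + (2 + (rounds s + 1 + CARD('d)) * (b s + c + 1))))" for s
  have B: "poly_bounded \<tau> T B"
    unfolding B_def by (intro poly_bounded_intros poly_bounded_ctx poly_bounded_rounds ab)
  have "len (state_val (s, i)) \<le> B s" if s: "s \<in> T" and i: "i \<le> rounds s" for s i
  proof -
    note facts = sol_list_facts[OF s i]
    have "len (enc_list (map enc_sol (sol_list s i))) \<le> 2 + length (map enc_sol (sol_list s i)) * Suc (a s)"
      using facts(2) ab(1)[OF s] by (intro len_enc_list_le) auto
    also have "\<dots> \<le> 2 + (rounds s + 1) * (a s + 1)"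
      using facts(3) i by (auto intro!: add_mono mult_mono)
    finally have 1: "len (enc_list (map enc_sol (sol_list s i))) \<le> 2 + (rounds s + 1) * (a s + 1)" .
    have "len x \<le> b s + c" if "x \<in> set (map enc_rats (gen_list s i))" for x
    proof -
      consider y where "y \<in> set (sol_list s i)" "x = enc_rats (1 # eva s y)" | "x \<in> set (map enc_rats (ray_lists CARD('d)))"
        using \<open>x \<in> set (map enc_rats (gen_list s i))\<close> by (auto simp: gen_list_def gens_def)
      then show ?thesis
      proof cases
        case 1
        then show ?thesis
          using facts(2) ab(2)[OF s, of y] by (auto intro: trans_le_add1)
      next
        case 2
        then show ?thesis
          using len_enc_list_bounds(2) by (auto simp: c_def enc_vecs_def intro: trans_le_add2)
      qed
    qed
    then have "len (enc_vecs (gen_list s i)) \<le> 2 + length (map enc_rats (gen_list s i)) * Suc (b s + c)"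
      unfolding enc_vecs_def by (rule len_enc_list_le)
    also have "\<dots> \<le> 2 + (rounds s + 1 + CARD('d)) * (b s + c + 1)"
      using facts(3) i by (auto simp: gen_list_def gens_def ray_lists_def unit_lists_def intro!: add_mono mult_mono)
    finally show ?thesis
      using 1 by (simp add: state_val_def B_def)
  qed
  then show ?thesis
    by (intro poly_bounded_mono[OF poly_bounded_reindex[OF B, where h = fst]]) auto
qed

lemma poly_time_grow:
  "poly_time (\<lambda>z. \<tau> (fst z)) {(s, i). s \<in> T \<and> i < rounds s} (growP CARD('d) WS E) state_val
    (\<lambda>z. state_val (fst z, Suc (snd z)))"
proof -
  let ?K = "{(s, i). s \<in> T \<and> i < rounds s}"
  have sub: "?K \<subseteq> {(s, i). s \<in> T \<and> i \<le> rounds s}"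
    by auto
  note pb = poly_bounded_subset[OF poly_bounded_state sub]
  have id: "poly_time (\<lambda>z. \<tau> (fst z)) ?K input state_val (\<lambda>z. VPair (ctx (fst z))
      (VPair (enc_list (map enc_sol (sol_list (fst z) (snd z)))) (enc_vecs (gen_list (fst z) (snd z)))))"
    using poly_time_input_val[OF pb] by (simp add: state_val_def[abs_def])
  have "poly_time (\<lambda>z. \<tau> (fst z)) ?K (pendingP CARD('d) WS E) state_val
      (\<lambda>z. VPair (enc_found (hd (found (fst z) (snd z)))) (enc_list (map enc_found (tl (found (fst z) (snd z))))))"
  proof (rule poly_time_cong[OF poly_time_pending[OF pb sub] refl])
    show "VPair (enc_found (hd (found (fst z) (snd z)))) (enc_list (map enc_found (tl (found (fst z) (snd z)))))
        = enc_list (map enc_found (found (fst z) (snd z)))" if "z \<in> ?K" for z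
      using that before_rounds[of "snd z" "rounds (fst z)" "fst z"] by (cases "found (fst z) (snd z)") auto
  qed
  from poly_time_Fork[OF id poly_time_fst[OF this]]
  have F: "poly_time (\<lambda>z. \<tau> (fst z)) ?K (Fork input (fstP (pendingP CARD('d) WS E))) state_val
      (\<lambda>z. VPair (VPair (ctx (fst z)) (VPair (enc_list (map enc_sol (sol_list (fst z) (snd z))))
          (enc_vecs (gen_list (fst z) (snd z)))))
        (VPair (enc_sol (fst (hd (found (fst z) (snd z))))) (enc_rats (snd (hd (found (fst z) (snd z)))))))"
    by (simp add: enc_found_def)
  note id' = poly_time_input_val[OF poly_time_output[OF F]]
  note st = poly_time_fst[OF id'] and new = poly_time_snd[OF id']
  have "poly_time (\<lambda>z. \<tau> (fst z)) ?K (growP CARD('d) WS E) state_val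
      (\<lambda>z. VPair (ctx (fst z)) (VPair (VPair (enc_sol (fst (hd (found (fst z) (snd z)))))
          (enc_list (map enc_sol (sol_list (fst z) (snd z)))))
        (VPair (enc_rats (snd (hd (found (fst z) (snd z))))) (enc_vecs (gen_list (fst z) (snd z))))))"
    unfolding growP_def
    by (rule poly_time_Then[OF F], intro poly_time_Fork poly_time_fst[OF st] poly_time_fst[OF new]
        poly_time_snd[OF new] poly_time_fst[OF poly_time_snd[OF st]] poly_time_snd[OF poly_time_snd[OF st]])
  then show ?thesis
  proof (rule poly_time_cong)
    fix z assume "z \<in> ?K"
    then obtain s i where z: "z = (s, i)" and s: "s \<in> T" and i: "i < rounds s"
      by auto
    interpret inner_run "prob (fst s)" "wsa s" "eva s" "slack (snd s)" "accuracy (snd s)" "start s"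
      by (rule run_loc[OF s])
    have xs: "feasible_list (sol_list s i)"
      using sol_list_facts(1)[OF s] i by simp
    have fnd: "found s i = pend (sol_list s i)"
      by (simp add: found_def gen_list_def)
    then have ne: "pend (sol_list s i) \<noteq> []"
      using before_rounds[OF i order_refl] by simp
    have Suc: "sol_list s (Suc i) = grow (sol_list s i)"
      by (simp add: sol_list_def sols_Suc)
    then have "sol_list s (Suc i) = fst (hd (found s i)) # sol_list s i"
      by (simp add: grow_def fnd)
    moreover have "gen_list s (Suc i) = snd (hd (found s i)) # gen_list s i"
      unfolding gen_list_def Suc fnd using grow_step(5)[OF xs ne] .
    ultimately show "state_val (fst z, Suc (snd z)) =
      VPair (ctx (fst z)) (VPair (VPair (enc_sol (fst (hd (found (fst z) (snd z)))))
          (enc_list (map enc_sol (sol_list (fst z) (snd z)))))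
        (VPair (enc_rats (snd (hd (found (fst z) (snd z))))) (enc_vecs (gen_list (fst z) (snd z)))))"
      by (simp add: state_val_def z enc_vecs_def)
  qed simp
qed

lemma poly_time_init: "poly_time \<tau> T (initP CARD('d) WS E) (\<lambda>s. scheme_input code (fst s) (snd s)) (\<lambda>s. state_val (s, 0))"
proof -
  let ?inp = "\<lambda>s. scheme_input code (fst s) (snd s)"
  have "poly_bounded \<tau> T (\<lambda>s. len (?inp s))"
    unfolding scheme_input_def len.simps
    using code_size eps_size
    by (intro poly_bounded_intros poly_bounded_mono[OF poly_bounded_self, of T "\<lambda>s. len (code (fst s))"]
        poly_bounded_mono[OF poly_bounded_self, of T "\<lambda>s. rat_len (snd s)"]) auto
  note pb = this
  have id: "poly_time \<tau> T input ?inp (\<lambda>s. VPair (code (fst s)) (VNum (snd s)))"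
    using poly_time_input_val[OF pb] by (simp add: scheme_input_def)
  note I = poly_time_fst[OF id] and eps = poly_time_snd[OF id] and const = poly_time_const[OF pb]
  have "poly_time \<tau> T (Fork (fstP input)
         (Fork (divideP (sndP input) (addP (sndP input) (constP (VNum 2))))
           (addP (constP (VNum 1)) (multP (constP (VNum (1 / 2))) (sndP input))))) ?inp ctx"
    unfolding accuracy_def slack_def
    by (intro poly_time_Fork I poly_time_divide poly_time_add poly_time_mult eps const)
  moreover have "poly_time \<tau> T (Then (Fork (fstP input)
      (Fork (constP (VNum 1)) (constP (enc_rats (replicate CARD('d) 0))))) WS) ?inp (\<lambda>s. enc_sol (start s))"
    by (rule poly_time_Then[OF _ WS_init]) (intro poly_time_Fork I const)
  ultimately have F1: "poly_time \<tau> T (Fork (Fork (fstP input)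
         (Fork (divideP (sndP input) (addP (sndP input) (constP (VNum 2))))
           (addP (constP (VNum 1)) (multP (constP (VNum (1 / 2))) (sndP input)))))
       (Then (Fork (fstP input) (Fork (constP (VNum 1)) (constP (enc_rats (replicate CARD('d) 0))))) WS))
      ?inp (\<lambda>s. VPair (ctx s) (enc_sol (start s)))"
    by (rule poly_time_Fork)
  note id1 = poly_time_input_val[OF poly_time_output[OF F1]]
  have Es: "poly_time \<tau> T E (\<lambda>s. VPair (code (fst s)) (enc_sol (start s))) (\<lambda>s. enc_rats (eva s (start s)))"
  proof -
    have bound: "poly_bounded \<tau> T (\<lambda>s. \<tau> s + len (enc_sol (start s)))"
      by (intro poly_bounded_add poly_bounded_self poly_time_output[OF WS_init])
    have "(s, start s) \<in> {(s, x). s \<in> T \<and> real_sol x \<in> feasible (prob (fst s))}" if "s \<in> T" for s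
      using that ws[of 1 0 "fst s"] by (simp add: ws_approx_def)
    then show ?thesis
      using poly_time_call[OF E_time _, of T "\<lambda>s. (s, start s)" \<tau>] bound by auto
  qed
  have "poly_time \<tau> T (Then (Fork (fstP (fstP input)) (sndP input)) E) (\<lambda>s. VPair (ctx s) (enc_sol (start s)))
      (\<lambda>s. enc_rats (eva s (start s)))"
    by (rule poly_time_Then[OF _ Es]) (intro poly_time_Fork poly_time_fst[OF poly_time_fst[OF id1]] poly_time_snd[OF id1])
  note F2 = poly_time_Fork[OF id1 this]
  note pb2 = poly_time_output[OF F2]
  note id2 = poly_time_input_val[OF pb2]
  have "poly_time \<tau> T (Fork (fstP (fstP input)) (Fork (singletonP (sndP (fstP input)))
       (Fork (Fork (constP (VNum 1)) (sndP input)) (constP (enc_vecs (ray_lists CARD('d)))))))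
      (\<lambda>s. VPair (VPair (ctx s) (enc_sol (start s))) (enc_rats (eva s (start s))))
      (\<lambda>s. VPair (ctx s) (VPair (enc_list (map enc_sol [start s]))
        (VPair (enc_rats (1 # eva s (start s))) (enc_vecs (ray_lists CARD('d))))))"
    by (intro poly_time_Fork poly_time_fst[OF poly_time_fst[OF id2]] poly_time_singleton
        poly_time_snd[OF poly_time_fst[OF id2]] poly_time_cons_rats poly_time_const[OF pb2] poly_time_snd[OF id2])
  from poly_time_Then[OF F1 poly_time_Then[OF F2 this]]
  show ?thesis
    unfolding initP_def
  proof (rule poly_time_cong)
    fix s assume s: "s \<in> T"
    show "state_val (s, 0) = VPair (ctx s) (VPair (enc_list (map enc_sol [start s]))
        (VPair (enc_rats (1 # eva s (start s))) (enc_vecs (ray_lists CARD('d)))))"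
      by (simp add: state_val_def gen_list_def sol_list_def inner_run.sols_0[OF run_loc[OF s]] gens_def enc_vecs_def)
  qed simp
qed

lemma poly_time_inner_prog:
  "poly_time \<tau> T (inner_prog CARD('d) WS E) (\<lambda>s. scheme_input code (fst s) (snd s)) (\<lambda>s. enc_sols (sol_list s (rounds s)))"
proof -
  have "poly_time \<tau> T (While (nonemptyP (pendingP CARD('d) WS E)) (growP CARD('d) WS E))
      (\<lambda>s. state_val (s, 0)) (\<lambda>s. state_val (s, rounds s))"
  proof (rule poly_time_While[of \<tau> T rounds _ "\<lambda>s i. state_val (s, i)"])
    let ?K = "{(s, i). s \<in> T \<and> i \<le> rounds s}"
    have "poly_time (\<lambda>z. \<tau> (fst z)) ?K (nonemptyP (pendingP CARD('d) WS E)) state_val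
        (\<lambda>z. truth (map enc_found (found (fst z) (snd z)) \<noteq> []))"
      by (rule poly_time_nonempty[OF poly_time_pending[OF poly_bounded_state order_refl]])
    then show "poly_time (\<lambda>z. \<tau> (fst z)) ?K (nonemptyP (pendingP CARD('d) WS E))
        (\<lambda>z. state_val (fst z, snd z)) (\<lambda>z. truth (snd z < rounds (fst z)))"
    proof (rule poly_time_cong)
      fix z assume z: "z \<in> ?K"
      have "found (fst z) (snd z) \<noteq> [] \<longleftrightarrow> snd z < rounds (fst z)"
        using z before_rounds[of "snd z" "rounds (fst z)" "fst z"] found_rounds[of "fst z"]
        by (auto simp: le_less)
      then show "truth (snd z < rounds (fst z)) = truth (map enc_found (found (fst z) (snd z)) \<noteq> [])"
        by simp
    qed simp
    show "poly_time (\<lambda>z. \<tau> (fst z)) {(s, i). s \<in> T \<and> i < rounds s} (growP CARD('d) WS E)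
        (\<lambda>z. state_val (fst z, snd z)) (\<lambda>z. state_val (fst z, Suc (snd z)))"
      using poly_time_grow by simp
  qed (rule poly_bounded_rounds)
  from poly_time_Then[OF poly_time_init this]
  have "poly_time \<tau> T (Then (initP CARD('d) WS E) (While (nonemptyP (pendingP CARD('d) WS E)) (growP CARD('d) WS E)))
      (\<lambda>s. scheme_input code (fst s) (snd s))
      (\<lambda>s. VPair (ctx s) (VPair (enc_sols (sol_list s (rounds s))) (enc_vecs (gen_list s (rounds s)))))"
    by (simp add: state_val_def enc_sols_def)
  then show ?thesis
    unfolding inner_prog_def by (intro poly_time_fst poly_time_snd)
qed

lemma inner_prog_correct:
  assumes s: "s \<in> T"
  shows "inner_algorithm_output (\<lambda>x. objective (prob (fst s)) (real_sol x)) (wsa s) (slack (snd s))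
      (start s) (set (sol_list s (rounds s)))"
    and "convex_approx_set (prob (fst s)) (1 + of_rat (snd s)) (real_sol ` set (sol_list s (rounds s)))"
proof -
  interpret inner_run "prob (fst s)" "wsa s" "eva s" "slack (snd s)" "accuracy (snd s)" "start s"
    by (rule run_loc[OF s])
  have ne: "pend (sols j) \<noteq> []" if "j < rounds s" for j
    using before_rounds[OF that order_refl] by (simp add: found_def gen_list_def sol_list_def)
  have e: "pend (sols (rounds s)) = []"
    using found_rounds[OF s] by (simp add: found_def gen_list_def sol_list_def)
  show "inner_algorithm_output (\<lambda>x. objective (prob (fst s)) (real_sol x)) (wsa s) (slack (snd s))
      (start s) (set (sol_list s (rounds s)))"
    unfolding sol_list_def by (rule output_sols[OF ne e])
  show "convex_approx_set (prob (fst s)) (1 + of_rat (snd s)) (real_sol ` set (sol_list s (rounds s)))"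
    unfolding sol_list_def by (rule convex_approx_sols[OF ne e accuracy_slack(3)[OF pos[OF s]]])
qed

end

section \<open>Approximation schemes\<close>

lemma inj_enc_list: "enc_list xs = enc_list ys \<Longrightarrow> xs = ys"
  by (induction xs arbitrary: ys; case_tac ys) auto

lemma inj_enc_sol: "enc_sol x = enc_sol y \<Longrightarrow> x = y"
proof -
  assume "enc_sol x = enc_sol y"
  then have "map VNum (list_of_vec x) = map VNum (list_of_vec y)"
    unfolding enc_sol_def by (rule inj_enc_list)
  then have "list_of_vec x = list_of_vec y"
    using inj_map_eq_map[of VNum] by (simp add: inj_def)
  then show "x = y"
    by (metis vec_list)
qed

lemma inj_enc_sols: "enc_sols xs = enc_sols ys \<Longrightarrow> xs = ys"
  unfolding enc_sols_def using inj_map_eq_map[of enc_sol xs ys] inj_enc_sol inj_enc_list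
  by (metis injI)

text \<open>Programs are deterministic and the encoding is injective, so the answer is unique.\<close>

lemma ws_fun_run:
  fixes w :: "rat ^ 'd::enum"
  assumes "ws_approx_scheme code (prob :: 'i \<Rightarrow> 'd momilp) WS" "0 < \<epsilon>" "0 \<le> w"
  shows "\<exists>t. run WS (ws_input code I \<epsilon> w) t (enc_sol (ws_fun code WS I \<epsilon> w))"
    and "ws_approx (prob I) (1 + of_rat \<epsilon>) (real_vec w) (real_sol (ws_fun code WS I \<epsilon> w))"
proof -
  obtain t x where x: "run WS (ws_input code I \<epsilon> w) t (enc_sol x)"
      "ws_approx (prob I) (1 + of_rat \<epsilon>) (real_vec w) (real_sol x)"
    using assms unfolding ws_approx_scheme_def by blast
  have "ws_fun code WS I \<epsilon> w = x"
    unfolding ws_fun_def using x(1) run_deterministic inj_enc_sol by blast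
  then show "\<exists>t. run WS (ws_input code I \<epsilon> w) t (enc_sol (ws_fun code WS I \<epsilon> w))"
    "ws_approx (prob I) (1 + of_rat \<epsilon>) (real_vec w) (real_sol (ws_fun code WS I \<epsilon> w))"
    using x by auto
qed

lemma objective_polytimeE:
  assumes "objective_polytime code (prob :: 'i \<Rightarrow> 'd::enum momilp)"
  obtains E p ev where "\<And>I x. real_sol x \<in> feasible (prob I) \<Longrightarrow>
    \<exists>t. run E (VPair (code I) (enc_sol x)) t (enc_rats (ev I x))
      \<and> real t \<le> poly p (ilen code I + real (len (enc_sol x)))"
    "\<And>I x. real_sol x \<in> feasible (prob I) \<Longrightarrow>
      length (ev I x) = CARD('d) \<and> real_vec (vec_of (ev I x)) = objective (prob I) (real_sol x)"
proof -
  obtain E p where "\<forall>I x. real_sol x \<in> feasible (prob I) \<longrightarrow>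
     (\<exists>t y. run E (VPair (code I) (enc_sol x)) t (enc_vec y)
        \<and> real_vec y = objective (prob I) (real_sol x)
        \<and> real t \<le> poly p (ilen code I + real (len (enc_sol x))))"
    using assms unfolding objective_polytime_def by blast
  then obtain y t where y: "\<And>I x. real_sol x \<in> feasible (prob I) \<Longrightarrow>
      run E (VPair (code I) (enc_sol x)) (t I x) (enc_vec (y I x))
        \<and> real_vec (y I x) = objective (prob I) (real_sol x)
        \<and> real (t I x) \<le> poly p (ilen code I + real (len (enc_sol x)))"
    by metis
  show thesis
    by (rule that[of E "\<lambda>I x. coords (y I x)" p]) (use y in \<open>auto simp: enc_vec_eq vec_of_coords\<close>)
qed

lemma poly_bounded_poly:
  assumes "poly_bounded \<sigma> K h" "\<And>k. k \<in> K \<Longrightarrow> 0 \<le> r k \<and> r k \<le> real (h k)"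
    and "\<And>k. k \<in> K \<Longrightarrow> real (g k) \<le> poly p (r k)"
  shows "poly_bounded \<sigma> K g"
proof -
  obtain n where n: "\<And>s r. 0 \<le> r \<Longrightarrow> r \<le> real s \<Longrightarrow> poly p r \<le> real ((s + 2) ^ n)"
    using poly_le_power[of p] by blast
  show ?thesis
  proof (rule poly_bounded_mono)
    show "poly_bounded \<sigma> K (\<lambda>k. (h k + 2) ^ n)"
      by (intro poly_bounded_intros assms(1))
    show "g k \<le> (h k + 2) ^ n" if "k \<in> K" for k
    proof -
      have "real (g k) \<le> real ((h k + 2) ^ n)"
        using assms(2,3)[OF that] n by (meson order_trans)
      then show ?thesis
        by (simp only: of_nat_le_iff)
    qed
  qed
qed

lemma poly_time_poly:
  assumes "poly_bounded \<sigma> K h" "\<And>k. k \<in> K \<Longrightarrow> 0 \<le> r k \<and> r k \<le> real (h k)"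
    and "\<And>k. k \<in> K \<Longrightarrow> \<exists>t. run P (x k) t (y k) \<and> real t \<le> poly p (r k)"
  shows "poly_time \<sigma> K P x y"
proof -
  obtain t where t: "\<And>k. k \<in> K \<Longrightarrow> run P (x k) (t k) (y k) \<and> real (t k) \<le> poly p (r k)"
    using assms(3) by metis
  have "poly_bounded \<sigma> K t"
    by (rule poly_bounded_poly[OF assms(1,2)]) (use t in auto)
  then show ?thesis
    by (rule poly_timeI) (use t in auto)
qed

definition instance_size :: "('i \<Rightarrow> val) \<Rightarrow> 'i \<times> rat \<Rightarrow> nat" where
  "instance_size code s = nat \<lceil>ilen code (fst s) + eps_len (snd s)\<rceil>"

lemma ilen_nonneg: "0 \<le> ilen code I" and eps_len_nonneg: "0 < \<epsilon> \<Longrightarrow> 0 \<le> eps_len \<epsilon>"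
  by (auto simp: ilen_def eps_len_def)

lemma instance_size_bounds:
  assumes "0 < snd s"
  shows "ilen code (fst s) + eps_len (snd s) \<le> real (instance_size code s)"
    and "real (instance_size code s) \<le> ilen code (fst s) + eps_len (snd s) + 1"
    and "len (code (fst s)) \<le> instance_size code s" and "rat_len (snd s) \<le> instance_size code s"
    and "1 \<le> snd s * of_nat (instance_size code s)"
proof -
  have nn: "0 \<le> ilen code (fst s) + eps_len (snd s)"
    using assms ilen_nonneg[of code "fst s"] eps_len_nonneg by simp
  show le: "ilen code (fst s) + eps_len (snd s) \<le> real (instance_size code s)"
    unfolding instance_size_def using nn by linarith
  show "real (instance_size code s) \<le> ilen code (fst s) + eps_len (snd s) + 1"
    unfolding instance_size_def using nn by linarith
  have inv: "0 \<le> 1 / real_of_rat (snd s)"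
    using assms by simp
  show "len (code (fst s)) \<le> instance_size code s" "rat_len (snd s) \<le> instance_size code s"
    using le inv unfolding ilen_def eps_len_def by linarith+
  have "1 / real_of_rat (snd s) \<le> real (instance_size code s)"
    using le by (simp add: ilen_def eps_len_def)
  then have "1 \<le> real_of_rat (snd s) * real (instance_size code s)"
    using assms by (simp add: field_simps)
  then have "real_of_rat 1 \<le> real_of_rat (snd s * of_nat (instance_size code s))"
    by (simp add: of_rat_mult)
  then show "1 \<le> snd s * of_nat (instance_size code s)"
    by (simp only: of_rat_less_eq)
qed

text \<open>The bounds of a fully polynomial algorithm refer to the accuracy that it is called with; this
  turns them into bounds in terms of \<open>\<epsilon>\<close>.\<close>

lemma eps_len_accuracy:
  assumes "0 < \<epsilon>"
  shows "eps_len (accuracy \<epsilon>) \<le> 3 * eps_len \<epsilon> + (2 * real (rat_len 2) + 1)"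
proof -
  have "rat_len (accuracy \<epsilon>) \<le> 3 * rat_len \<epsilon> + 2 * rat_len 2"
    using rat_len_divide[of \<epsilon> "\<epsilon> + 2"] rat_len_add[of \<epsilon> 2] by (simp add: accuracy_def)
  then have "real (rat_len (accuracy \<epsilon>)) \<le> 3 * real (rat_len \<epsilon>) + 2 * real (rat_len 2)"
    by linarith
  moreover have "1 / real_of_rat (accuracy \<epsilon>) = 2 * (1 / real_of_rat \<epsilon>) + 1"
    using assms by (simp add: accuracy_def of_rat_divide of_rat_add field_simps)
  moreover have "0 \<le> 1 / real_of_rat \<epsilon>"
    using assms by simp
  ultimately show ?thesis
    unfolding eps_len_def
    by (simp only: distrib_left)
qed

lemma coords_zero: "coords (0 :: rat ^ 'd::enum) = replicate CARD('d) 0"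
  by (rule nth_equalityI) (simp_all add: coords_def card_UNIV_length_enum)

text \<open>Both kinds of schemes provide polynomial bounds in the length of the instance, the length of
  the weight and, on a suitable set \<open>T\<close> of instances with accuracies, the size of the accuracy.\<close>

lemma inner_program_intro:
  fixes code :: "'i \<Rightarrow> val" and prob :: "'i \<Rightarrow> 'd::enum momilp"
  assumes prob: "momilp_class code prob"
    and E: "\<And>I x. real_sol x \<in> feasible (prob I) \<Longrightarrow>
      \<exists>t. run E (VPair (code I) (enc_sol x)) t (enc_rats (ev I x))
        \<and> real t \<le> poly pE (ilen code I + real (len (enc_sol x)))"
    and ev: "\<And>I x. real_sol x \<in> feasible (prob I) \<Longrightarrow>
      length (ev I x) = CARD('d) \<and> real_vec (vec_of (ev I x)) = objective (prob I) (real_sol x)"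
    and WS: "ws_approx_scheme code prob WS"
    and pos: "\<And>s. s \<in> T \<Longrightarrow> 0 < snd s"
    and time: "\<And>I \<epsilon> w t y. (I, \<epsilon>) \<in> T \<Longrightarrow> 0 \<le> (w :: 'd qvec) \<Longrightarrow> run WS (ws_input code I (accuracy \<epsilon>) w) t y \<Longrightarrow>
      real t \<le> poly pT (ilen code I + real (len (enc_vec w)) + eps_len (accuracy \<epsilon>))"
    and size: "\<And>I \<epsilon> w t y. (I, \<epsilon>) \<in> T \<Longrightarrow> 0 \<le> (w :: 'd qvec) \<Longrightarrow> run WS (ws_input code I (accuracy \<epsilon>) w) t y \<Longrightarrow>
      real (len y) \<le> poly pS (ilen code I)"
    and init: "\<And>I t y. run WS (ws_input code I 1 (0 :: 'd qvec)) t y \<Longrightarrow> real t \<le> poly p0 (ilen code I)"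
  shows "inner_program code prob WS E ev (ws_fun code WS) T (instance_size code)"
proof
  let ?\<tau> = "instance_size code"
  note sz = instance_size_bounds[OF pos]
  note ws = ws_fun_run[OF WS]
  have ilen: "ilen code (fst s) \<le> real (?\<tau> s)" "eps_len (snd s) \<le> real (?\<tau> s)" if "s \<in> T" for s
    using sz(1)[OF that, of code] ilen_nonneg[of code "fst s"] eps_len_nonneg[OF pos[OF that]] by auto
  show "images (prob I) \<subseteq> {y. 0 \<le> y}" for I
    using prob by (simp add: momilp_class_def)
  show "ws_approx (prob I) (1 + of_rat \<epsilon>) (real_vec w) (real_sol (ws_fun code WS I \<epsilon> w))"
    if "0 < \<epsilon>" "0 \<le> w" for I \<epsilon> and w :: "'d qvec"
    using ws(2)[OF that] .
  show "length (ev I x) = CARD('d) \<and> real_vec (vec_of (ev I x)) = objective (prob I) (real_sol x)"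
    if "real_sol x \<in> feasible (prob I)" for I x
    using ev[OF that] .
  show "poly_time (\<lambda>z. ?\<tau> (fst z) + len (enc_rats (snd z)))
      {(s, w). s \<in> T \<and> length w = CARD('d) \<and> 0 \<le> (vec_of w :: 'd qvec)} WS
      (\<lambda>z. VPair (code (fst (fst z))) (VPair (VNum (accuracy (snd (fst z)))) (enc_rats (snd z))))
      (\<lambda>z. enc_sol (ws_fun code WS (fst (fst z)) (accuracy (snd (fst z))) (vec_of (snd z) :: 'd qvec)))"
    (is "poly_time ?\<sigma> ?K _ _ _")
  proof (rule poly_time_poly)
    let ?c = "2 * rat_len 2 + 1"
    \<comment> \<open>The size of the accuracy is at most three times that of \<open>\<epsilon>\<close>, up to a constant.\<close>
    show "poly_bounded ?\<sigma> ?K (\<lambda>z. 4 * ?\<sigma> z + ?c)"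
      by (intro poly_bounded_add poly_bounded_mult poly_bounded_const poly_bounded_self)
    fix z assume z: "z \<in> ?K"
    then obtain I \<epsilon> w where zeq: "z = ((I, \<epsilon>), w)" and s: "(I, \<epsilon>) \<in> T" and w: "length w = CARD('d)"
        "0 \<le> (vec_of w :: 'd qvec)"
      by auto
    have eps: "0 < \<epsilon>"
      using pos[OF s] by simp
    have acc: "0 < accuracy \<epsilon>"
      using accuracy_slack(1)[OF eps] .
    let ?r = "ilen code I + real (len (enc_rats w)) + eps_len (accuracy \<epsilon>)"
    have "?r \<le> real (4 * ?\<sigma> z + ?c)"
      using ilen[OF s] eps_len_accuracy[OF eps] by (simp add: zeq)
    moreover have "0 \<le> ?r"
      using ilen_nonneg[of code I] eps_len_nonneg[OF acc] by simp
    ultimately show "0 \<le> ilen code (fst (fst z)) + real (len (enc_rats (snd z))) + eps_len (accuracy (snd (fst z)))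
        \<and> ilen code (fst (fst z)) + real (len (enc_rats (snd z))) + eps_len (accuracy (snd (fst z))) \<le> real (4 * ?\<sigma> z + ?c)"
      by (simp add: zeq)
    obtain t where t: "run WS (ws_input code I (accuracy \<epsilon>) (vec_of w :: 'd qvec)) t
        (enc_sol (ws_fun code WS I (accuracy \<epsilon>) (vec_of w :: 'd qvec)))"
      using ws(1)[OF acc w(2)] by blast
    have "enc_vec (vec_of w :: 'd qvec) = enc_rats w"
      by (simp add: enc_vec_eq coords_vec_of w(1))
    then show "\<exists>t. run WS (VPair (code (fst (fst z))) (VPair (VNum (accuracy (snd (fst z)))) (enc_rats (snd z)))) t
        (enc_sol (ws_fun code WS (fst (fst z)) (accuracy (snd (fst z))) (vec_of (snd z) :: 'd qvec)))
        \<and> real t \<le> poly pT (ilen code (fst (fst z)) + real (len (enc_rats (snd z))) + eps_len (accuracy (snd (fst z))))"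
      using t time[OF s w(2) t] by (auto simp: zeq ws_input_def)
  qed
  show "poly_bounded (\<lambda>z. ?\<tau> (fst z)) {(s, w). s \<in> T \<and> 0 \<le> w}
      (\<lambda>z. len (enc_sol (ws_fun code WS (fst (fst z)) (accuracy (snd (fst z))) (snd z :: 'd qvec))))"
  proof (rule poly_bounded_poly[OF poly_bounded_self])
    fix z :: "('i \<times> rat) \<times> 'd qvec" assume z: "z \<in> {(s, w). s \<in> T \<and> 0 \<le> w}"
    then have s: "(fst (fst z), snd (fst z)) \<in> T" "0 \<le> snd z"
      by auto
    show "0 \<le> ilen code (fst (fst z)) \<and> ilen code (fst (fst z)) \<le> real (?\<tau> (fst z))"
      using ilen(1)[OF s(1)] ilen_nonneg[of code] by simp
    have "0 < accuracy (snd (fst z))"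
      using accuracy_slack(1) pos[OF s(1)] by simp
    then show "real (len (enc_sol (ws_fun code WS (fst (fst z)) (accuracy (snd (fst z))) (snd z))))
        \<le> poly pS (ilen code (fst (fst z)))"
      using ws(1)[of _ "snd z"] size[OF s] s(2) by blast
  qed
  show "poly_time ?\<tau> T WS
      (\<lambda>s. VPair (code (fst s)) (VPair (VNum 1) (enc_rats (replicate CARD('d) 0))))
      (\<lambda>s. enc_sol (ws_fun code WS (fst s) 1 (0 :: 'd qvec)))"
  proof (rule poly_time_poly[OF poly_bounded_self])
    fix s assume s: "s \<in> T"
    show "0 \<le> ilen code (fst s) \<and> ilen code (fst s) \<le> real (?\<tau> s)"
      using ilen(1)[OF s] ilen_nonneg[of code] by simp
    obtain t where "run WS (ws_input code (fst s) 1 (0 :: 'd qvec)) t (enc_sol (ws_fun code WS (fst s) 1 (0 :: 'd qvec)))"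
      using ws(1)[of 1 0] by auto
    then show "\<exists>t. run WS (VPair (code (fst s)) (VPair (VNum 1) (enc_rats (replicate CARD('d) 0)))) t
        (enc_sol (ws_fun code WS (fst s) 1 (0 :: 'd qvec))) \<and> real t \<le> poly p0 (ilen code (fst s))"
      using init by (auto simp: ws_input_def enc_vec_eq coords_zero)
  qed
  show "poly_time (\<lambda>z. ?\<tau> (fst z) + len (enc_sol (snd z)))
      {(s, x). s \<in> T \<and> real_sol x \<in> feasible (prob (fst s))} E
      (\<lambda>z. VPair (code (fst (fst z))) (enc_sol (snd z))) (\<lambda>z. enc_rats (ev (fst (fst z)) (snd z)))"
  proof (rule poly_time_poly[OF poly_bounded_self])
    fix z assume z: "z \<in> {(s, x). s \<in> T \<and> real_sol x \<in> feasible (prob (fst s))}"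
    show "0 \<le> ilen code (fst (fst z)) + real (len (enc_sol (snd z))) \<and>
        ilen code (fst (fst z)) + real (len (enc_sol (snd z))) \<le> real (?\<tau> (fst z) + len (enc_sol (snd z)))"
      using z ilen(1)[of "fst z"] ilen_nonneg[of code "fst (fst z)"] by auto
    show "\<exists>t. run E (VPair (code (fst (fst z))) (enc_sol (snd z))) t (enc_rats (ev (fst (fst z)) (snd z))) \<and>
        real t \<le> poly pE (ilen code (fst (fst z)) + real (len (enc_sol (snd z))))"
      using z E by auto
  qed
  show "0 < snd s" "len (code (fst s)) \<le> ?\<tau> s" "rat_len (snd s) \<le> ?\<tau> s"
    "1 \<le> snd s * of_nat (?\<tau> s)" if "s \<in> T" for s
    using pos[OF that] sz(3-5)[OF that] by blast+
qed

text \<open>One run with a bounded time bounds all, since runs are deterministic. Rounding up has added at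
  most one to the size, whence the constant three.\<close>

lemma run_poly_bound:
  assumes "poly_time (instance_size code) T P x y" "\<And>s. s \<in> T \<Longrightarrow> 0 < snd s"
  shows "\<exists>p. \<forall>s\<in>T. \<forall>t z. run P (x s) t z \<longrightarrow> real t \<le> poly p (ilen code (fst s) + eps_len (snd s))"
proof -
  obtain n where n: "\<And>s. s \<in> T \<Longrightarrow> \<exists>t. run P (x s) t (y s) \<and> t \<le> (instance_size code s + 2) ^ n"
    using assms(1) unfolding poly_time_def by blast
  have "real t \<le> poly ([:3, 1:] ^ n) (ilen code (fst s) + eps_len (snd s))"
    if s: "s \<in> T" and t: "run P (x s) t z" for s t z
  proof -
    have "t \<le> (instance_size code s + 2) ^ n"
      using n[OF s] run_deterministic[OF t] by blast
    then have "real t \<le> real ((instance_size code s + 2) ^ n)"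
      by (simp only: of_nat_le_iff)
    also have "\<dots> = (real (instance_size code s) + 2) ^ n"
      by (simp add: add.commute)
    also have "\<dots> \<le> (ilen code (fst s) + eps_len (snd s) + 3) ^ n"
      using instance_size_bounds(2)[OF assms(2)[OF s], of code] by (intro power_mono) auto
    also have "\<dots> = poly ([:3, 1:] ^ n) (ilen code (fst s) + eps_len (snd s))"
      by (simp add: poly_power add.commute)
    finally show ?thesis .
  qed
  then show ?thesis
    by blast
qed

lemma inner_prog_built:
  fixes code :: "'i \<Rightarrow> val" and prob :: "'i \<Rightarrow> 'd::enum momilp"
  assumes prog: "\<And>\<epsilon>. 0 < \<epsilon> \<Longrightarrow>
      \<exists>T. (\<forall>I. (I, \<epsilon>) \<in> T) \<and> inner_program code prob WS E ev (ws_fun code WS) T (instance_size code)"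
    and init: "\<And>I t y. run WS (ws_input code I 1 (0 :: 'd qvec)) t y \<Longrightarrow> real t \<le> poly p0 (ilen code I)"
    and WS: "ws_approx_scheme code prob WS"
  shows "built_by_inner_approximation code prob WS (inner_prog CARD('d) WS E)"
    and "convex_approx_scheme code prob (inner_prog CARD('d) WS E)"
proof -
  let ?S = "inner_prog CARD('d) WS E" and ?init = "\<lambda>I. ws_fun code WS I 1 (0 :: 'd qvec)"
  have main: "\<exists>t xs. run ?S (scheme_input code I \<epsilon>) t (enc_sols xs)
      \<and> inner_algorithm_output (\<lambda>x. objective (prob I) (real_sol x)) (ws_fun code WS I (accuracy \<epsilon>))
          (slack \<epsilon>) (?init I) (set xs)
      \<and> convex_approx_set (prob I) (1 + of_rat \<epsilon>) (real_sol ` set xs)" if eps: "0 < \<epsilon>" for I \<epsilon>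
  proof -
    obtain T where T: "(I, \<epsilon>) \<in> T" and "inner_program code prob WS E ev (ws_fun code WS) T (instance_size code)"
      using prog[OF eps] by blast
    then interpret inner_program code prob WS E ev "ws_fun code WS" T "instance_size code"
      by blast
    show ?thesis
      using poly_time_inner_prog inner_prog_correct[OF T] T unfolding poly_time_def by fastforce
  qed
  then show "convex_approx_scheme code prob ?S"
    unfolding convex_approx_scheme_def by blast
  show "built_by_inner_approximation code prob WS ?S"
    unfolding built_by_inner_approximation_def
  proof (intro exI conjI allI impI)
    show "0 < slack \<epsilon>" "0 < accuracy \<epsilon>" if "0 < \<epsilon>" for \<epsilon>
      using accuracy_slack[OF that] by auto
    show "real_sol (?init I) \<in> feasible (prob I)" for I
      using ws_fun_run(2)[OF WS, of 1 0 I] by (simp add: ws_approx_def)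
    show "real (len (enc_sol (?init I))) \<le> poly p0 (ilen code I)" for I
    proof -
      obtain t where t: "run WS (ws_input code I 1 (0 :: 'd qvec)) t (enc_sol (?init I))"
        using ws_fun_run(1)[OF WS, of 1 0 I] by auto
      show ?thesis
        using len_le_time[OF t] init[OF t] by linarith
    qed
    show "inner_algorithm_output (\<lambda>x. objective (prob I) (real_sol x)) (ws_fun code WS I (accuracy \<epsilon>))
        (slack \<epsilon>) (?init I) (set xs)"
      if eps: "0 < \<epsilon>" and r: "run ?S (scheme_input code I \<epsilon>) t (enc_sols xs)" for I \<epsilon> t xs
    proof -
      obtain t' ys where ys: "run ?S (scheme_input code I \<epsilon>) t' (enc_sols ys)"
        "inner_algorithm_output (\<lambda>x. objective (prob I) (real_sol x)) (ws_fun code WS I (accuracy \<epsilon>))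
          (slack \<epsilon>) (?init I) (set ys)"
        using main[OF eps] by blast
      then have "xs = ys"
        using run_deterministic[OF r ys(1)] inj_enc_sols by blast
      then show ?thesis
        using ys(2) by simp
    qed
  qed
qed

theorem theorem11:
  fixes code :: "'i \<Rightarrow> val"
    and prob :: "'i \<Rightarrow> 'd::enum momilp"
    and WS :: prog
  assumes "momilp_class code prob"
  shows "(ws_PTAS code prob WS \<longrightarrow>
            (\<exists>S. built_by_inner_approximation code prob WS S \<and> cPTAS code prob S))
       \<and> (ws_FPTAS code prob WS \<longrightarrow>
            (\<exists>S. built_by_inner_approximation code prob WS S \<and> cFPTAS code prob S))"
proof -
  have OP: "objective_polytime code prob"
    using assms by (simp add: momilp_class_def)
  obtain E pE ev where E: "\<And>I x. real_sol x \<in> feasible (prob I) \<Longrightarrow>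
    \<exists>t. run E (VPair (code I) (enc_sol x)) t (enc_rats (ev I x))
      \<and> real t \<le> poly pE (ilen code I + real (len (enc_sol x)))"
    and ev: "\<And>I x. real_sol x \<in> feasible (prob I) \<Longrightarrow>
      length (ev I x) = CARD('d) \<and> real_vec (vec_of (ev I x)) = objective (prob I) (real_sol x)"
    by (rule objective_polytimeE[OF OP]) (rule that)
  let ?S = "inner_prog CARD('d) WS E"
  let ?W = "\<lambda>T. inner_program code prob WS E ev (ws_fun code WS) T (instance_size code)"
  note intro = inner_program_intro[OF assms E ev]
  have PTAS: "built_by_inner_approximation code prob WS ?S \<and> cPTAS code prob ?S" if P: "ws_PTAS code prob WS"
  proof -
    have WS: "ws_approx_scheme code prob WS"
      using P by (simp add: ws_PTAS_def)
    have time: "\<exists>p. \<forall>I. \<forall>w :: 'd qvec. 0 \<le> w \<longrightarrow> (\<forall>t y. run WS (ws_input code I \<epsilon> w) t y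
        \<longrightarrow> real t \<le> poly p (ilen code I + real (len (enc_vec w))))"
      and size: "\<exists>p. \<forall>I. \<forall>w :: 'd qvec. 0 \<le> w \<longrightarrow> (\<forall>t y. run WS (ws_input code I \<epsilon> w) t y
        \<longrightarrow> real (len y) \<le> poly p (ilen code I))" if "0 < \<epsilon>" for \<epsilon>
      using P that unfolding ws_PTAS_def by simp_all
    have one: "(0 :: rat) < 1"
      by simp
    obtain p where "\<forall>I. \<forall>w :: 'd qvec. 0 \<le> w \<longrightarrow> (\<forall>t y. run WS (ws_input code I 1 w) t y
        \<longrightarrow> real t \<le> poly p (ilen code I + real (len (enc_vec w))))"
      using one time by blast
    then have p: "real t \<le> poly p (ilen code I + real (len (enc_vec (0 :: 'd qvec))))"
      if "run WS (ws_input code I 1 (0 :: 'd qvec)) t y" for I t y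
      using that by blast
    define p0 where "p0 = p \<circ>\<^sub>p [:real (len (enc_vec (0 :: 'd qvec))), 1:]"
    have init: "real t \<le> poly p0 (ilen code I)" if "run WS (ws_input code I 1 (0 :: 'd qvec)) t y" for I t y
      using p[OF that] by (simp add: p0_def poly_pcompose add.commute)
    have prog: "?W (UNIV \<times> {\<epsilon>})" if eps: "0 < \<epsilon>" for \<epsilon>
    proof -
      have acc: "0 < accuracy \<epsilon>"
        using accuracy_slack(1)[OF eps] .
      obtain pT where pT: "\<And>I (w :: 'd qvec) t y. 0 \<le> w \<Longrightarrow> run WS (ws_input code I (accuracy \<epsilon>) w) t y
          \<Longrightarrow> real t \<le> poly pT (ilen code I + real (len (enc_vec w)))"
        using time[OF acc] by blast
      obtain pS where pS: "\<And>I (w :: 'd qvec) t y. 0 \<le> w \<Longrightarrow> run WS (ws_input code I (accuracy \<epsilon>) w) t y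
          \<Longrightarrow> real (len y) \<le> poly pS (ilen code I)"
        using size[OF acc] by blast
      \<comment> \<open>The accuracy is fixed, so its contribution to the size can be subtracted again.\<close>
      define pT' where "pT' = pT \<circ>\<^sub>p [:- eps_len (accuracy \<epsilon>), 1:]"
      have pT': "real t \<le> poly pT' (ilen code I + real (len (enc_vec w)) + eps_len (accuracy \<epsilon>))"
        if "0 \<le> w" "run WS (ws_input code I (accuracy \<epsilon>) w) t y" for I t y and w :: "'d qvec"
        using pT[OF that] by (simp add: pT'_def poly_pcompose)
      show ?thesis
        by (rule intro[OF _ _ WS _ _ _ init]) (use eps pT' pS in auto)
    qed
    have ex: "\<exists>T. (\<forall>I. (I, \<epsilon>) \<in> T) \<and> ?W T" if "0 < \<epsilon>" for \<epsilon>
      using prog[OF that] by (intro exI[of _ "UNIV \<times> {\<epsilon>}"] conjI) simp_all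
    have built: "built_by_inner_approximation code prob WS ?S" "convex_approx_scheme code prob ?S"
      by (rule inner_prog_built[OF ex init WS]; assumption)+
    have "\<exists>q. \<forall>I t y. run ?S (scheme_input code I \<epsilon>) t y \<longrightarrow> real t \<le> poly q (ilen code I)" if eps: "0 < \<epsilon>" for \<epsilon>
    proof -
      obtain q where q: "\<And>I t y. run ?S (scheme_input code I \<epsilon>) t y \<Longrightarrow> real t \<le> poly q (ilen code I + eps_len \<epsilon>)"
        using run_poly_bound[OF inner_program.poly_time_inner_prog[OF prog[OF eps]]] eps by fastforce
      show ?thesis
        by (intro exI[of _ "q \<circ>\<^sub>p [:eps_len \<epsilon>, 1:]"]) (use q in \<open>auto simp: poly_pcompose add.commute\<close>)
    qed
    then show ?thesis
      using built unfolding cPTAS_def by blast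
  qed
  have FPTAS: "built_by_inner_approximation code prob WS ?S \<and> cFPTAS code prob ?S" if P: "ws_FPTAS code prob WS"
  proof -
    have WS: "ws_approx_scheme code prob WS"
      using P by (simp add: ws_FPTAS_def)
    have time: "\<exists>p. \<forall>I. \<forall>\<epsilon>>0. \<forall>w :: 'd qvec. 0 \<le> w \<longrightarrow> (\<forall>t y. run WS (ws_input code I \<epsilon> w) t y
        \<longrightarrow> real t \<le> poly p (ilen code I + real (len (enc_vec w)) + eps_len \<epsilon>))"
      and size: "\<exists>p. \<forall>I. \<forall>\<epsilon>>0. \<forall>w :: 'd qvec. 0 \<le> w \<longrightarrow> (\<forall>t y. run WS (ws_input code I \<epsilon> w) t y
        \<longrightarrow> real (len y) \<le> poly p (ilen code I))"
      using P unfolding ws_FPTAS_def by simp_all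
    obtain pT where pT: "\<And>I \<epsilon> (w :: 'd qvec) t y. 0 < \<epsilon> \<Longrightarrow> 0 \<le> w \<Longrightarrow> run WS (ws_input code I \<epsilon> w) t y
          \<Longrightarrow> real t \<le> poly pT (ilen code I + real (len (enc_vec w)) + eps_len \<epsilon>)"
      using time by blast
    obtain pS where pS: "\<And>I \<epsilon> (w :: 'd qvec) t y. 0 < \<epsilon> \<Longrightarrow> 0 \<le> w \<Longrightarrow> run WS (ws_input code I \<epsilon> w) t y
          \<Longrightarrow> real (len y) \<le> poly pS (ilen code I)"
      using size by blast
    define p0 where "p0 = pT \<circ>\<^sub>p [:real (len (enc_vec (0 :: 'd qvec))) + eps_len 1, 1:]"
    have init: "real t \<le> poly p0 (ilen code I)" if "run WS (ws_input code I 1 (0 :: 'd qvec)) t y" for I t y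
      using pT[OF _ _ that] by (simp add: p0_def poly_pcompose add_ac)
    have prog: "?W {(I, \<epsilon>). 0 < \<epsilon>}"
      by (rule intro[where pT = pT and pS = pS, OF _ _ WS _ _ _ init])
        (auto intro: pT[OF accuracy_slack(1)] pS[OF accuracy_slack(1)])
    have ex: "\<exists>T. (\<forall>I. (I, \<epsilon>) \<in> T) \<and> ?W T" if "0 < \<epsilon>" for \<epsilon>
      using prog that by (intro exI[of _ "{(I, \<epsilon>). 0 < \<epsilon>}"] conjI) simp_all
    have built: "built_by_inner_approximation code prob WS ?S" "convex_approx_scheme code prob ?S"
      by (rule inner_prog_built[OF ex init WS]; assumption)+
    obtain q where "\<And>I \<epsilon> t y. 0 < \<epsilon> \<Longrightarrow> run ?S (scheme_input code I \<epsilon>) t y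
        \<Longrightarrow> real t \<le> poly q (ilen code I + eps_len \<epsilon>)"
      using run_poly_bound[OF inner_program.poly_time_inner_prog[OF prog]] by fastforce
    then show ?thesis
      using built unfolding cFPTAS_def by blast
  qed
  show ?thesis
    using PTAS FPTAS by blast
qed

end
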